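(* $\mathcal G[-1]$ is a Gerstenhaber algebra under the disjoint union product and the bracket $[X,Y]^\phi=(-1)^{x}[X,Y]$ ($X$ an oriented graph with $x$ vertices). Explicitly: the product on $\mathcal G$ is associative and graded commutative with respect to the number of vertices; $[\cdot,\cdot]^\phi$ is a graded Lie bracket with respect to the shifted degree $|X|=x-1$; and for oriented graphs $X,Y,Z$ (with $|X|=x-1$, $|Y|=y-1$), $$[X,Y\cdot Z]^\phi=[X,Y]^\phi\cdot Z+(-1)^{|X|(|Y|+1)}\,Y\cdot[X,Z]^\phi .$$
   Context: Graded Lie bracket on a graded vector space $V$: a bilinear map $[\cdot,\cdot]:V\times V\to V$ with $[v,w]=-(-1)^{|v||w|}[w,v]$ and $[u,[v,w]]+(-1)^{|w|(|u|+|v|)}[w,[u,v]]+(-1)^{|u|(|v|+|w|)}[v,[w,u]]=0$ for homogeneous $u,v,w$. Graphs. A graph is a finite 1-dimensional CW complex (not necessarily connected, multiple edges allowed, the empty graph allowed) all of whose vertices have valence at least 3. A labelling of a graph is a numbering $1,2,\dots$ of its vertices together with an arrow on each edge. An orientation is an equivalence class of labellings: reversing the arrow on one edge, or switching the numbers of two vertices, changes the orientation to the opposite one. $\mathcal G$ is the vector space, over a fixed field of characteristic zero, of linear combinations of (isomorphism classes of) oriented graphs modulo $(X,or)=-(X,-or)$; it is graded by the number of vertices. $\mathcal G[-1]$ is $\mathcal G$ with the grading shifted down by 1. A graph with a loop is zero in $\mathcal G$, so graphs may be assumed loopless. The orientation is suppressed from the notation. Collapse. For a (non-loop) edge $e$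 of $X$, $X_e$ is obtained by collapsing $e$ to a point. Induced orientation: represent the orientation of $X$ by a labelling in which the initial vertex of $e$ is 1 and the terminal vertex is 2; in $X_e$ the vertex resulting from the collapse is numbered 1, the numbers of all other vertices are reduced by one, and arrows on uncontracted edges are unchanged. Half-edges. Each half-edge $h$ begins at a vertex $v(h)$, lies in an edge $e(h)$, and has a complementary half-edge $\bar h$ with $e(h)=h\cup\bar h$. For distinct half-edges $h,k$ with $k\ne\bar h$, $X\langle hk\rangle$ is obtained by cutting $e(h)$ and $e(k)$ at their midpoints and gluing $h$ to $k$ and $\bar h$ to $\bar k$; orientation: represent the orientation of $X$ so that $h$ is the initial half-edge of $e(h)$ and $k$ is the terminal half-edge of $e(k)$; in $X\langle hk\rangle$ the edge $h\cup k$ is directed from $h$ to $k$ and the edge $\bar h\cup\bar k$ from $\bar k$ to $\bar h$, all else unchanged. If $v(h)\ne v(k)$, $X_{hk}:=(X\langle hk\rangle)_{h\cup k}$; if $v(h)=v(k)$, $X_{hk}:=0$. $\partial_H X=\sum X_{hk}$, sum over all unordered pairs $\{h,k\}$ of distinct half-edges of $X$ with $k\neq\bar h$. Product. If $X$ has vertices numbered $1,\dots,x$ and $Y$ has vertices numbered $1,\dots,y$, then $X\cdot Y$ is the disjoint union with the vertex numbers of $Y$ shifted to $x+1,\dots,x+y$ (arrows unchanged), extended bilinearly. Bracket. $[X,Y]=\partial_H(X\cdot Y)-\partial_H(X)\cdot Y-(-1)^{x}X\cdot\partial_H(Y)$, where $X$ has $x$ vertices; equivalently $[X,Y]=\sum_{h\in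 X,\,k\in Y}(X\cdot Y)_{hk}$, the sum over half-edges $h$ of $X$ and $k$ of $Y$. Extended bilinearly. *)

theory Defs
  imports Complex_Main "HOL-Library.Poly_Mapping"
begin

section \<open>Graphs, labellings, orientations\<close>

text \<open>
  A finite 1-dimensional CW complex is given by its vertices, its half-edges, the vertex
  \<open>origin h\<close> at which a half-edge \<open>h\<close> begins, and the complementary half-edge \<open>bar h\<close>; the
  edges are the pairs \<open>{h, bar h}\<close>.  Loops, multiple edges and the empty graph are allowed.
  As graphs only matter up to isomorphism, vertices and half-edges are named by natural
  numbers.  The functions are irrelevant outside \<open>halves\<close>.
\<close>

record graph =
  verts  :: "nat set"
  halves :: "nat set"
  origin :: "nat \<Rightarrow> nat"
  bar    :: "nat \<Rightarrow> nat"

definition is_graph :: "graph \<Rightarrow> bool" where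
  "is_graph g \<longleftrightarrow> finite (verts g) \<and> finite (halves g) \<and>
     (\<forall>h\<in>halves g. origin g h \<in> verts g \<and> bar g h \<in> halves g \<and>
        bar g h \<noteq> h \<and> bar g (bar g h) = h) \<and>
     (\<forall>v\<in>verts g. 3 \<le> card {h \<in> halves g. origin g h = v})"

text \<open>
  A labelling \<open>(vs, I)\<close> lists the vertices in the order of their numbers (so the vertex
  numbered \<open>i\<close> is \<open>vs ! (i - 1)\<close>) and records the arrows by the set \<open>I\<close> of initial half-edges.
\<close>

type_synonym labelling = "nat list \<times> nat set"

definition labellings :: "graph \<Rightarrow> labelling set" where
  "labellings g = {(vs, I). distinct vs \<and> set vs = verts g \<and> I \<subseteq> halves g \<and>
     (\<forall>h\<in>halves g. h \<in> I \<longleftrightarrow> bar g h \<notin> I)}"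

inductive_set moves :: "graph \<Rightarrow> (labelling \<times> labelling) set" for g :: graph where
  reverse_arrow: "h \<in> I \<Longrightarrow> ((vs, I), (vs, insert (bar g h) (I - {h}))) \<in> moves g"
| switch_numbers: "i < j \<Longrightarrow> j < length vs \<Longrightarrow>
     ((vs, I), (vs[i := vs ! j, j := vs ! i], I)) \<in> moves g"

definition orientation_class :: "graph \<Rightarrow> labelling \<Rightarrow> labelling set" where
  "orientation_class g l = {l'. \<exists>n. even n \<and> (l, l') \<in> moves g ^^ n}"

typedef ograph =
  "{(g, or). is_graph g \<and> (\<exists>l\<in>labellings g. or = orientation_class g l)}"
proof -
  let ?g = "\<lparr>verts = {}, halves = {}, origin = id, bar = id\<rparr>"
  have "is_graph ?g" "([], {}) \<in> labellings ?g"
    by (auto simp: is_graph_def labellings_def)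
  then show ?thesis by blast
qed

definition graph_of :: "ograph \<Rightarrow> graph" where
  "graph_of X = fst (Rep_ograph X)"

definition or_of :: "ograph \<Rightarrow> labelling set" where
  "or_of X = snd (Rep_ograph X)"

definition oriented :: "graph \<Rightarrow> labelling \<Rightarrow> ograph" where
  "oriented g l = Abs_ograph (g, orientation_class g l)"

definition nverts :: "ograph \<Rightarrow> nat" where
  "nverts X = card (verts (graph_of X))"

definition ograph_iso :: "ograph \<Rightarrow> ograph \<Rightarrow> bool" where
  "ograph_iso X Y \<longleftrightarrow> (\<exists>\<phi> \<psi>.
     bij_betw \<phi> (verts (graph_of X)) (verts (graph_of Y)) \<and>
     bij_betw \<psi> (halves (graph_of X)) (halves (graph_of Y)) \<and>
     (\<forall>h\<in>halves (graph_of X).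
        origin (graph_of Y) (\<psi> h) = \<phi> (origin (graph_of X) h) \<and>
        bar (graph_of Y) (\<psi> h) = \<psi> (bar (graph_of X) h)) \<and>
     (\<lambda>(vs, I). (map \<phi> vs, \<psi> ` I)) ` or_of X = or_of Y)"

text \<open>
  \<open>X\<close> and \<open>Y\<close> are the same graph with opposite orientations.  The empty graph has a single
  labelling, hence a single orientation, and is opposite to nothing.
\<close>

definition opposite :: "ograph \<Rightarrow> ograph \<Rightarrow> bool" where
  "opposite X Y \<longleftrightarrow> graph_of X = graph_of Y \<and>
     (\<exists>l\<in>or_of X. \<exists>l'\<in>or_of Y. (l, l') \<in> moves (graph_of X))"

section \<open>Operations on oriented graphs\<close>

text \<open>
  Choosing a labelling with \<open>SOME\<close> represents the orientation by a labelling of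
  the required form.
\<close>

definition disjoint_union :: "graph \<Rightarrow> graph \<Rightarrow> graph" where
  "disjoint_union g g' = \<lparr>
     verts = (\<lambda>v. 2 * v) ` verts g \<union> (\<lambda>v. 2 * v + 1) ` verts g',
     halves = (\<lambda>h. 2 * h) ` halves g \<union> (\<lambda>h. 2 * h + 1) ` halves g',
     origin = (\<lambda>h. if even h then 2 * origin g (h div 2) else 2 * origin g' (h div 2) + 1),
     bar = (\<lambda>h. if even h then 2 * bar g (h div 2) else 2 * bar g' (h div 2) + 1)\<rparr>"

definition ograph_prod :: "ograph \<Rightarrow> ograph \<Rightarrow> ograph"  (infixl \<open>\<odot>\<close> 70) where
  "X \<odot> Y = (let (vs, I) = (SOME l. l \<in> or_of X); (ws, J) = (SOME l. l \<in> or_of Y) in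
     oriented (disjoint_union (graph_of X) (graph_of Y))
       (map (\<lambda>v. 2 * v) vs @ map (\<lambda>v. 2 * v + 1) ws,
        (\<lambda>h. 2 * h) ` I \<union> (\<lambda>h. 2 * h + 1) ` J))"

text \<open>
  \<open>reglue X h k\<close> is \<open>X\<langle>hk\<rangle>\<close>.  With \<open>h\<close> initial in its edge and \<open>k\<close> terminal in its edge, the
  initial half-edges of these two edges are \<open>h\<close> and \<open>bar k\<close>.  These are also to be the initial
  half-edges of the new edges \<open>{h, k}\<close> and \<open>{bar h, bar k}\<close>, so the labelling does not change.
\<close>

definition reglue :: "ograph \<Rightarrow> nat \<Rightarrow> nat \<Rightarrow> ograph" where
  "reglue X h k = (let g = graph_of X in
     oriented (g\<lparr>bar := (bar g)(h := k, k := h, bar g h := bar g k, bar g k := bar g h)\<rparr>)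
       (SOME l. l \<in> or_of X \<and> h \<in> snd l \<and> k \<notin> snd l))"

text \<open>
  \<open>collapse X h\<close> is \<open>X\<^sub>e\<close> for the (non-loop) edge \<open>e = {h, bar h}\<close>.  The vertex resulting from
  the collapse is named \<open>origin h\<close>, whichever end of \<open>e\<close> is the initial one.
\<close>

definition collapse :: "ograph \<Rightarrow> nat \<Rightarrow> ograph" where
  "collapse X h = (let g = graph_of X; a = origin g h; b = origin g (bar g h);
     (vs, I) = (SOME l. l \<in> or_of X \<and>
        (\<exists>i\<in>{h, bar g h}. i \<in> snd l \<and> take 2 (fst l) = [origin g i, origin g (bar g i)])) in
     oriented
       (g\<lparr>verts := verts g - {b}, halves := halves g - {h, bar g h},
          origin := (\<lambda>j. if origin g j = b then a else origin g j)\<rparr>)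
       (a # drop 2 vs, I - {h, bar g h}))"

section \<open>The space of oriented graphs\<close>

definition fscale :: "'k::field_char_0 \<Rightarrow> (ograph \<Rightarrow>\<^sub>0 'k) \<Rightarrow> (ograph \<Rightarrow>\<^sub>0 'k)" where
  "fscale c p = Poly_Mapping.map ((*) c) p"

lemma lookup_fscale: "Poly_Mapping.lookup (fscale c p) X = c * Poly_Mapping.lookup p X"
  by (simp add: fscale_def Poly_Mapping.map.rep_eq when_def)

interpretation F: vector_space "fscale :: 'k::field_char_0 \<Rightarrow> _"
  by unfold_locales
    (auto intro!: poly_mapping_eqI simp: lookup_fscale lookup_add algebra_simps)

definition relators :: "(ograph \<Rightarrow>\<^sub>0 'k::field_char_0) set" where
  "relators =
     {Poly_Mapping.single X 1 - Poly_Mapping.single Y 1 | X Y. ograph_iso X Y} \<union>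
     {Poly_Mapping.single X 1 + Poly_Mapping.single Y 1 | X Y. opposite X Y}"

definition graph_rel :: "(ograph \<Rightarrow>\<^sub>0 'k::field_char_0) \<Rightarrow> (ograph \<Rightarrow>\<^sub>0 'k) \<Rightarrow> bool" where
  "graph_rel p q \<longleftrightarrow> p - q \<in> F.span relators"

quotient_type (overloaded) 'k graph_space = "ograph \<Rightarrow>\<^sub>0 'k::field_char_0" / graph_rel
proof (rule equivpI)
  show "reflp (graph_rel :: (ograph \<Rightarrow>\<^sub>0 'k) \<Rightarrow> _)"
    by (auto simp: reflp_def graph_rel_def F.span_zero)
  show "symp (graph_rel :: (ograph \<Rightarrow>\<^sub>0 'k) \<Rightarrow> _)"
    using F.span_neg[of "p - q" relators for p q :: "ograph \<Rightarrow>\<^sub>0 'k"]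
    by (auto simp: symp_def graph_rel_def)
  show "transp (graph_rel :: (ograph \<Rightarrow>\<^sub>0 'k) \<Rightarrow> _)"
    using F.span_add[of "p - q" relators "q - r" for p q r :: "ograph \<Rightarrow>\<^sub>0 'k"]
    by (auto simp: transp_def graph_rel_def)
qed

instantiation graph_space :: (field_char_0) ab_group_add
begin

lift_definition zero_graph_space :: "'a graph_space" is 0 .

lift_definition plus_graph_space :: "'a graph_space \<Rightarrow> 'a graph_space \<Rightarrow> 'a graph_space"
  is "(+)" unfolding graph_rel_def by (subst add_diff_add) (rule F.span_add)

lift_definition uminus_graph_space :: "'a graph_space \<Rightarrow> 'a graph_space"
  is uminus unfolding graph_rel_def by (subst minus_diff_minus) (rule F.span_neg)

lift_definition minus_graph_space :: "'a graph_space \<Rightarrow> 'a graph_space \<Rightarrow> 'a graph_space"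
  is "(-)"
proof -
  fix p p' q q' :: "ograph \<Rightarrow>\<^sub>0 'a"
  assume "graph_rel p p'" "graph_rel q q'"
  then have "(p - p') - (q - q') \<in> F.span relators"
    unfolding graph_rel_def by (rule F.span_diff)
  then show "graph_rel (p - q) (p' - q')"
    by (simp add: graph_rel_def algebra_simps)
qed

instance
  by standard (transfer; simp add: graph_rel_def F.span_zero algebra_simps)+

end

lift_definition gscale :: "'k::field_char_0 \<Rightarrow> 'k graph_space \<Rightarrow> 'k graph_space"  (infixr \<open>*\<^sub>G\<close> 75)
  is fscale unfolding graph_rel_def
  by (subst F.scale_right_diff_distrib [symmetric]) (rule F.span_scale)

interpretation G: vector_space "gscale :: 'k::field_char_0 \<Rightarrow> _"
  by unfold_locales
    (transfer; simp add: graph_rel_def F.span_zero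
       F.scale_right_distrib F.scale_left_distrib)+

lift_definition cls :: "ograph \<Rightarrow> 'k::field_char_0 graph_space" is "\<lambda>X. Poly_Mapping.single X 1" .

definition graph_degree :: "int \<Rightarrow> 'k::field_char_0 graph_space set" where
  "graph_degree n = G.span {cls X | X. int (nverts X) = n}"

section \<open>Graded structures\<close>

text \<open>Throughout, \<open>s\<close> is the scalar multiplication of a vector space graded by the subspaces \<open>V i\<close>.\<close>

definition graded_space ::
  "('k::field \<Rightarrow> 'a::ab_group_add \<Rightarrow> 'a) \<Rightarrow> (int \<Rightarrow> 'a set) \<Rightarrow> bool" where
  "graded_space s V \<longleftrightarrow> vector_space s \<and> (\<forall>i. module.subspace s (V i)) \<and>
     (\<forall>v. \<exists>!f. finite {i. f i \<noteq> 0} \<and> (\<forall>i. f i \<in> V i) \<and> v = (\<Sum>i | f i \<noteq> 0. f i))"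

definition bilinear_map ::
  "('k::field \<Rightarrow> 'a::ab_group_add \<Rightarrow> 'a) \<Rightarrow> ('a \<Rightarrow> 'a \<Rightarrow> 'a) \<Rightarrow> bool" where
  "bilinear_map s B \<longleftrightarrow>
     (\<forall>a. Vector_Spaces.linear s s (\<lambda>b. B a b)) \<and> (\<forall>b. Vector_Spaces.linear s s (\<lambda>a. B a b))"

definition graded_commutative_product ::
  "('k::field \<Rightarrow> 'a::ab_group_add \<Rightarrow> 'a) \<Rightarrow> (int \<Rightarrow> 'a set) \<Rightarrow> ('a \<Rightarrow> 'a \<Rightarrow> 'a) \<Rightarrow> bool" where
  "graded_commutative_product s V m \<longleftrightarrow> bilinear_map s m \<and>
     (\<forall>i j. \<forall>u\<in>V i. \<forall>v\<in>V j. m u v \<in> V (i + j)) \<and>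
     (\<forall>u v w. m (m u v) w = m u (m v w)) \<and>
     (\<forall>i j. \<forall>u\<in>V i. \<forall>v\<in>V j. m u v = s ((-1) powi (i * j)) (m v u))"

definition graded_lie_bracket ::
  "('k::field \<Rightarrow> 'a::ab_group_add \<Rightarrow> 'a) \<Rightarrow> (int \<Rightarrow> 'a set) \<Rightarrow> ('a \<Rightarrow> 'a \<Rightarrow> 'a) \<Rightarrow> bool" where
  "graded_lie_bracket s V br \<longleftrightarrow> bilinear_map s br \<and>
     (\<forall>i j. \<forall>u\<in>V i. \<forall>v\<in>V j. br u v \<in> V (i + j)) \<and>
     (\<forall>i j. \<forall>u\<in>V i. \<forall>v\<in>V j. br u v = - s ((-1) powi (i * j)) (br v u)) \<and>
     (\<forall>i j k. \<forall>u\<in>V i. \<forall>v\<in>V j. \<forall>w\<in>V k.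
        br u (br v w) + s ((-1) powi (k * (i + j))) (br w (br u v))
          + s ((-1) powi (i * (j + k))) (br v (br w u)) = 0)"

definition shift_down :: "(int \<Rightarrow> 'a set) \<Rightarrow> int \<Rightarrow> 'a set" where
  "shift_down V i = V (i + 1)"

text \<open>
  In a Gerstenhaber algebra the bracket has degree 0 for the grading \<open>V\<close>, while the product is
  graded commutative for the grading in which the elements of \<open>V i\<close> have degree \<open>i + 1\<close>.
\<close>

definition gerstenhaber_algebra ::
  "('k::field \<Rightarrow> 'a::ab_group_add \<Rightarrow> 'a) \<Rightarrow> (int \<Rightarrow> 'a set) \<Rightarrow>
     ('a \<Rightarrow> 'a \<Rightarrow> 'a) \<Rightarrow> ('a \<Rightarrow> 'a \<Rightarrow> 'a) \<Rightarrow> bool" where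
  "gerstenhaber_algebra s V m br \<longleftrightarrow> graded_space s V \<and>
     graded_commutative_product s (\<lambda>n. V (n - 1)) m \<and>
     graded_lie_bracket s V br \<and>
     (\<forall>i j k. \<forall>u\<in>V i. \<forall>v\<in>V j. \<forall>w\<in>V k.
        br u (m v w) = m (br u v) w + s ((-1) powi (i * (j + 1))) (m v (br u w)))"

section \<open>Product and bracket\<close>

definition bilinear_extension ::
  "(ograph \<Rightarrow> ograph \<Rightarrow> 'k::field_char_0 graph_space) \<Rightarrow>
     ('k graph_space \<Rightarrow> 'k graph_space \<Rightarrow> 'k graph_space) \<Rightarrow> bool" where
  "bilinear_extension f B \<longleftrightarrow> bilinear_map gscale B \<and> (\<forall>X Y. B (cls X) (cls Y) = f X Y)"

text \<open>
  The classes of oriented graphs span, so there is at most one bilinear extension; that there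
  is one amounts to the function on oriented graphs being compatible with the relations.
\<close>

definition gprod ::
  "'k::field_char_0 graph_space \<Rightarrow> 'k graph_space \<Rightarrow> 'k graph_space" where
  "gprod = (THE B. bilinear_extension (\<lambda>X Y. cls (X \<odot> Y)) B)"

definition X_hk :: "ograph \<Rightarrow> nat \<Rightarrow> nat \<Rightarrow> 'k::field_char_0 graph_space" where
  "X_hk X h k = (if origin (graph_of X) h = origin (graph_of X) k then 0
     else cls (collapse (reglue X h k) h))"

text \<open>Since \<open>X\<^sub>h\<^sub>k = X\<^sub>k\<^sub>h\<close>, each unordered pair is represented by its increasing ordering.\<close>

definition boundary_H :: "ograph \<Rightarrow> 'k::field_char_0 graph_space" where
  "boundary_H X = (\<Sum>(h, k) \<in> {(h, k). h \<in> halves (graph_of X) \<and> k \<in> halves (graph_of X) \<and>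
     h < k \<and> k \<noteq> bar (graph_of X) h}. X_hk X h k)"

definition ograph_bracket :: "ograph \<Rightarrow> ograph \<Rightarrow> 'k::field_char_0 graph_space" where
  "ograph_bracket X Y = boundary_H (X \<odot> Y) - gprod (boundary_H X) (cls Y)
     - (-1) ^ nverts X *\<^sub>G gprod (cls X) (boundary_H Y)"

definition gbracket ::
  "'k::field_char_0 graph_space \<Rightarrow> 'k graph_space \<Rightarrow> 'k graph_space" where
  "gbracket = (THE B. bilinear_extension ograph_bracket B)"

definition gbracket_phi ::
  "'k::field_char_0 graph_space \<Rightarrow> 'k graph_space \<Rightarrow> 'k graph_space" where
  "gbracket_phi =
     (THE B. bilinear_extension (\<lambda>X Y. (-1) ^ nverts X *\<^sub>G gbracket (cls X) (cls Y)) B)"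

definition shifted_degree :: "ograph \<Rightarrow> int" where
  "shifted_degree X = int (nverts X) - 1"

end

theory Submission
  imports Defs "HOL-Library.Multiset"
begin

text \<open>
  A function of labelled graphs which changes its sign under the moves and is invariant under
  isomorphisms induces a linear map on the space of graphs.  Any finite number of graphs may be
  taken to be disjoint with common functions \<open>origin\<close> and \<open>bar\<close>.  Then the product is the union
  with concatenated labellings, and the bracket of \<open>X\<close> and \<open>Y\<close> is the sum of the contractions
  \<open>(X \<cdot> Y)\<^sub>h\<^sub>k\<close> with \<open>h\<close> in \<open>X\<close> and \<open>k\<close> in \<open>Y\<close>, since the other terms of \<open>\<partial>\<^sub>H (X \<cdot> Y)\<close> make up
  \<open>\<partial>\<^sub>H X \<cdot> Y\<close> and \<open>\<plusminus> X \<cdot> \<partial>\<^sub>H Y\<close>.  The symmetry of the bracket and the Leibniz rule follow by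
  moving blocks of vertex numbers past each other.  An iterated bracket of three graphs is a sum
  of double contractions, of which two half-edges lie in one of the graphs and one half-edge lies
  in each of the others.  Exchanging the two contractions changes the sign, so that the terms of
  the Jacobi sum cancel in pairs.
\<close>

section \<open>Alternating functions of labellings\<close>

definition graph_iso :: "(nat \<Rightarrow> nat) \<Rightarrow> (nat \<Rightarrow> nat) \<Rightarrow> graph \<Rightarrow> graph \<Rightarrow> bool" where
  "graph_iso \<phi> \<psi> g g' \<longleftrightarrow>
     bij_betw \<phi> (verts g) (verts g') \<and> bij_betw \<psi> (halves g) (halves g') \<and>
     (\<forall>h\<in>halves g. origin g' (\<psi> h) = \<phi> (origin g h) \<and> bar g' (\<psi> h) = \<psi> (bar g h))"

definition relabel :: "(nat \<Rightarrow> nat) \<Rightarrow> (nat \<Rightarrow> nat) \<Rightarrow> labelling \<Rightarrow> labelling" where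
  "relabel \<phi> \<psi> = (\<lambda>(vs, I). (map \<phi> vs, \<psi> ` I))"

definition alternating :: "graph \<Rightarrow> (labelling \<Rightarrow> 'a::ab_group_add) \<Rightarrow> bool" where
  "alternating g F \<longleftrightarrow> (\<forall>l\<in>labellings g. \<forall>l'. (l, l') \<in> moves g \<longrightarrow> F l' = - F l)"

definition gcls :: "graph \<Rightarrow> labelling \<Rightarrow> 'k::field_char_0 graph_space" where
  "gcls g l = cls (oriented g l)"

lemma relabel_Pair [simp]: "relabel \<phi> \<psi> (vs, I) = (map \<phi> vs, \<psi> ` I)"
  by (simp add: relabel_def)

lemma is_graphD:
  assumes "is_graph g"
  shows "finite (verts g)" "finite (halves g)"
    and "\<And>h. h \<in> halves g \<Longrightarrow> origin g h \<in> verts g"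
    and "\<And>h. h \<in> halves g \<Longrightarrow> bar g h \<in> halves g"
    and "\<And>h. h \<in> halves g \<Longrightarrow> bar g h \<noteq> h"
    and "\<And>h. h \<in> halves g \<Longrightarrow> bar g (bar g h) = h"
    and "\<And>v. v \<in> verts g \<Longrightarrow> 3 \<le> card {h \<in> halves g. origin g h = v}"
  using assms by (auto simp: is_graph_def)

lemma mem_labellings:
  "(vs, I) \<in> labellings g \<longleftrightarrow> distinct vs \<and> set vs = verts g \<and> I \<subseteq> halves g \<and>
     (\<forall>h\<in>halves g. h \<in> I \<longleftrightarrow> bar g h \<notin> I)"
  by (simp add: labellings_def)

lemma labellings_flip:
  assumes "is_graph g" "(vs, I) \<in> labellings g" "h \<in> I"
  shows "(vs, insert (bar g h) (I - {h})) \<in> labellings g"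
proof -
  let ?I = "insert (bar g h) (I - {h})"
  have h: "h \<in> halves g" using assms by (auto simp: mem_labellings)
  note b = is_graphD(4-6)[OF assms(1)]
  have "j \<in> ?I \<longleftrightarrow> bar g j \<notin> ?I" if j: "j \<in> halves g" for j
  proof (cases "j = h \<or> j = bar g h")
    case True
    then show ?thesis using b[OF h] by auto
  next
    case False
    then have "bar g j \<noteq> h" "bar g j \<noteq> bar g h" using b(3)[OF h] b(3)[OF j] by metis+
    moreover have "j \<in> I \<longleftrightarrow> bar g j \<notin> I" using j assms(2) by (simp add: mem_labellings)
    ultimately show ?thesis using False by simp
  qed
  then show ?thesis using assms(2) h b(1)[OF h] unfolding mem_labellings by blast
qed

lemma movesE:
  assumes "(l, l') \<in> moves g"
  obtains (reverse_arrow) h I vs where "l = (vs, I)" "l' = (vs, insert (bar g h) (I - {h}))" "h \<in> I"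
  | (switch_numbers) i j vs I where "l = (vs, I)" "l' = (vs[i := vs ! j, j := vs ! i], I)"
      "i < j" "j < length vs"
proof -
  obtain vs I ws J where "l = (vs, I)" "l' = (ws, J)" by fastforce
  with assms that show thesis by (auto elim!: moves.cases)
qed

lemma labellings_move:
  assumes g: "is_graph g" and l: "l \<in> labellings g" and "(l, l') \<in> moves g"
  shows "l' \<in> labellings g"
  using assms(3)
proof (cases rule: movesE)
  case (reverse_arrow h I vs)
  then show ?thesis using labellings_flip[OF g] l by auto
next
  case (switch_numbers i j vs I)
  then show ?thesis using l
    by (auto simp: mem_labellings set_swap distinct_swap)
qed

lemma labellings_relpow:
  assumes "is_graph g" "l \<in> labellings g" "(l, l') \<in> moves g ^^ n"
  shows "l' \<in> labellings g"
  using assms(3) by (induction n arbitrary: l') (auto intro: assms labellings_move)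

lemma labellings_rtrancl:
  assumes "is_graph g" "l \<in> labellings g" "(l, l') \<in> (moves g)\<^sup>*"
  shows "l' \<in> labellings g"
  using assms labellings_relpow rtrancl_imp_relpow by metis

lemma alternating_relpow:
  assumes "is_graph g" "alternating g F" "l \<in> labellings g" "(l, l') \<in> moves g ^^ n"
  shows "F l' = (if even n then F l else - F l)"
  using assms(4)
proof (induction n arbitrary: l')
  case (Suc n)
  then obtain m where m: "(l, m) \<in> moves g ^^ n" "(m, l') \<in> moves g" by auto
  have "m \<in> labellings g" using labellings_relpow assms m by blast
  then have "F l' = - F m" using assms(2) m unfolding alternating_def by blast
  then show ?case using Suc.IH[OF m(1)] by auto
qed auto

lemma alternating_class:
  assumes "is_graph g" "alternating g F" "l \<in> labellings g" "l' \<in> orientation_class g l"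
  shows "F l' = F l"
proof -
  obtain n where n: "even n" "(l, l') \<in> moves g ^^ n"
    using assms(4) unfolding orientation_class_def by blast
  then show ?thesis using alternating_relpow[OF assms(1-3) n(2)] by simp
qed

lemma alternating_eqI:
  assumes "is_graph g" "alternating g F" "alternating g F'" "l \<in> labellings g"
    and "(l, l') \<in> (moves g)\<^sup>*" "F l' = F' l'"
  shows "F l = F' l"
proof -
  obtain n where n: "(l, l') \<in> moves g ^^ n" using assms(5) rtrancl_imp_relpow by blast
  show ?thesis
    using alternating_relpow[OF assms(1,2,4) n] alternating_relpow[OF assms(1,3,4) n] assms(6)
    by (auto split: if_splits)
qed

lemma in_orientation_class: "l \<in> orientation_class g l"
  unfolding orientation_class_def using relpow_0_I by (intro CollectI exI[of _ 0]) auto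

lemma swap_append:
  fixes x y :: 'a
  shows "(as @ x # ms @ y # bs)[length as := y, Suc (length as + length ms) := x]
    = as @ y # ms @ x # bs"
  by (simp add: list_update_append)

lemma move_swap: "((as @ x # ms @ y # bs, I), (as @ y # ms @ x # bs, I)) \<in> moves g"
proof -
  let ?vs = "as @ x # ms @ y # bs"
  let ?i = "length as" and ?j = "Suc (length as + length ms)"
  have "((?vs, I), (?vs[?i := ?vs ! ?j, ?j := ?vs ! ?i], I)) \<in> moves g"
    by (rule moves.switch_numbers) auto
  moreover have "?vs ! ?j = y" "?vs ! ?i = x" by (auto simp: nth_append)
  ultimately show ?thesis using swap_append[of as x ms y bs] by simp
qed

lemma move_switchE:
  assumes "i < j" "j < length vs"
  obtains as x ms y bs where "vs = as @ x # ms @ y # bs"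
    and "vs[i := vs ! j, j := vs ! i] = as @ y # ms @ x # bs"
proof -
  define as where "as = take i vs"
  define ms where "ms = take (j - Suc i) (drop (Suc i) vs)"
  define bs where "bs = drop (Suc j) vs"
  have "drop (Suc i) vs = take (j - Suc i) (drop (Suc i) vs) @ drop (Suc i) vs ! (j - Suc i) #
      drop (Suc (j - Suc i)) (drop (Suc i) vs)"
    by (rule id_take_nth_drop) (use assms in simp)
  moreover have "drop (Suc i) vs ! (j - Suc i) = vs ! j"
    "drop (Suc (j - Suc i)) (drop (Suc i) vs) = bs"
    unfolding bs_def using assms by auto
  ultimately have d: "drop (Suc i) vs = ms @ vs ! j # bs" by (simp only: ms_def)
  have v: "vs = as @ vs ! i # ms @ vs ! j # bs"
    unfolding as_def d[symmetric] by (rule id_take_nth_drop) (use assms in simp)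
  have l: "length as = i" "Suc (length as + length ms) = j"
    unfolding as_def ms_def using assms by auto
  have "vs[i := vs ! j, j := vs ! i] = vs[length as := vs ! j, Suc (length as + length ms) := vs ! i]"
    using l by simp
  also have "\<dots> = as @ vs ! j # ms @ vs ! i # bs"
    using swap_append[of as "vs ! i" ms "vs ! j" bs] unfolding v[symmetric] .
  finally have "vs[i := vs ! j, j := vs ! i] = as @ vs ! j # ms @ vs ! i # bs" .
  with v show thesis by (rule that)
qed
text \<open>A transposition is an odd product of transpositions of neighbours.\<close>

lemma swap_neighbours:
  fixes f :: "'b list \<Rightarrow> 'a::ab_group_add"
  assumes "\<And>as x y bs. mset (as @ x # y # bs) = M \<Longrightarrow> f (as @ y # x # bs) = - f (as @ x # y # bs)"
    and "mset (as @ x # ms @ y # bs) = M"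
  shows "f (as @ y # ms @ x # bs) = - f (as @ x # ms @ y # bs)"
  using assms(2)
proof (induction ms arbitrary: as)
  case Nil
  then show ?case using assms(1) by simp
next
  case (Cons m ms)
  have "f (as @ y # m # ms @ x # bs) = - f (as @ m # y # ms @ x # bs)"
    by (rule assms(1)) (use Cons.prems in \<open>simp add: add_mset_commute\<close>)
  also have "f (as @ m # y # ms @ x # bs) = - f (as @ m # x # ms @ y # bs)"
    using Cons.IH[of "as @ [m]"] Cons.prems by (simp add: add_mset_commute)
  also have "f (as @ m # x # ms @ y # bs) = - f (as @ x # m # ms @ y # bs)"
    by (rule assms(1)) (use Cons.prems in \<open>simp add: add_mset_commute\<close>)
  finally show ?case by simp
qed

lemma labellings_mset:
  assumes "(vs, I) \<in> labellings g" "mset ws = mset vs"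
  shows "(ws, I) \<in> labellings g"
  using assms mset_eq_imp_distinct_iff[OF assms(2)] mset_eq_setD[OF assms(2)]
  by (simp add: mem_labellings)

lemma alternatingI:
  assumes swap: "\<And>as x y bs I. (as @ x # y # bs, I) \<in> labellings g \<Longrightarrow>
      F (as @ y # x # bs, I) = - F (as @ x # y # bs, I)"
    and flip: "\<And>vs I h. (vs, I) \<in> labellings g \<Longrightarrow> h \<in> I \<Longrightarrow>
      F (vs, insert (bar g h) (I - {h})) = - F (vs, I)"
  shows "alternating g F"
  unfolding alternating_def
proof (intro ballI allI impI)
  fix l l' assume l: "l \<in> labellings g" and "(l, l') \<in> moves g"
  from this(2) show "F l' = - F l"
  proof (cases rule: movesE)
    case (reverse_arrow h I vs)
    then show ?thesis using l flip by simp
  next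
    case (switch_numbers i j vs I)
    obtain as x ms y bs where v: "vs = as @ x # ms @ y # bs"
      "vs[i := vs ! j, j := vs ! i] = as @ y # ms @ x # bs"
      using move_switchE switch_numbers by metis
    have "F (as @ y # ms @ x # bs, I) = - F (as @ x # ms @ y # bs, I)"
    proof (rule swap_neighbours[where f = "\<lambda>v. F (v, I)" and M = "mset vs"])
      fix as x y bs assume "mset (as @ x # y # bs) = mset vs"
      then have "(as @ x # y # bs, I) \<in> labellings g"
        using l switch_numbers(1) by (auto intro: labellings_mset)
      then show "F (as @ y # x # bs, I) = - F (as @ x # y # bs, I)" by (rule swap)
    qed (simp add: v)
    then show ?thesis using v switch_numbers by simp
  qed
qed

lemma alternating_swap:
  assumes "alternating g F" "(as @ x # ms @ y # bs, I) \<in> labellings g"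
  shows "F (as @ y # ms @ x # bs, I) = - F (as @ x # ms @ y # bs, I)"
  using assms move_swap unfolding alternating_def by blast

lemma alternating_flip:
  assumes "alternating g F" "(vs, I) \<in> labellings g" "h \<in> I"
  shows "F (vs, insert (bar g h) (I - {h})) = - F (vs, I)"
  using assms moves.reverse_arrow unfolding alternating_def by blast

lemma alternating_move_left:
  fixes F :: "labelling \<Rightarrow> 'k::field_char_0 graph_space"
  assumes "alternating g F" "(as @ xs @ y # bs, I) \<in> labellings g"
  shows "F (as @ xs @ y # bs, I) = (-1) ^ length xs *\<^sub>G F (as @ y # xs @ bs, I)"
  using assms(2)
proof (induction xs arbitrary: bs rule: rev_induct)
  case (snoc x xs)
  have l: "(as @ xs @ y # x # bs, I) \<in> labellings g"
    by (rule labellings_mset[OF snoc.prems]) simp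
  have "F (as @ (xs @ [x]) @ y # bs, I) = - F (as @ xs @ y # x # bs, I)"
    using alternating_swap[OF assms(1), of "as @ xs" y "[]" x bs I] l by simp
  also have "\<dots> = - ((-1) ^ length xs *\<^sub>G F (as @ y # xs @ x # bs, I))"
    using snoc.IH[OF l] by simp
  finally show ?case by simp
qed simp

lemma powneg1_mult: "(-1) ^ a *\<^sub>G (-1) ^ b *\<^sub>G v = ((-1) ^ (a + b) :: 'k::field_char_0) *\<^sub>G v"
  by (simp add: power_add)

lemma alternating_block_swap:
  fixes F :: "labelling \<Rightarrow> 'k::field_char_0 graph_space"
  assumes "alternating g F" "(xs @ ys @ bs, I) \<in> labellings g"
  shows "F (xs @ ys @ bs, I) = (-1) ^ (length xs * length ys) *\<^sub>G F (ys @ xs @ bs, I)"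
proof -
  have "F (as @ xs @ ys @ bs, I) = (-1) ^ (length xs * length ys) *\<^sub>G F (as @ ys @ xs @ bs, I)"
    if "(as @ xs @ ys @ bs, I) \<in> labellings g" for as
    using that
  proof (induction ys arbitrary: as)
    case (Cons y ys)
    have "F (as @ xs @ (y # ys) @ bs, I) = (-1) ^ length xs *\<^sub>G F ((as @ [y]) @ xs @ ys @ bs, I)"
      using alternating_move_left[OF assms(1), of as xs y "ys @ bs" I] Cons.prems by simp
    also have "F ((as @ [y]) @ xs @ ys @ bs, I) =
        (-1) ^ (length xs * length ys) *\<^sub>G F ((as @ [y]) @ ys @ xs @ bs, I)"
      by (rule Cons.IH) (rule labellings_mset[OF Cons.prems], simp)
    finally show ?case by (simp add: powneg1_mult del: G.scale_scale)
  qed simp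
  from this[of "[]"] assms(2) show ?thesis by simp
qed

lemma moves_to_front:
  assumes "distinct xs" "set xs \<subseteq> set vs" "distinct vs"
  shows "\<exists>r. ((vs, I), (xs @ r, I)) \<in> (moves g)\<^sup>*"
  using assms(1,2)
proof (induction xs rule: rev_induct)
  case (snoc x xs)
  then obtain r where r: "((vs, I), (xs @ r, I)) \<in> (moves g)\<^sup>*" by auto
  have "set (xs @ r) = set vs"
  proof -
    have "set (fst l') = set (fst l)" if "(l, l') \<in> (moves g)\<^sup>*" for l l'
      using that
    proof (induction rule: rtrancl_induct)
      case (step y z)
      from step(2) have "set (fst z) = set (fst y)" by (cases rule: movesE) (auto simp: set_swap)
      then show ?case using step by simp
    qed simp
    from this[OF r] show ?thesis by simp
  qed
  then have "x \<in> set r" using snoc.prems by auto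
  then obtain r1 r2 where r12: "r = r1 @ x # r2" by (auto simp: in_set_conv_decomp)
  show ?case
  proof (cases r1)
    case Nil
    then show ?thesis using r r12 by auto
  next
    case (Cons y r1')
    have "((xs @ y # r1' @ x # r2, I), (xs @ x # r1' @ y # r2, I)) \<in> moves g"
      by (rule move_swap)
    then have "((vs, I), ((xs @ [x]) @ r1' @ y # r2, I)) \<in> (moves g)\<^sup>*"
      using r r12 Cons by (auto intro: rtrancl_into_rtrancl)
    then show ?thesis by blast
  qed
qed auto

lemma moves_to_initial:
  assumes g: "is_graph g" and "finite A" "A \<subseteq> halves g" "\<And>h. h \<in> A \<Longrightarrow> bar g h \<notin> A"
    and "(vs, I) \<in> labellings g"
  shows "\<exists>J. ((vs, I), (vs, J)) \<in> (moves g)\<^sup>* \<and> A \<subseteq> J"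
  using assms(2-4)
proof (induction A rule: finite_induct)
  case empty
  then show ?case by auto
next
  case (insert h A)
  then obtain J where J: "((vs, I), (vs, J)) \<in> (moves g)\<^sup>*" "A \<subseteq> J" by auto
  show ?case
  proof (cases "h \<in> J")
    case True
    then show ?thesis using J by auto
  next
    case False
    have "(vs, J) \<in> labellings g" using labellings_rtrancl[OF g assms(5)] J by blast
    then have b: "bar g h \<in> J"
      using False insert.prems by (auto simp: mem_labellings)
    have "((vs, J), (vs, insert (bar g (bar g h)) (J - {bar g h}))) \<in> moves g"
      by (rule moves.reverse_arrow) (rule b)
    moreover have "bar g (bar g h) = h" using is_graphD(6)[OF g] insert.prems by auto
    moreover have "A \<subseteq> J - {bar g h}" using J insert.prems by auto
    ultimately show ?thesis
      using J(1) by (intro exI[of _ "insert h (J - {bar g h})"]) (auto intro: rtrancl_into_rtrancl)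
  qed
qed

lemma moves_to_standard:
  assumes g: "is_graph g" and l: "l \<in> labellings g"
    and "distinct xs" "set xs \<subseteq> verts g"
    and "A \<subseteq> halves g" "\<And>h. h \<in> A \<Longrightarrow> bar g h \<notin> A"
  obtains r J where "(l, (xs @ r, J)) \<in> (moves g)\<^sup>*" "A \<subseteq> J" "(xs @ r, J) \<in> labellings g"
proof -
  obtain vs I where vI: "l = (vs, I)" by (cases l)
  have "distinct vs" "set vs = verts g" using l vI by (auto simp: mem_labellings)
  then obtain r where r: "((vs, I), (xs @ r, I)) \<in> (moves g)\<^sup>*"
    using moves_to_front assms by metis
  have "(xs @ r, I) \<in> labellings g" using labellings_rtrancl[OF g _ r] l vI by auto
  then obtain J where J: "((xs @ r, I), (xs @ r, J)) \<in> (moves g)\<^sup>*" "A \<subseteq> J"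
    using moves_to_initial[OF g _ assms(5,6)] is_graphD(2)[OF g] finite_subset assms(5) by metis
  then have "(l, (xs @ r, J)) \<in> (moves g)\<^sup>*" using r vI by auto
  then show thesis using that J labellings_rtrancl[OF g l] by blast
qed

lemma alternating_eq_standard:
  assumes g: "is_graph g" and F: "alternating g F" "alternating g F'"
    and xs: "distinct xs" "set xs \<subseteq> verts g"
    and A: "A \<subseteq> halves g" "\<And>h. h \<in> A \<Longrightarrow> bar g h \<notin> A"
    and eq: "\<And>r J. (xs @ r, J) \<in> labellings g \<Longrightarrow> A \<subseteq> J \<Longrightarrow> F (xs @ r, J) = F' (xs @ r, J)"
    and l: "l \<in> labellings g"
  shows "F l = F' l"
  using moves_to_standard[OF g l xs A] alternating_eqI[OF g F l] eq by metis

lemma class_standard: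
  assumes g: "is_graph g" and l: "l \<in> labellings g"
    and xs: "distinct xs" "set xs \<subseteq> verts g"
    and A: "A \<subseteq> halves g" "\<And>h. h \<in> A \<Longrightarrow> bar g h \<notin> A"
    and h: "h \<in> halves g" "h \<notin> A" "bar g h \<notin> A"
  shows "\<exists>r J. (xs @ r, J) \<in> orientation_class g l \<and> A \<subseteq> J"
proof -
  obtain r J where rJ: "(l, (xs @ r, J)) \<in> (moves g)\<^sup>*" "A \<subseteq> J" "(xs @ r, J) \<in> labellings g"
    using moves_to_standard[OF g l xs A] by metis
  obtain n where n: "(l, (xs @ r, J)) \<in> moves g ^^ n" using rJ rtrancl_imp_relpow by metis
  show ?thesis
  proof (cases "even n")
    case True
    then show ?thesis using n rJ unfolding orientation_class_def by blast
  next
    case False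
    have "h \<in> J \<or> bar g h \<in> J" using rJ(3) h by (auto simp: mem_labellings)
    then obtain j where j: "j \<in> J" "j \<in> {h, bar g h}" by blast
    have "((xs @ r, J), (xs @ r, insert (bar g j) (J - {j}))) \<in> moves g"
      by (rule moves.reverse_arrow) (rule j)
    then have "(l, (xs @ r, insert (bar g j) (J - {j}))) \<in> moves g ^^ Suc n" using n by auto
    moreover have "A \<subseteq> insert (bar g j) (J - {j})" using j h rJ by auto
    moreover have "even (Suc n)" using False by simp
    ultimately show ?thesis unfolding orientation_class_def by blast
  qed
qed

section \<open>Classes of labelled graphs\<close>

lemma ograph_cases:
  obtains l where "is_graph (graph_of X)" "l \<in> labellings (graph_of X)"
    "or_of X = orientation_class (graph_of X) l" "X = oriented (graph_of X) l"
proof -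
  have "Rep_ograph X = (graph_of X, or_of X)" by (simp add: graph_of_def or_of_def)
  moreover from this have "X = Abs_ograph (graph_of X, or_of X)" by (metis Rep_ograph_inverse)
  ultimately show thesis using Rep_ograph[of X] that by (auto simp: oriented_def)
qed

lemma is_graph_graph_of [simp]: "is_graph (graph_of X)"
  using ograph_cases by blast

lemma or_of_subset:
  assumes "l \<in> or_of X"
  shows "l \<in> labellings (graph_of X)"
proof -
  obtain l0 where l0: "l0 \<in> labellings (graph_of X)" "or_of X = orientation_class (graph_of X) l0"
    using ograph_cases by metis
  obtain n where "(l0, l) \<in> moves (graph_of X) ^^ n"
    using assms l0(2) unfolding orientation_class_def by blast
  then show ?thesis using labellings_relpow l0(1) is_graph_graph_of by metis
qed

lemma or_of_nonempty: "\<exists>l. l \<in> or_of X"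
  using ograph_cases[of X] in_orientation_class by metis

lemma graph_of_oriented:
  assumes "is_graph g" "l \<in> labellings g"
  shows "graph_of (oriented g l) = g" "or_of (oriented g l) = orientation_class g l"
proof -
  have "(g, orientation_class g l) \<in> {(g, or). is_graph g \<and> (\<exists>l\<in>labellings g. or = orientation_class g l)}"
    using assms by blast
  then show "graph_of (oriented g l) = g" "or_of (oriented g l) = orientation_class g l"
    by (auto simp: graph_of_def or_of_def oriented_def Abs_ograph_inverse)
qed

lemma alternating_or_of:
  assumes "alternating (graph_of X) F" "l \<in> or_of X" "l' \<in> or_of X"
  shows "F l = F l'"
proof -
  obtain l0 where "l0 \<in> labellings (graph_of X)" "or_of X = orientation_class (graph_of X) l0"
    using ograph_cases by metis
  then show ?thesis using alternating_class[OF is_graph_graph_of assms(1)] assms by metis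
qed

lemma cls_iso: "ograph_iso X Y \<Longrightarrow> (cls X :: 'k::field_char_0 graph_space) = cls Y"
  by transfer (auto simp: graph_rel_def relators_def intro!: F.span_base)

lemma cls_opposite: "opposite X Y \<Longrightarrow> (cls Y :: 'k::field_char_0 graph_space) = - cls X"
  by transfer (auto simp: graph_rel_def relators_def ac_simps intro!: F.span_base)

lemma gcls_alternating:
  assumes g: "is_graph g"
  shows "alternating g (gcls g :: _ \<Rightarrow> 'k::field_char_0 graph_space)"
  unfolding alternating_def gcls_def
proof (intro ballI allI impI cls_opposite)
  fix l l' assume l: "l \<in> labellings g" and m: "(l, l') \<in> moves g"
  have l': "l' \<in> labellings g" using labellings_move[OF g l m] .
  show "opposite (oriented g l) (oriented g l')"
    unfolding opposite_def graph_of_oriented[OF g l] graph_of_oriented[OF g l']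
    using m in_orientation_class by blast
qed

lemma cls_eq_gcls:
  assumes "l \<in> or_of X"
  shows "(cls X :: 'k::field_char_0 graph_space) = gcls (graph_of X) l"
proof -
  obtain l0 where l0: "l0 \<in> or_of X" "X = oriented (graph_of X) l0"
    using ograph_cases[of X] in_orientation_class by metis
  have "(cls X :: 'k graph_space) = gcls (graph_of X) l0" using l0 by (simp add: gcls_def)
  then show ?thesis
    using alternating_or_of[OF gcls_alternating[OF is_graph_graph_of] l0(1) assms] by simp
qed

lemma graph_isoD:
  assumes "graph_iso \<phi> \<psi> g g'"
  shows "bij_betw \<phi> (verts g) (verts g')" "bij_betw \<psi> (halves g) (halves g')"
    and "\<And>h. h \<in> halves g \<Longrightarrow> origin g' (\<psi> h) = \<phi> (origin g h)"
    and "\<And>h. h \<in> halves g \<Longrightarrow> bar g' (\<psi> h) = \<psi> (bar g h)"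
  using assms by (auto simp: graph_iso_def)

lemma relabel_labellings:
  assumes g: "is_graph g" and iso: "graph_iso \<phi> \<psi> g g'" and l: "(vs, I) \<in> labellings g"
  shows "(map \<phi> vs, \<psi> ` I) \<in> labellings g'"
proof -
  note iso = graph_isoD[OF iso]
  have inj: "inj_on \<psi> (halves g)" "\<psi> ` halves g = halves g'" "inj_on \<phi> (verts g)" "\<phi> ` verts g = verts g'"
    using iso by (auto simp: bij_betw_def)
  have I: "I \<subseteq> halves g" using l by (auto simp: mem_labellings)
  have mem: "\<psi> h \<in> \<psi> ` I \<longleftrightarrow> h \<in> I" if "h \<in> halves g" for h
    using inj(1) that I inj_on_image_mem_iff by metis
  have "h \<in> \<psi> ` I \<longleftrightarrow> bar g' h \<notin> \<psi> ` I" if h: "h \<in> halves g'" for h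
  proof -
    obtain k where k: "k \<in> halves g" "h = \<psi> k" using h inj(2) by blast
    have "k \<in> I \<longleftrightarrow> bar g k \<notin> I" using k l by (simp add: mem_labellings)
    then show ?thesis
      using mem[OF k(1)] mem[OF is_graphD(4)[OF g k(1)]] iso(4)[OF k(1)] k(2) by simp
  qed
  then show ?thesis
    using l inj I image_mono[OF I, of \<psi>] unfolding mem_labellings distinct_map set_map by simp
qed

lemma relabel_move:
  assumes g: "is_graph g" and iso: "graph_iso \<phi> \<psi> g g'" and l: "l \<in> labellings g"
    and m: "(l, l') \<in> moves g"
  shows "(relabel \<phi> \<psi> l, relabel \<phi> \<psi> l') \<in> moves g'"
  using m
proof (cases rule: movesE)
  case (reverse_arrow h I vs)
  have h: "I \<subseteq> halves g" "h \<in> halves g" using l reverse_arrow by (auto simp: mem_labellings)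
  have inj: "inj_on \<psi> (halves g)" using iso by (auto simp: graph_iso_def bij_betw_def)
  have "\<psi> ` (I - {h}) = \<psi> ` I - {\<psi> h}"
    using inj_on_image_set_diff[OF inj, of I "{h}"] h by auto
  then have eq: "\<psi> ` (insert (bar g h) (I - {h})) = insert (bar g' (\<psi> h)) (\<psi> ` I - {\<psi> h})"
    using graph_isoD(4)[OF iso h(2)] by simp
  show ?thesis
    unfolding reverse_arrow relabel_Pair eq
    by (rule moves.reverse_arrow) (use reverse_arrow in auto)
next
  case (switch_numbers i j vs I)
  have eq: "map \<phi> (vs[i := vs ! j, j := vs ! i]) = (map \<phi> vs)[i := map \<phi> vs ! j, j := map \<phi> vs ! i]"
    using switch_numbers by (simp add: map_update)
  show ?thesis
    unfolding switch_numbers relabel_Pair eq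
    by (rule moves.switch_numbers) (use switch_numbers in auto)
qed

lemma relabel_move_lift:
  assumes g: "is_graph g" and iso: "graph_iso \<phi> \<psi> g g'" and l: "l \<in> labellings g"
    and m: "(relabel \<phi> \<psi> l, m) \<in> moves g'"
  shows "\<exists>l'. (l, l') \<in> moves g \<and> m = relabel \<phi> \<psi> l'"
proof -
  obtain vs I where vI: "l = (vs, I)" by (cases l)
  from m show ?thesis
  proof (cases rule: movesE)
    case (reverse_arrow h' I' vs')
    then obtain h where h: "h \<in> I" "h' = \<psi> h" using vI by auto
    have m1: "(l, (vs, insert (bar g h) (I - {h}))) \<in> moves g"
      unfolding vI by (rule moves.reverse_arrow) (rule h)
    have hh: "I \<subseteq> halves g" "h \<in> halves g" using l vI h by (auto simp: mem_labellings)
    have inj: "inj_on \<psi> (halves g)" using iso by (auto simp: graph_iso_def bij_betw_def)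
    have "\<psi> ` (I - {h}) = \<psi> ` I - {\<psi> h}"
      using inj_on_image_set_diff[OF inj, of I "{h}"] hh by auto
    then have "m = relabel \<phi> \<psi> (vs, insert (bar g h) (I - {h}))"
      using graph_isoD(4)[OF iso hh(2)] reverse_arrow vI h by simp
    with m1 show ?thesis by blast
  next
    case (switch_numbers i j vs' I')
    have eq: "vs' = map \<phi> vs" "I' = \<psi> ` I" using switch_numbers(1) vI by simp_all
    have m1: "(l, (vs[i := vs ! j, j := vs ! i], I)) \<in> moves g"
      unfolding vI by (rule moves.switch_numbers) (use switch_numbers(3,4) eq in auto)
    have "m = relabel \<phi> \<psi> (vs[i := vs ! j, j := vs ! i], I)"
      using switch_numbers(2-4) eq by (simp add: map_update)
    with m1 show ?thesis by blast
  qed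
qed

lemma alternating_relabel:
  assumes g: "is_graph g" and iso: "graph_iso \<phi> \<psi> g g'" and "alternating g' F"
  shows "alternating g (\<lambda>l. F (relabel \<phi> \<psi> l))"
  unfolding alternating_def
proof (intro ballI allI impI)
  fix l l' assume l: "l \<in> labellings g" "(l, l') \<in> moves g"
  then have "relabel \<phi> \<psi> l \<in> labellings g'"
    using relabel_labellings[OF g iso] by (cases l) simp
  then show "F (relabel \<phi> \<psi> l') = - F (relabel \<phi> \<psi> l)"
    using relabel_move[OF g iso l] assms(3) unfolding alternating_def by blast
qed

lemma relabel_class:
  assumes g: "is_graph g" and iso: "graph_iso \<phi> \<psi> g g'" and l: "l \<in> labellings g"
  shows "relabel \<phi> \<psi> ` orientation_class g l = orientation_class g' (relabel \<phi> \<psi> l)"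
proof -
  have "(relabel \<phi> \<psi> l, m) \<in> moves g' ^^ n \<longleftrightarrow> (\<exists>l'. (l, l') \<in> moves g ^^ n \<and> m = relabel \<phi> \<psi> l')" for m n
  proof (induction n arbitrary: m)
    case (Suc n)
    show ?case
    proof
      assume "(relabel \<phi> \<psi> l, m) \<in> moves g' ^^ Suc n"
      then obtain l1 where l1: "(l, l1) \<in> moves g ^^ n" "(relabel \<phi> \<psi> l1, m) \<in> moves g'"
        using Suc.IH by auto
      then show "\<exists>l'. (l, l') \<in> moves g ^^ Suc n \<and> m = relabel \<phi> \<psi> l'"
        using relabel_move_lift[OF g iso] labellings_relpow[OF g l] by (metis relpow_Suc_I)
    next
      assume "\<exists>l'. (l, l') \<in> moves g ^^ Suc n \<and> m = relabel \<phi> \<psi> l'"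
      then obtain l1 l' where l1: "(l, l1) \<in> moves g ^^ n" "(l1, l') \<in> moves g" "m = relabel \<phi> \<psi> l'"
        by auto
      then show "(relabel \<phi> \<psi> l, m) \<in> moves g' ^^ Suc n"
        using relabel_move[OF g iso] labellings_relpow[OF g l] Suc.IH by (metis relpow_Suc_I)
    qed
  qed auto
  then show ?thesis unfolding orientation_class_def by blast
qed

lemma is_graph_iso:
  assumes g: "is_graph g" and iso: "graph_iso \<phi> \<psi> g g'"
  shows "is_graph g'"
proof -
  note i = graph_isoD[OF iso] and g = is_graphD[OF g]
  have im: "\<psi> ` halves g = halves g'" "\<phi> ` verts g = verts g'"
    and inj: "inj_on \<psi> (halves g)" "inj_on \<phi> (verts g)"
    using i by (auto simp: bij_betw_def)
  have "origin g' h \<in> verts g' \<and> bar g' h \<in> halves g' \<and> bar g' h \<noteq> h \<and> bar g' (bar g' h) = h"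
    if hh: "h \<in> halves g'" for h
  proof -
    obtain k where k: "k \<in> halves g" "h = \<psi> k" using hh unfolding im(1)[symmetric] by blast
    have b: "bar g' h = \<psi> (bar g k)" "bar g' (bar g' h) = h"
      using i(4)[OF k(1)] i(4)[OF g(4)[OF k(1)]] g(6)[OF k(1)] k(2) by simp_all
    have "\<psi> (bar g k) \<noteq> h" using inj(1) g(4,5)[OF k(1)] k by (simp add: inj_on_eq_iff)
    moreover have "origin g' h \<in> verts g'" "\<psi> (bar g k) \<in> halves g'"
      using i(3)[OF k(1)] g(3,4)[OF k(1)] k(2) im by auto
    ultimately show ?thesis using b by simp
  qed
  moreover have "3 \<le> card {h \<in> halves g'. origin g' h = v}" if v: "v \<in> verts g'" for v
  proof -
    obtain u where u: "u \<in> verts g" "v = \<phi> u" using v unfolding im(2)[symmetric] by blast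
    have *: "{h \<in> halves g'. origin g' h = v} = \<psi> ` {h \<in> halves g. origin g h = u}"
      unfolding im(1)[symmetric] using i(3) g(3) inj(2) u by (auto simp: inj_on_eq_iff)
    have "inj_on \<psi> {h \<in> halves g. origin g h = u}"
      using inj(1) by (rule inj_on_subset) auto
    from card_image[OF this]
    have "card {h \<in> halves g'. origin g' h = v} = card {h \<in> halves g. origin g h = u}"
      unfolding * .
    then show ?thesis using g(7)[OF u(1)] by simp
  qed
  moreover have "finite (verts g')" "finite (halves g')"
    unfolding im[symmetric] using g(1,2) by auto
  ultimately show ?thesis unfolding is_graph_def by blast
qed

lemma gcls_relabel:
  assumes g: "is_graph g" and iso: "graph_iso \<phi> \<psi> g g'" and l: "l \<in> labellings g"
  shows "gcls g' (relabel \<phi> \<psi> l) = (gcls g l :: 'k::field_char_0 graph_space)"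
proof -
  have g': "is_graph g'" using is_graph_iso[OF g iso] .
  have l': "relabel \<phi> \<psi> l \<in> labellings g'" using relabel_labellings[OF g iso] l by (cases l) auto
  have "ograph_iso (oriented g l) (oriented g' (relabel \<phi> \<psi> l))"
    unfolding ograph_iso_def graph_of_oriented[OF g l] graph_of_oriented[OF g' l']
    using relabel_class[OF g iso l] iso unfolding relabel_def graph_iso_def
    by (intro exI[of _ \<phi>] exI[of _ \<psi>]) auto
  then show ?thesis unfolding gcls_def by (rule cls_iso[symmetric])
qed

lemma gcls_cong:
  assumes "is_graph g" "verts g' = verts g" "halves g' = halves g"
    "\<And>h. h \<in> halves g \<Longrightarrow> origin g' h = origin g h" "\<And>h. h \<in> halves g \<Longrightarrow> bar g' h = bar g h"
    "l \<in> labellings g"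
  shows "gcls g' l = (gcls g l :: 'k::field_char_0 graph_space)"
proof -
  have "graph_iso id id g g'" using assms unfolding graph_iso_def by auto
  from gcls_relabel[OF assms(1) this assms(6)] show ?thesis by (cases l) auto
qed

section \<open>Linear and bilinear extension\<close>

abbreviation glinear :: "('k::field_char_0 graph_space \<Rightarrow> 'k graph_space) \<Rightarrow> bool" where
  "glinear \<equiv> Vector_Spaces.linear gscale gscale"

lemma glinear_iff:
  "glinear T \<longleftrightarrow> (\<forall>v w. T (v + w) = T v + T w) \<and> (\<forall>c v. T (c *\<^sub>G v) = c *\<^sub>G T v)"
  by (simp add: Vector_Spaces.linear_iff G.vector_space_axioms)

lemma glinearD:
  assumes "glinear T"
  shows "T (v + w) = T v + T w" "T (c *\<^sub>G v) = c *\<^sub>G T v" "T 0 = 0" "T (- v) = - T v"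
    "T (v - w) = T v - T w" "T (\<Sum>i\<in>A. f i) = (\<Sum>i\<in>A. T (f i))"
proof -
  have add: "T (v + w) = T v + T w" for v w using assms by (simp add: glinear_iff)
  show sc: "T (c *\<^sub>G v) = c *\<^sub>G T v" for c v using assms by (simp add: glinear_iff)
  show z: "T 0 = 0" using sc[of 0 0] by simp
  show m: "T (- v) = - T v" for v using sc[of "- 1" v] by simp
  show "T (v + w) = T v + T w" by (rule add)
  show "T (v - w) = T v - T w" using add[of v "- w"] m[of w] by simp
  show "T (\<Sum>i\<in>A. f i) = (\<Sum>i\<in>A. T (f i))"
    by (induction A rule: infinite_finite_induct) (auto simp: z add)
qed

lemma fscale_single: "fscale c (Poly_Mapping.single X d) = Poly_Mapping.single X (c * d)"
  by (rule poly_mapping_eqI) (auto simp: lookup_fscale lookup_single when_def)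

lemma abs_graph_space_cases: obtains p where "v = abs_graph_space p"
  using Quotient_abs_rep[OF Quotient_graph_space] by metis

lemma abs_graph_space_single: "abs_graph_space (Poly_Mapping.single X c) = c *\<^sub>G cls X"
  by (simp add: cls.abs_eq gscale.abs_eq fscale_single)

lemma poly_mapping_sum_single:
  fixes p :: "'a \<Rightarrow>\<^sub>0 'b::comm_monoid_add"
  shows "(\<Sum>X\<in>Poly_Mapping.keys p. Poly_Mapping.single X (Poly_Mapping.lookup p X)) = p"
proof (rule poly_mapping_eqI)
  fix Y
  have "(\<Sum>X\<in>Poly_Mapping.keys p. Poly_Mapping.lookup p X when X = Y) = Poly_Mapping.lookup p Y"
    by (cases "Y \<in> Poly_Mapping.keys p") (auto simp: when_def sum.delta in_keys_iff)
  then show "Poly_Mapping.lookup (\<Sum>X\<in>Poly_Mapping.keys p. Poly_Mapping.single X (Poly_Mapping.lookup p X)) Y =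
      Poly_Mapping.lookup p Y"
    by (simp add: lookup_sum lookup_single)
qed

lemma span_cls_UNIV: "G.span (range cls) = (UNIV :: 'k::field_char_0 graph_space set)"
proof -
  have "v \<in> G.span (range cls)" for v :: "'k graph_space"
  proof -
    obtain p where p: "v = abs_graph_space p" by (rule abs_graph_space_cases)
    have "abs_graph_space (\<Sum>X\<in>S. Poly_Mapping.single X (Poly_Mapping.lookup p X)) \<in> G.span (range cls)"
      if "finite S" for S
      using that
    proof induction
      case empty
      then show ?case using G.span_zero by (simp add: zero_graph_space.abs_eq[symmetric])
    next
      case (insert X S)
      have "Poly_Mapping.lookup p X *\<^sub>G cls X \<in> G.span (range cls)"
        by (intro G.span_scale G.span_base) auto
      then show ?case
        using insert
        by (simp add: plus_graph_space.abs_eq[symmetric] abs_graph_space_single G.span_add)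
    qed
    from this[OF finite_keys[of p]] show ?thesis by (simp add: poly_mapping_sum_single p)
  qed
  then show ?thesis by blast
qed

lemma glinear_eq_on_span:
  assumes "glinear S" "glinear T" "\<And>v. v \<in> A \<Longrightarrow> S v = T v" "v \<in> G.span A"
  shows "S v = T v"
  using assms(4)
proof (induction rule: G.span_induct)
  case base
  then show ?case
    using glinearD[OF assms(1)] glinearD[OF assms(2)] by (auto simp: G.subspace_def)
qed (use assms(3) in simp)

lemma glinear_eqI:
  assumes "glinear S" "glinear T" "\<And>X. S (cls X) = T (cls X)"
  shows "S v = T v"
  by (rule glinear_eq_on_span[OF assms(1,2), of "range cls"]) (auto simp: assms(3) span_cls_UNIV)

lemma cls_cases:
  obtains g l where "is_graph g" "l \<in> labellings g"
    "(cls X :: 'k::field_char_0 graph_space) = gcls g l" "nverts X = card (verts g)"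
proof -
  obtain l where "is_graph (graph_of X)" "l \<in> labellings (graph_of X)" "X = oriented (graph_of X) l"
    using ograph_cases by metis
  moreover from this have "(cls X :: 'k graph_space) = gcls (graph_of X) l" by (simp add: gcls_def)
  ultimately show thesis using that unfolding nverts_def by blast
qed

definition graph_invariant :: "(graph \<Rightarrow> labelling \<Rightarrow> 'k::field_char_0 graph_space) \<Rightarrow> bool" where
  "graph_invariant F \<longleftrightarrow> (\<forall>g. is_graph g \<longrightarrow> alternating g (F g)) \<and>
     (\<forall>\<phi> \<psi> g g' l. is_graph g \<longrightarrow> graph_iso \<phi> \<psi> g g' \<longrightarrow> l \<in> labellings g \<longrightarrow>
        F g' (relabel \<phi> \<psi> l) = F g l)"

lemma linear_extension:
  fixes F :: "graph \<Rightarrow> labelling \<Rightarrow> 'k::field_char_0 graph_space"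
  assumes inv: "graph_invariant F"
  shows "\<exists>T. glinear T \<and> (\<forall>g l. is_graph g \<longrightarrow> l \<in> labellings g \<longrightarrow> T (gcls g l) = F g l)"
proof -
  have alt: "alternating g (F g)" if "is_graph g" for g
    using inv that by (auto simp: graph_invariant_def)
  define f where "f X = F (graph_of X) (SOME l. l \<in> or_of X)" for X
  have f: "f X = F (graph_of X) l" if "l \<in> or_of X" for X l
    unfolding f_def
    by (rule alternating_or_of[OF alt[OF is_graph_graph_of]]) (use that in \<open>auto intro: someI\<close>)
  have f_iso: "f X = f Y" if XY: "ograph_iso X Y" for X Y
  proof -
    obtain \<phi> \<psi> where i: "graph_iso \<phi> \<psi> (graph_of X) (graph_of Y)" "relabel \<phi> \<psi> ` or_of X = or_of Y"
      using XY unfolding ograph_iso_def graph_iso_def relabel_def by blast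
    obtain l where l: "l \<in> or_of X" using or_of_nonempty by blast
    then have "relabel \<phi> \<psi> l \<in> or_of Y" using i by blast
    then have "f Y = F (graph_of Y) (relabel \<phi> \<psi> l)" by (rule f)
    also have "\<dots> = F (graph_of X) l"
      using inv i(1) or_of_subset[OF l] is_graph_graph_of unfolding graph_invariant_def by blast
    finally show ?thesis using f[OF l] by simp
  qed
  have f_opp: "f Y = - f X" if XY: "opposite X Y" for X Y
  proof -
    obtain l l' where l: "l \<in> or_of X" "l' \<in> or_of Y" "graph_of X = graph_of Y" "(l, l') \<in> moves (graph_of X)"
      using XY unfolding opposite_def by blast
    then have "F (graph_of X) l' = - F (graph_of X) l"
      using alt[OF is_graph_graph_of[of X]] or_of_subset unfolding alternating_def by blast
    then show ?thesis using f[OF l(1)] f[OF l(2)] l(3) by simp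
  qed
  define L where "L p = (\<Sum>X\<in>Poly_Mapping.keys p. Poly_Mapping.lookup p X *\<^sub>G f X)" for p
  have L: "L p = (\<Sum>X\<in>S. Poly_Mapping.lookup p X *\<^sub>G f X)"
    if "finite S" "Poly_Mapping.keys p \<subseteq> S" for p S
    unfolding L_def by (rule sum.mono_neutral_left) (use that in \<open>auto simp: in_keys_iff\<close>)
  have L_add: "L (p + q) = L p + L q" for p q
  proof -
    let ?S = "Poly_Mapping.keys p \<union> Poly_Mapping.keys q"
    have "L (p + q) = (\<Sum>X\<in>?S. Poly_Mapping.lookup (p + q) X *\<^sub>G f X)"
      by (rule L) (use keys_add[of p q] in auto)
    moreover have "L p = (\<Sum>X\<in>?S. Poly_Mapping.lookup p X *\<^sub>G f X)" by (rule L) auto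
    moreover have "L q = (\<Sum>X\<in>?S. Poly_Mapping.lookup q X *\<^sub>G f X)" by (rule L) auto
    ultimately show ?thesis by (simp add: lookup_add G.scale_left_distrib sum.distrib)
  qed
  have L_scale: "L (fscale c p) = c *\<^sub>G L p" for c p
  proof -
    have "L (fscale c p) = (\<Sum>X\<in>Poly_Mapping.keys p. Poly_Mapping.lookup (fscale c p) X *\<^sub>G f X)"
      by (rule L) (auto simp: in_keys_iff lookup_fscale)
    then show ?thesis by (simp add: L_def lookup_fscale G.scale_sum_right)
  qed
  have L_single: "L (Poly_Mapping.single X 1) = f X" for X
    by (simp add: L_def)
  have L_neg: "L (- p) = - L p" for p
  proof -
    have "fscale (- 1) p = - p" by (rule poly_mapping_eqI) (simp add: lookup_fscale)
    then show ?thesis using L_scale[of "- 1" p] by simp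
  qed
  have L_diff: "L (p - q) = L p - L q" for p q
    using L_add[of p "- q"] L_neg[of q] by simp
  have L_span: "L p = 0" if "p \<in> F.span relators" for p
    using that
  proof (induction rule: F.span_induct)
    case base
    have "L 0 = 0" by (simp add: L_def)
    then show ?case by (auto simp: F.subspace_def L_add L_scale)
  next
    case (step p)
    then show ?case
      using f_iso f_opp by (auto simp: relators_def L_add L_diff L_single)
  qed
  define T where "T v = L (rep_graph_space v)" for v
  have T: "T (abs_graph_space p) = L p" for p
  proof -
    have "abs_graph_space (rep_graph_space (abs_graph_space p)) = abs_graph_space p"
      by (rule Quotient_abs_rep[OF Quotient_graph_space])
    then have "graph_rel (rep_graph_space (abs_graph_space p)) p"
      by (simp add: graph_space.abs_eq_iff)
    then show ?thesis using L_span L_diff unfolding T_def graph_rel_def by (metis eq_iff_diff_eq_0)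
  qed
  have "glinear T"
    unfolding glinear_iff
  proof (intro conjI allI)
    fix v w :: "'k graph_space" and c
    obtain p q where "v = abs_graph_space p" "w = abs_graph_space q"
      using abs_graph_space_cases by metis
    then show "T (v + w) = T v + T w" "T (c *\<^sub>G v) = c *\<^sub>G T v"
      by (simp_all add: plus_graph_space.abs_eq gscale.abs_eq T L_add L_scale)
  qed
  moreover have "T (gcls g l) = F g l" if g: "is_graph g" and l: "l \<in> labellings g" for g l
  proof -
    have "l \<in> or_of (oriented g l)" using graph_of_oriented[OF g l] in_orientation_class by simp
    from f[OF this] show ?thesis
      using graph_of_oriented[OF g l] by (simp add: gcls_def cls.abs_eq T L_single)
  qed
  ultimately show ?thesis by blast
qed

lemma bilinear_map_iff:
  "bilinear_map gscale B \<longleftrightarrow> (\<forall>u. glinear (\<lambda>v. B u v)) \<and> (\<forall>v. glinear (\<lambda>u. B u v))"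
  by (simp add: bilinear_map_def)

lemma bilinear_mapD:
  assumes "bilinear_map gscale B"
  shows "glinear (\<lambda>v. B u v)" "glinear (\<lambda>u. B u v)"
  using assms unfolding bilinear_map_iff by blast+

lemma bilinear_map_extension:
  fixes F :: "graph \<Rightarrow> labelling \<Rightarrow> graph \<Rightarrow> labelling \<Rightarrow> 'k::field_char_0 graph_space"
  assumes inv2: "\<And>g l. is_graph g \<Longrightarrow> l \<in> labellings g \<Longrightarrow> graph_invariant (F g l)"
    and inv1: "\<And>g l. is_graph g \<Longrightarrow> l \<in> labellings g \<Longrightarrow> graph_invariant (\<lambda>g' l'. F g' l' g l)"
  shows "\<exists>B. bilinear_map gscale B \<and>
    (\<forall>g l g' l'. is_graph g \<longrightarrow> l \<in> labellings g \<longrightarrow> is_graph g' \<longrightarrow> l' \<in> labellings g' \<longrightarrow>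
       B (gcls g l) (gcls g' l') = F g l g' l')"
proof -
  have "\<exists>T. \<forall>g l. is_graph g \<longrightarrow> l \<in> labellings g \<longrightarrow> glinear (T g l) \<and>
      (\<forall>g' l'. is_graph g' \<longrightarrow> l' \<in> labellings g' \<longrightarrow> T g l (gcls g' l') = F g l g' l')"
    using linear_extension[OF inv2] by metis
  then obtain T where T: "\<And>g l. is_graph g \<Longrightarrow> l \<in> labellings g \<Longrightarrow> glinear (T g l)"
    "\<And>g l g' l'. is_graph g \<Longrightarrow> l \<in> labellings g \<Longrightarrow> is_graph g' \<Longrightarrow> l' \<in> labellings g' \<Longrightarrow>
       T g l (gcls g' l') = F g l g' l'" by blast
  have eqI: "S v = S' v" if "glinear S" "glinear S'"
    "\<And>g' l'. is_graph g' \<Longrightarrow> l' \<in> labellings g' \<Longrightarrow> S (gcls g' l') = S' (gcls g' l')"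
    for S S' :: "'k graph_space \<Rightarrow> 'k graph_space" and v
    using that(1,2)
  proof (rule glinear_eqI)
    fix X
    show "S (cls X) = S' (cls X)" by (rule cls_cases[of X, where 'k = 'k]) (simp add: that(3))
  qed
  have inv: "graph_invariant (\<lambda>g l. T g l v)" for v
    unfolding graph_invariant_def alternating_def
  proof (intro conjI allI impI ballI)
    fix g l l' assume g: "is_graph g" and l: "l \<in> labellings g" and m: "(l, l') \<in> moves g"
    have l': "l' \<in> labellings g" using labellings_move[OF g l m] .
    have lin: "glinear (\<lambda>v. - T g l v)"
      using T(1)[OF g l] by (simp add: glinear_iff)
    show "T g l' v = - T g l v"
    proof (rule eqI[OF T(1)[OF g l'] lin])
      fix g' l1 assume "is_graph g'" "l1 \<in> labellings g'"
      then show "T g l' (gcls g' l1) = - T g l (gcls g' l1)"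
        using T(2) g l l' inv1 m unfolding graph_invariant_def alternating_def by metis
    qed
  next
    fix \<phi> \<psi> g g' l assume g: "is_graph g" and i: "graph_iso \<phi> \<psi> g g'" and l: "l \<in> labellings g"
    have g': "is_graph g'" using is_graph_iso[OF g i] .
    have l': "relabel \<phi> \<psi> l \<in> labellings g'" using relabel_labellings[OF g i] l by (cases l) auto
    show "T g' (relabel \<phi> \<psi> l) v = T g l v"
    proof (rule eqI[OF T(1)[OF g' l'] T(1)[OF g l]])
      fix h k assume h: "is_graph h" "k \<in> labellings h"
      have "F g' (relabel \<phi> \<psi> l) h k = F g l h k"
        using inv1[OF h] g i l unfolding graph_invariant_def by blast
      then show "T g' (relabel \<phi> \<psi> l) (gcls h k) = T g l (gcls h k)"
        using T(2) g l g' l' h by simp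
    qed
  qed
  obtain B where B: "\<And>v. glinear (B v)"
    "\<And>v g l. is_graph g \<Longrightarrow> l \<in> labellings g \<Longrightarrow> B v (gcls g l) = T g l v"
    using linear_extension[OF inv] by metis
  have "glinear (\<lambda>v. B v u)" for u
    unfolding glinear_iff
  proof (intro conjI allI)
    fix v w :: "'k graph_space" and c
    have l1: "glinear (\<lambda>u. B v u + B w u)" "glinear (\<lambda>u. c *\<^sub>G B v u)"
      using B(1)[of v] B(1)[of w] by (auto simp: glinear_iff G.scale_right_distrib ac_simps)
    show "B (v + w) u = B v u + B w u"
      by (rule eqI[OF B(1) l1(1)]) (simp add: B(2) glinearD(1)[OF T(1)])
    show "B (c *\<^sub>G v) u = c *\<^sub>G B v u"
      by (rule eqI[OF B(1) l1(2)]) (simp add: B(2) glinearD(2)[OF T(1)])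
  qed
  then show ?thesis
    using B T(2) by (intro exI[of _ "\<lambda>u v. B v u"]) (simp add: bilinear_map_iff)
qed

lemma bilinear_map_eqI:
  assumes "bilinear_map gscale B" "bilinear_map gscale C" "\<And>X Y. B (cls X) (cls Y) = C (cls X) (cls Y)"
  shows "B u v = C u v"
proof -
  have "B (cls X) v = C (cls X) v" for X
    using bilinear_mapD(1)[OF assms(1)] bilinear_mapD(1)[OF assms(2)] assms(3) by (rule glinear_eqI)
  with bilinear_mapD(2)[OF assms(1)] bilinear_mapD(2)[OF assms(2)] show ?thesis by (rule glinear_eqI)
qed

lemma bilinear_extension_The:
  assumes "bilinear_extension f B"
  shows "(THE B. bilinear_extension f B) = B"
proof (rule the_equality)
  show "bilinear_extension f B" by (rule assms)
next
  fix C assume "bilinear_extension f C"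
  then show "C = B"
    using assms bilinear_map_eqI[of C B] unfolding bilinear_extension_def by (intro ext) auto
qed

lemma graph_invariant_scale:
  "graph_invariant (\<lambda>g l. c (card (verts g)) *\<^sub>G (gcls g l :: 'k::field_char_0 graph_space))"
  unfolding graph_invariant_def
proof (intro conjI allI impI)
  fix g assume "is_graph g"
  then show "alternating g (\<lambda>l. c (card (verts g)) *\<^sub>G (gcls g l :: 'k graph_space))"
    using gcls_alternating[where 'k = 'k] unfolding alternating_def by (metis G.scale_minus_right)
next
  fix \<phi> \<psi> g g' l assume g: "is_graph g" and i: "graph_iso \<phi> \<psi> g g'" and l: "l \<in> labellings g"
  have "card (verts g') = card (verts g)"
    using i bij_betw_same_card unfolding graph_iso_def by metis
  then show "c (card (verts g')) *\<^sub>G gcls g' (relabel \<phi> \<psi> l) =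
      c (card (verts g)) *\<^sub>G (gcls g l :: 'k graph_space)"
    by (simp add: gcls_relabel[OF g i l])
qed

lemma bilinear_extension_scale:
  fixes B :: "'k::field_char_0 graph_space \<Rightarrow> 'k graph_space \<Rightarrow> 'k graph_space"
  assumes B: "bilinear_map gscale B"
  shows "\<exists>C. bilinear_extension (\<lambda>X Y. (-1) ^ nverts X *\<^sub>G B (cls X) (cls Y)) C"
proof -
  have sgn: "graph_invariant (\<lambda>g l. (-1) ^ card (verts g) *\<^sub>G (gcls g l :: 'k graph_space))"
    by (rule graph_invariant_scale)
  obtain T where T: "glinear T" "\<And>g l. is_graph g \<Longrightarrow> l \<in> labellings g \<Longrightarrow>
      T (gcls g l) = (-1) ^ card (verts g) *\<^sub>G (gcls g l :: 'k graph_space)"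
    using linear_extension[OF sgn] by blast
  have TX: "T (cls X) = (-1) ^ nverts X *\<^sub>G cls X" for X
    by (rule cls_cases[of X, where 'k = 'k]) (simp add: T(2))
  have "glinear (\<lambda>u. B (T u) v)" for v
    using B T(1) unfolding bilinear_map_iff glinear_iff by simp
  then have "bilinear_extension (\<lambda>X Y. (-1) ^ nverts X *\<^sub>G B (cls X) (cls Y)) (\<lambda>u v. B (T u) v)"
    using B unfolding bilinear_extension_def bilinear_map_iff
    by (auto simp: TX glinear_iff)
  then show ?thesis by blast
qed

section \<open>The grading\<close>

lemma graph_degree_subspace: "G.subspace (graph_degree n)"
  unfolding graph_degree_def by (rule G.subspace_span)

lemma degree_projection:
  "\<exists>P :: int \<Rightarrow> 'k::field_char_0 graph_space \<Rightarrow> 'k graph_space.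
    (\<forall>n. glinear (P n)) \<and> (\<forall>n X. P n (cls X) = (if int (nverts X) = n then cls X else 0))"
proof -
  have inv: "graph_invariant (\<lambda>g l. (if int (card (verts g)) = n then 1 else 0) *\<^sub>G (gcls g l :: 'k graph_space))" for n
    by (rule graph_invariant_scale)
  obtain P :: "int \<Rightarrow> 'k graph_space \<Rightarrow> 'k graph_space" where P: "\<And>n. glinear (P n)"
    "\<And>n g l. is_graph g \<Longrightarrow> l \<in> labellings g \<Longrightarrow>
      P n (gcls g l) = (if int (card (verts g)) = n then 1 else 0) *\<^sub>G gcls g l"
    using linear_extension[OF inv] by metis
  have "P n (cls X) = (if int (nverts X) = n then cls X else 0)" for n X
    by (rule cls_cases[of X, where 'k = 'k]) (simp add: P(2))
  then show ?thesis using P(1) by blast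
qed

lemma sum_support:
  fixes f :: "'i \<Rightarrow> 'a::comm_monoid_add"
  assumes "finite S" "{i. f i \<noteq> 0} \<subseteq> S"
  shows "(\<Sum>i | f i \<noteq> 0. f i) = sum f S"
  using assms by (intro sum.mono_neutral_left) auto

lemma graded_space_graph_degree:
  "graded_space gscale (shift_down graph_degree :: int \<Rightarrow> 'k::field_char_0 graph_space set)"
proof -
  obtain P :: "int \<Rightarrow> 'k graph_space \<Rightarrow> 'k graph_space" where P: "\<And>n. glinear (P n)"
    "\<And>n X. P n (cls X) = (if int (nverts X) = n then cls X else 0)"
    using degree_projection by blast
  have Pn: "P m v = (if m = n then v else 0)" if v: "v \<in> graph_degree n" for m n v
  proof -
    have "glinear (\<lambda>v. if m = n then v else 0)" by (auto simp: glinear_iff)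
    from P(1)[of m] this show ?thesis
      by (rule glinear_eq_on_span[OF _ _ _ v[unfolded graph_degree_def]]) (auto simp: P(2))
  qed
  have uniq: "f n = P (n + 1) v"
    if "finite {i. f i \<noteq> 0}" "\<And>i. f i \<in> graph_degree (i + 1)" "v = (\<Sum>i | f i \<noteq> 0. f i)" for f n v
  proof -
    have "P (n + 1) v = (\<Sum>i | f i \<noteq> 0. if n = i then f i else 0)"
      unfolding that(3) glinearD(6)[OF P(1)] using Pn[OF that(2)] by simp
    also have "\<dots> = f n" using that(1) by (auto simp: sum.delta)
    finally show ?thesis by simp
  qed
  have ex: "\<exists>f. finite {i. f i \<noteq> 0} \<and> (\<forall>i. f i \<in> graph_degree (i + 1)) \<and> v = (\<Sum>i | f i \<noteq> 0. f i)"
    for v :: "'k graph_space"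
  proof -
    have "v \<in> G.span (range cls)" by (simp add: span_cls_UNIV)
    then show ?thesis
    proof (induction rule: G.span_induct_alt)
      case base
      show ?case by (intro exI[of _ "\<lambda>_. 0"]) (simp add: G.subspace_0[OF graph_degree_subspace])
    next
      case (step c x y)
      then obtain X f where X: "x = cls X" and f: "finite {i. f i \<noteq> 0}" "\<And>i. f i \<in> graph_degree (i + 1)"
        "y = (\<Sum>i | f i \<noteq> 0. f i)" by blast
      let ?n = "int (nverts X) - 1"
      let ?S = "insert ?n {i. f i \<noteq> 0}"
      define h where "h i = (if i = ?n then c *\<^sub>G x else 0) + f i" for i
      have h: "{i. h i \<noteq> 0} \<subseteq> ?S" by (auto simp: h_def)
      have "cls X \<in> graph_degree (?n + 1)" unfolding graph_degree_def by (rule G.span_base) auto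
      then have "c *\<^sub>G x \<in> graph_degree (?n + 1)"
        unfolding X by (rule G.subspace_scale[OF graph_degree_subspace])
      then have "h i \<in> graph_degree (i + 1)" for i
        using f(2)[of i] G.subspace_add[OF graph_degree_subspace] by (auto simp: h_def)
      moreover have "c *\<^sub>G x + y = (\<Sum>i | h i \<noteq> 0. h i)"
      proof -
        have "(\<Sum>i | h i \<noteq> 0. h i) = sum h ?S" using f(1) h by (intro sum_support) auto
        also have "\<dots> = c *\<^sub>G x + sum f ?S"
          using f(1) by (auto simp: h_def sum.distrib)
        also have "sum f ?S = y" unfolding f(3) using f(1) by (intro sum_support[symmetric]) auto
        finally show ?thesis by simp
      qed
      moreover have "finite {i. h i \<noteq> 0}" using h f(1) finite_subset by blast
      ultimately show ?case by blast
    qed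
  qed
  have "\<exists>!f. finite {i. f i \<noteq> 0} \<and> (\<forall>i. f i \<in> graph_degree (i + 1)) \<and> v = (\<Sum>i | f i \<noteq> 0. f i)"
    for v :: "'k graph_space"
  proof (rule ex_ex1I[OF ex])
    fix f f' :: "int \<Rightarrow> 'k graph_space"
    assume f: "finite {i. f i \<noteq> 0} \<and> (\<forall>i. f i \<in> graph_degree (i + 1)) \<and> v = (\<Sum>i | f i \<noteq> 0. f i)"
      "finite {i. f' i \<noteq> 0} \<and> (\<forall>i. f' i \<in> graph_degree (i + 1)) \<and> v = (\<Sum>i | f' i \<noteq> 0. f' i)"
    show "f = f'" using uniq[of f v] uniq[of f' v] f by (intro ext) metis
  qed
  then show ?thesis
    unfolding graded_space_def shift_down_def using G.vector_space_axioms graph_degree_subspace by blast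
qed

section \<open>Disjoint unions and the product\<close>

definition gunion :: "graph \<Rightarrow> graph \<Rightarrow> graph" where
  "gunion g g' = \<lparr>verts = verts g \<union> verts g', halves = halves g \<union> halves g',
     origin = origin g, bar = bar g\<rparr>"

definition ljoin :: "labelling \<Rightarrow> labelling \<Rightarrow> labelling" where
  "ljoin l l' = (fst l @ fst l', snd l \<union> snd l')"

text \<open>
  Disjoint graphs are required to share \<open>origin\<close> and \<open>bar\<close>, which makes the union of graphs
  associative, and commutative on disjoint graphs, as an operation on records.
\<close>

definition disjoint_graphs :: "graph \<Rightarrow> graph \<Rightarrow> bool" where
  "disjoint_graphs g g' \<longleftrightarrow> verts g \<inter> verts g' = {} \<and> halves g \<inter> halves g' = {} \<and>
     origin g' = origin g \<and> bar g' = bar g"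

lemma gunion_simps [simp]:
  "verts (gunion g g') = verts g \<union> verts g'" "halves (gunion g g') = halves g \<union> halves g'"
  "origin (gunion g g') = origin g" "bar (gunion g g') = bar g"
  by (simp_all add: gunion_def)

lemma ljoin_Pair [simp]: "ljoin (vs, I) (ws, J) = (vs @ ws, I \<union> J)"
  by (simp add: ljoin_def)

lemma ljoin_assoc: "ljoin (ljoin l l') l'' = ljoin l (ljoin l' l'')"
  by (simp add: ljoin_def Un_assoc)

lemma gunion_assoc: "gunion (gunion g g') g'' = gunion g (gunion g' g'')"
  by (simp add: gunion_def Un_assoc)

lemma gunion_commute: "disjoint_graphs g g' \<Longrightarrow> gunion g' g = gunion g g'"
  by (simp add: gunion_def disjoint_graphs_def Un_commute)

lemma disjoint_graphs_sym: "disjoint_graphs g g' \<Longrightarrow> disjoint_graphs g' g"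
  by (auto simp: disjoint_graphs_def)

lemma disjoint_graphs_gunion:
  "disjoint_graphs g h \<Longrightarrow> disjoint_graphs g' h \<Longrightarrow> disjoint_graphs (gunion g g') h"
  "disjoint_graphs h g \<Longrightarrow> disjoint_graphs h g' \<Longrightarrow> disjoint_graphs h (gunion g g')"
  by (auto simp: disjoint_graphs_def)

lemma is_graph_gunion:
  assumes g: "is_graph g" and g': "is_graph g'" and d: "disjoint_graphs g g'"
  shows "is_graph (gunion g g')"
proof -
  note d = d[unfolded disjoint_graphs_def]
  have "{h \<in> halves g \<union> halves g'. origin g h = v} = {h \<in> halves g. origin g h = v}"
    if "v \<in> verts g" for v
    using d is_graphD(3)[OF g'] that by auto
  moreover have "{h \<in> halves g \<union> halves g'. origin g h = v} = {h \<in> halves g'. origin g' h = v}"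
    if "v \<in> verts g'" for v
    using d is_graphD(3)[OF g] that by auto
  ultimately show ?thesis
    unfolding is_graph_def gunion_simps
    using is_graphD[OF g] is_graphD[OF g'] d by (simp add: ball_Un)
qed

lemma ljoin_labellings:
  assumes "is_graph g" "is_graph g'" "disjoint_graphs g g'"
    and "l \<in> labellings g" "l' \<in> labellings g'"
  shows "ljoin l l' \<in> labellings (gunion g g')"
proof -
  obtain vs I ws J where l: "l = (vs, I)" "l' = (ws, J)" by fastforce
  note d = assms(3)[unfolded disjoint_graphs_def]
  have *: "distinct vs" "set vs = verts g" "I \<subseteq> halves g" "distinct ws" "set ws = verts g'" "J \<subseteq> halves g'"
    using assms(4,5) by (auto simp: l mem_labellings)
  have "h \<in> I \<union> J \<longleftrightarrow> bar g h \<notin> I \<union> J" if h: "h \<in> halves g \<union> halves g'" for h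
  proof (cases "h \<in> halves g")
    case True
    then have "h \<notin> J" "bar g h \<notin> J" using * d is_graphD(4)[OF assms(1)] by blast+
    moreover have "h \<in> I \<longleftrightarrow> bar g h \<notin> I" using True assms(4) by (simp add: l mem_labellings)
    ultimately show ?thesis by simp
  next
    case False
    then have h': "h \<in> halves g'" using h by simp
    then have "h \<notin> I" "bar g' h \<notin> I" using * d is_graphD(4)[OF assms(2)] by blast+
    moreover have "h \<in> J \<longleftrightarrow> bar g' h \<notin> J" using h' assms(5) by (simp add: l mem_labellings)
    moreover have "bar g' h = bar g h" using d by simp
    ultimately show ?thesis by simp
  qed
  then show ?thesis
    using * d unfolding l ljoin_Pair mem_labellings gunion_simps by auto
qed

lemma alternating_ljoin_left:
  assumes "is_graph g" "is_graph g'" "disjoint_graphs g g'" "l' \<in> labellings g'"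
    and F: "alternating (gunion g g') F"
  shows "alternating g (\<lambda>l. F (ljoin l l'))"
proof -
  obtain ws J where l: "l' = (ws, J)" by fastforce
  note lj = ljoin_labellings[OF assms(1-3) _ assms(4)]
  show ?thesis
  proof (rule alternatingI)
    fix as x y bs I assume "(as @ x # y # bs, I) \<in> labellings g"
    from lj[OF this] alternating_swap[OF F, of as x "[]" y "bs @ ws" "I \<union> J"]
    show "F (ljoin (as @ y # x # bs, I) l') = - F (ljoin (as @ x # y # bs, I) l')"
      by (simp add: l)
  next
    fix vs I h assume a: "(vs, I) \<in> labellings g" "h \<in> I"
    have "h \<notin> J" using a assms(3,4) by (auto simp: l mem_labellings disjoint_graphs_def)
    then have "insert (bar g h) (I - {h}) \<union> J = insert (bar (gunion g g') h) ((I \<union> J) - {h})"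
      by auto
    with lj[OF a(1)] alternating_flip[OF F, of "vs @ ws" "I \<union> J" h] a(2)
    show "F (ljoin (vs, insert (bar g h) (I - {h})) l') = - F (ljoin (vs, I) l')"
      by (simp add: l)
  qed
qed

lemma length_labelling:
  "(vs, I) \<in> labellings g \<Longrightarrow> length vs = card (verts g)"
  using distinct_card[of vs] by (simp add: mem_labellings)

lemma alternating_ljoin_commute:
  assumes g: "is_graph g" "is_graph g'" "disjoint_graphs g g'" "l \<in> labellings g" "l' \<in> labellings g'"
    and F: "alternating (gunion g g') F"
  shows "F (ljoin l l') = (-1) ^ (card (verts g) * card (verts g')) *\<^sub>G (F (ljoin l' l) :: 'k::field_char_0 graph_space)"
proof -
  obtain vs I ws J where v: "l = (vs, I)" "l' = (ws, J)" by fastforce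
  have "(vs @ ws @ [], I \<union> J) \<in> labellings (gunion g g')"
    using ljoin_labellings[OF g] by (simp add: v)
  from alternating_block_swap[OF F this] show ?thesis
    using g(4,5) by (simp add: v length_labelling Un_commute)
qed

lemma alternating_ljoin_right:
  fixes F :: "labelling \<Rightarrow> 'k::field_char_0 graph_space"
  assumes g: "is_graph g" "is_graph g'" "disjoint_graphs g g'" "l \<in> labellings g"
    and F: "alternating (gunion g g') F"
  shows "alternating g' (\<lambda>l'. F (ljoin l l'))"
proof -
  have "alternating g' (\<lambda>l'. F (ljoin l' l))"
    using alternating_ljoin_left[OF g(2,1) disjoint_graphs_sym[OF g(3)] g(4)] F gunion_commute[OF g(3)] by simp
  then show ?thesis
    unfolding alternating_def
    by (simp add: alternating_ljoin_commute[OF g _ F] labellings_move[OF g(2)])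
qed

lemma graph_iso_comp:
  assumes "is_graph g" "graph_iso \<phi> \<psi> g g'" "graph_iso \<phi>' \<psi>' g' g''"
  shows "graph_iso (\<phi>' \<circ> \<phi>) (\<psi>' \<circ> \<psi>) g g''"
proof -
  have "\<psi> h \<in> halves g'" if "h \<in> halves g" for h
    using assms(2) that by (auto simp: graph_iso_def bij_betw_def)
  then show ?thesis
    using assms is_graphD(3,4)[OF assms(1)] unfolding graph_iso_def
    by (auto intro: bij_betw_trans)
qed

lemma relabel_comp: "relabel \<phi>' \<psi>' (relabel \<phi> \<psi> l) = relabel (\<phi>' \<circ> \<phi>) (\<psi>' \<circ> \<psi>) l"
  by (cases l) (simp add: image_comp)

text \<open>
  The names of the vertices and half-edges of the \<open>i\<close>-th copy are congruent to \<open>i\<close> modulo \<open>n\<close>, so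
  that all copies can use the same functions.
\<close>

definition copy :: "nat \<Rightarrow> (nat \<Rightarrow> graph) \<Rightarrow> nat \<Rightarrow> graph" where
  "copy n G i = \<lparr>verts = (\<lambda>v. n * v + i) ` verts (G i), halves = (\<lambda>h. n * h + i) ` halves (G i),
     origin = (\<lambda>h. n * origin (G (h mod n)) (h div n) + h mod n),
     bar = (\<lambda>h. n * bar (G (h mod n)) (h div n) + h mod n)\<rparr>"

lemma copy_iso:
  assumes "i < n"
  shows "graph_iso (\<lambda>v. n * v + i) (\<lambda>v. n * v + i) (G i) (copy n G i)"
  using assms by (auto simp: graph_iso_def copy_def bij_betw_def inj_on_def)

lemma copy_disjoint:
  assumes "i < n" "j < n" "i \<noteq> j"
  shows "disjoint_graphs (copy n G i) (copy n G j)"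
proof -
  have "n * a + i \<noteq> n * b + j" for a b
  proof
    assume "n * a + i = n * b + j"
    then have "(n * a + i) mod n = (n * b + j) mod n" by simp
    then show False using assms by simp
  qed
  then show ?thesis by (auto simp: disjoint_graphs_def copy_def)
qed

definition lunion :: "labelling \<Rightarrow> labelling \<Rightarrow> labelling" where
  "lunion l l' = ljoin (relabel (\<lambda>v. 2 * v) (\<lambda>v. 2 * v) l) (relabel (\<lambda>v. 2 * v + 1) (\<lambda>v. 2 * v + 1) l')"

definition left_part :: "graph \<Rightarrow> graph \<Rightarrow> graph" where
  "left_part g g' = copy 2 (\<lambda>i. if i = 0 then g else g') 0"

definition right_part :: "graph \<Rightarrow> graph \<Rightarrow> graph" where
  "right_part g g' = copy 2 (\<lambda>i. if i = 0 then g else g') 1"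

lemma disjoint_union_parts:
  assumes g: "is_graph g" and g': "is_graph g'"
  shows "disjoint_union g g' = gunion (left_part g g') (right_part g g')"
    and "disjoint_graphs (left_part g g') (right_part g g')"
    and "is_graph (left_part g g')" "is_graph (right_part g g')"
    and "graph_iso (\<lambda>v. 2 * v) (\<lambda>v. 2 * v) g (left_part g g')"
    and "graph_iso (\<lambda>v. 2 * v + 1) (\<lambda>v. 2 * v + 1) g' (right_part g g')"
proof -
  let ?G = "\<lambda>i. if i = (0::nat) then g else g'"
  show "disjoint_union g g' = gunion (left_part g g') (right_part g g')"
    unfolding disjoint_union_def gunion_def copy_def left_part_def right_part_def
    by (auto intro!: ext simp: even_iff_mod_2_eq_zero odd_iff_mod_2_eq_one)
  show "disjoint_graphs (left_part g g') (right_part g g')"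
    unfolding left_part_def right_part_def by (rule copy_disjoint) auto
  show i: "graph_iso (\<lambda>v. 2 * v) (\<lambda>v. 2 * v) g (left_part g g')"
    "graph_iso (\<lambda>v. 2 * v + 1) (\<lambda>v. 2 * v + 1) g' (right_part g g')"
    using copy_iso[of 0 2 ?G] copy_iso[of 1 2 ?G] by (simp_all add: left_part_def right_part_def)
  show "is_graph (left_part g g')" "is_graph (right_part g g')"
    using is_graph_iso[OF g i(1)] is_graph_iso[OF g' i(2)] .
qed

lemma is_graph_disjoint_union: "is_graph g \<Longrightarrow> is_graph g' \<Longrightarrow> is_graph (disjoint_union g g')"
  using disjoint_union_parts is_graph_gunion by metis

lemma lunion_labellings:
  assumes "is_graph g" "is_graph g'" "l \<in> labellings g" "l' \<in> labellings g'"
  shows "lunion l l' \<in> labellings (disjoint_union g g')"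
proof -
  note k = disjoint_union_parts[OF assms(1,2)]
  show ?thesis
    unfolding k(1) lunion_def
    by (rule ljoin_labellings[OF k(3,4,2)])
      (use relabel_labellings[OF assms(1) k(5)] relabel_labellings[OF assms(2) k(6)] assms(3,4)
        in \<open>auto simp: relabel_def split: prod.splits\<close>)
qed

lemma relabel_mem:
  assumes "is_graph g" "graph_iso \<phi> \<psi> g g'" "l \<in> labellings g"
  shows "relabel \<phi> \<psi> l \<in> labellings g'"
  using relabel_labellings[OF assms(1,2)] assms(3) by (cases l) auto

lemma alternating_lunion:
  fixes F :: "labelling \<Rightarrow> 'k::field_char_0 graph_space"
  assumes g: "is_graph g" and g': "is_graph g'" and F: "alternating (disjoint_union g g') F"
  shows "l' \<in> labellings g' \<Longrightarrow> alternating g (\<lambda>l. F (lunion l l'))"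
    and "l \<in> labellings g \<Longrightarrow> alternating g' (\<lambda>l'. F (lunion l l'))"
proof -
  note k = disjoint_union_parts[OF g g']
  show "alternating g (\<lambda>l. F (lunion l l'))" if "l' \<in> labellings g'"
    unfolding lunion_def
    using alternating_relabel[OF g k(5) alternating_ljoin_left[OF k(3,4,2) relabel_mem[OF g' k(6) that]]]
      F[unfolded k(1)] by blast
  show "alternating g' (\<lambda>l'. F (lunion l l'))" if "l \<in> labellings g"
    unfolding lunion_def
    using alternating_relabel[OF g' k(6) alternating_ljoin_right[OF k(3,4,2) relabel_mem[OF g k(5) that]]]
      F[unfolded k(1)] by blast
qed

definition merge :: "(nat \<Rightarrow> nat) \<Rightarrow> (nat \<Rightarrow> nat) \<Rightarrow> nat \<Rightarrow> nat" where
  "merge f f' v = (if even v then f (v div 2) else f' (v div 2))"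

lemma merge_simps [simp]: "merge f f' (2 * v) = f v" "merge f f' (Suc (2 * v)) = f' v"
  by (auto simp: merge_def)

lemma bij_betw_merge:
  assumes "bij_betw f A B" "bij_betw f' A' B'" "B \<inter> B' = {}"
  shows "bij_betw (merge f f') ((\<lambda>v. 2 * v) ` A \<union> (\<lambda>v. 2 * v + 1) ` A') (B \<union> B')"
proof (rule bij_betw_combine[OF _ _ assms(3)])
  show "bij_betw (merge f f') ((\<lambda>v. 2 * v) ` A) B"
    using assms(1) by (auto simp: bij_betw_def inj_on_def image_image)
  show "bij_betw (merge f f') ((\<lambda>v. 2 * v + 1) ` A') B'"
    using assms(2) by (auto simp: bij_betw_def inj_on_def image_image)
qed

lemma disjoint_union_iso:
  assumes i: "graph_iso \<phi> \<psi> g k" and i': "graph_iso \<phi>' \<psi>' g' k'" and d: "disjoint_graphs k k'"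
  shows "graph_iso (merge \<phi> \<phi>') (merge \<psi> \<psi>') (disjoint_union g g') (gunion k k')"
proof -
  note i = graph_isoD[OF i] and i' = graph_isoD[OF i'] and d = d[unfolded disjoint_graphs_def]
  show ?thesis
    unfolding graph_iso_def
  proof (intro conjI ballI)
    show "bij_betw (merge \<phi> \<phi>') (verts (disjoint_union g g')) (verts (gunion k k'))"
      using bij_betw_merge[OF i(1) i'(1)] d by (simp add: disjoint_union_def)
    show "bij_betw (merge \<psi> \<psi>') (halves (disjoint_union g g')) (halves (gunion k k'))"
      using bij_betw_merge[OF i(2) i'(2)] d by (simp add: disjoint_union_def)
    fix h assume "h \<in> halves (disjoint_union g g')"
    then consider j where "j \<in> halves g" "h = 2 * j" | j where "j \<in> halves g'" "h = Suc (2 * j)"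
      by (auto simp: disjoint_union_def)
    then show "origin (gunion k k') (merge \<psi> \<psi>' h) = merge \<phi> \<phi>' (origin (disjoint_union g g') h)"
      "bar (gunion k k') (merge \<psi> \<psi>' h) = merge \<psi> \<psi>' (bar (disjoint_union g g') h)"
      using i(3,4) i'(3,4) d by (cases; simp add: disjoint_union_def)+
  qed
qed

lemma relabel_merge:
  "relabel (merge \<phi> \<phi>') (merge \<psi> \<psi>') (lunion l l') = ljoin (relabel \<phi> \<psi> l) (relabel \<phi>' \<psi>' l')"
  by (cases l; cases l') (simp add: lunion_def image_Un image_image o_def)

lemma relabel_identity:
  "relabel (\<lambda>v. v) (\<lambda>v. v) l = l"
  by (cases l) simp

text \<open>
  In \<open>Q W H H' l\<close>, the graph \<open>W\<close> is a disjoint union of two graphs with half-edges \<open>H\<close> and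
  \<open>H'\<close>, and \<open>l\<close> is a labelling of \<open>W\<close>.
\<close>

definition union_invariant ::
  "(graph \<Rightarrow> nat set \<Rightarrow> nat set \<Rightarrow> labelling \<Rightarrow> 'k::field_char_0 graph_space) \<Rightarrow> bool" where
  "union_invariant Q \<longleftrightarrow>
     (\<forall>k k'. is_graph k \<longrightarrow> is_graph k' \<longrightarrow> disjoint_graphs k k' \<longrightarrow>
        alternating (gunion k k') (Q (gunion k k') (halves k) (halves k'))) \<and>
     (\<forall>\<phi> \<psi> g g' k k' l. is_graph g \<longrightarrow> is_graph g' \<longrightarrow> disjoint_graphs g g' \<longrightarrow>
        disjoint_graphs k k' \<longrightarrow> graph_iso \<phi> \<psi> (gunion g g') (gunion k k') \<longrightarrow>
        halves k = \<psi> ` halves g \<longrightarrow> halves k' = \<psi> ` halves g' \<longrightarrow> l \<in> labellings (gunion g g') \<longrightarrow>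
        Q (gunion k k') (halves k) (halves k') (relabel \<phi> \<psi> l) = Q (gunion g g') (halves g) (halves g') l)"

lemma graph_invariant_disjoint_union:
  fixes Q :: "graph \<Rightarrow> nat set \<Rightarrow> nat set \<Rightarrow> labelling \<Rightarrow> 'k::field_char_0 graph_space"
  assumes Q: "union_invariant Q"
  defines "F \<equiv> \<lambda>g l g' l'. Q (disjoint_union g g') ((\<lambda>h. 2 * h) ` halves g) ((\<lambda>h. 2 * h + 1) ` halves g')
      (lunion l l')"
  shows "is_graph g \<Longrightarrow> l \<in> labellings g \<Longrightarrow> graph_invariant (F g l)" (is "PROP ?A")
    and "is_graph g' \<Longrightarrow> l' \<in> labellings g' \<Longrightarrow> graph_invariant (\<lambda>g l. F g l g' l')" (is "PROP ?B")
    and "is_graph g \<Longrightarrow> l \<in> labellings g \<Longrightarrow> is_graph g' \<Longrightarrow> l' \<in> labellings g' \<Longrightarrow> disjoint_graphs g g' \<Longrightarrow>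
      F g l g' l' = Q (gunion g g') (halves g) (halves g') (ljoin l l')" (is "PROP ?C")
proof -
  have alt: "alternating (gunion k k') (Q (gunion k k') (halves k) (halves k'))"
    if "is_graph k" "is_graph k'" "disjoint_graphs k k'" for k k'
    using Q that unfolding union_invariant_def by blast
  have iso: "Q (gunion k k') (halves k) (halves k') (relabel \<phi> \<psi> l) = Q (gunion g g') (halves g) (halves g') l"
    if "is_graph g" "is_graph g'" "disjoint_graphs g g'" "disjoint_graphs k k'"
      "graph_iso \<phi> \<psi> (gunion g g') (gunion k k')" "halves k = \<psi> ` halves g" "halves k' = \<psi> ` halves g'"
      "l \<in> labellings (gunion g g')" for \<phi> \<psi> g g' k k' l
    using Q that unfolding union_invariant_def by blast
  have F: "F g l g' l' = Q (gunion k k') (halves k) (halves k') (ljoin (relabel \<phi> \<psi> l) (relabel \<phi>' \<psi>' l'))"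
    if g: "is_graph g" "l \<in> labellings g" "is_graph g'" "l' \<in> labellings g'"
      and i: "graph_iso \<phi> \<psi> g k" "graph_iso \<phi>' \<psi>' g' k'" and d: "disjoint_graphs k k'"
    for g l g' l' \<phi> \<psi> \<phi>' \<psi>' k k'
  proof -
    define c c' where "c = left_part g g'" and "c' = right_part g g'"
    note c = disjoint_union_parts[OF g(1,3), folded c_def c'_def]
    have h: "halves c = (\<lambda>v. 2 * v) ` halves g" "halves c' = (\<lambda>v. 2 * v + 1) ` halves g'"
      "halves k = \<psi> ` halves g" "halves k' = \<psi>' ` halves g'"
      using c(5,6) i by (auto simp: graph_iso_def bij_betw_def)
    have "Q (gunion k k') (halves k) (halves k') (relabel (merge \<phi> \<phi>') (merge \<psi> \<psi>') (lunion l l')) =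
      Q (gunion c c') (halves c) (halves c') (lunion l l')"
    proof (rule iso[OF c(3,4,2) d])
      show "graph_iso (merge \<phi> \<phi>') (merge \<psi> \<psi>') (gunion c c') (gunion k k')"
        using disjoint_union_iso[OF i d] by (simp add: c(1))
      show "lunion l l' \<in> labellings (gunion c c')"
        using lunion_labellings[OF g(1,3,2,4)] by (simp add: c(1))
    qed (simp_all add: h image_image)
    then show ?thesis unfolding F_def relabel_merge c(1) h(1,2) by simp
  qed
  have Falt: "alternating (disjoint_union g g')
     (Q (disjoint_union g g') ((\<lambda>h. 2 * h) ` halves g) ((\<lambda>h. 2 * h + 1) ` halves g'))"
    if g: "is_graph g" "is_graph g'" for g g'
  proof -
    define c c' where "c = left_part g g'" and "c' = right_part g g'"
    note c = disjoint_union_parts[OF g, folded c_def c'_def]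
    have h: "halves c = (\<lambda>v. 2 * v) ` halves g" "halves c' = (\<lambda>v. 2 * v + 1) ` halves g'"
      using c(5,6) by (auto simp: graph_iso_def bij_betw_def)
    show ?thesis using alt[OF c(3,4,2)] by (simp add: c(1) h)
  qed
  show "PROP ?C"
  proof -
    assume g: "is_graph g" "l \<in> labellings g" "is_graph g'" "l' \<in> labellings g'" and d: "disjoint_graphs g g'"
    have "graph_iso (\<lambda>v. v) (\<lambda>v. v) g g" for g by (simp add: graph_iso_def bij_betw_def)
    from F[OF g this this d] show "F g l g' l' = Q (gunion g g') (halves g) (halves g') (ljoin l l')"
      by (simp add: relabel_identity)
  qed
  show "PROP ?A"
  proof -
    assume g: "is_graph g" "l \<in> labellings g"
    show "graph_invariant (F g l)"
      unfolding graph_invariant_def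
    proof (intro conjI allI impI)
      fix g' assume g': "is_graph g'"
      show "alternating g' (F g l g')"
        unfolding F_def by (rule alternating_lunion(2)[OF g(1) g' Falt[OF g(1) g'] g(2)])
    next
      fix \<phi> \<psi> g1 g2 l1 assume h: "is_graph g1" "graph_iso \<phi> \<psi> g1 g2" "l1 \<in> labellings g1"
      have g2: "is_graph g2" "relabel \<phi> \<psi> l1 \<in> labellings g2"
        using is_graph_iso[OF h(1,2)] relabel_mem[OF h] .
      note c = disjoint_union_parts(2,5,6)[OF g(1) g2(1)]
      show "F g l g2 (relabel \<phi> \<psi> l1) = F g l g1 l1"
        using F[OF g g2 c(2,3,1)] F[OF g h(1,3) c(2) graph_iso_comp[OF h(1,2) c(3)] c(1)]
        by (simp add: relabel_comp)
    qed
  qed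
  show "PROP ?B"
  proof -
    assume g': "is_graph g'" "l' \<in> labellings g'"
    show "graph_invariant (\<lambda>g l. F g l g' l')"
      unfolding graph_invariant_def
    proof (intro conjI allI impI)
      fix g assume g: "is_graph g"
      show "alternating g (\<lambda>l. F g l g' l')"
        unfolding F_def by (rule alternating_lunion(1)[OF g g'(1) Falt[OF g g'(1)] g'(2)])
    next
      fix \<phi> \<psi> g1 g2 l1 assume h: "is_graph g1" "graph_iso \<phi> \<psi> g1 g2" "l1 \<in> labellings g1"
      have g2: "is_graph g2" "relabel \<phi> \<psi> l1 \<in> labellings g2"
        using is_graph_iso[OF h(1,2)] relabel_mem[OF h] .
      note c = disjoint_union_parts(2,5,6)[OF g2(1) g'(1)]
      show "F g2 (relabel \<phi> \<psi> l1) g' l' = F g1 l1 g' l'"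
        using F[OF g2 g' c(2,3,1)] F[OF h(1,3) g' graph_iso_comp[OF h(1,2) c(2)] c(3) c(1)]
        by (simp add: relabel_comp)
    qed
  qed
qed

lemma ograph_prod_eq:
  obtains l l' where "l \<in> or_of X" "l' \<in> or_of Y"
    "X \<odot> Y = oriented (disjoint_union (graph_of X) (graph_of Y)) (lunion l l')"
proof -
  define l l' where "l = (SOME l. l \<in> or_of X)" and "l' = (SOME l. l \<in> or_of Y)"
  have "l \<in> or_of X" "l' \<in> or_of Y"
    using someI_ex[OF or_of_nonempty] unfolding l_def l'_def by auto
  moreover have "X \<odot> Y = oriented (disjoint_union (graph_of X) (graph_of Y)) (lunion l l')"
    unfolding ograph_prod_def l_def[symmetric] l'_def[symmetric]
    by (cases l; cases l') (simp add: lunion_def)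
  ultimately show thesis by (rule that)
qed

lemma gprod_facts:
  shows bilinear_extension_gprod:
    "bilinear_extension (\<lambda>X Y. cls (X \<odot> Y)) (gprod :: 'k::field_char_0 graph_space \<Rightarrow> _)"
    and gprod_gcls: "is_graph g \<Longrightarrow> l \<in> labellings g \<Longrightarrow> is_graph g' \<Longrightarrow> l' \<in> labellings g' \<Longrightarrow>
      disjoint_graphs g g' \<Longrightarrow>
      gprod (gcls g l) (gcls g' l') = (gcls (gunion g g') (ljoin l l') :: 'k graph_space)"
proof -
  let ?Q = "\<lambda>k (_ :: nat set) (_ :: nat set). gcls k :: _ \<Rightarrow> 'k graph_space"
  have Q: "union_invariant ?Q"
    unfolding union_invariant_def by (simp add: gcls_alternating is_graph_gunion gcls_relabel)
  note I = graph_invariant_disjoint_union[OF Q]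
  obtain B :: "'k graph_space \<Rightarrow> 'k graph_space \<Rightarrow> 'k graph_space" where B: "bilinear_map gscale B"
    "\<And>g l g' l'. is_graph g \<Longrightarrow> l \<in> labellings g \<Longrightarrow> is_graph g' \<Longrightarrow> l' \<in> labellings g' \<Longrightarrow>
       B (gcls g l) (gcls g' l') = gcls (disjoint_union g g') (lunion l l')"
    using bilinear_map_extension[OF I(1,2)] by blast
  have "B (cls X) (cls Y) = cls (X \<odot> Y)" for X Y
  proof -
    obtain l l' where l: "l \<in> or_of X" "l' \<in> or_of Y"
      "X \<odot> Y = oriented (disjoint_union (graph_of X) (graph_of Y)) (lunion l l')"
      by (rule ograph_prod_eq)
    show ?thesis
      unfolding cls_eq_gcls[OF l(1)] cls_eq_gcls[OF l(2)] l(3)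
      by (subst B(2)) (use l or_of_subset in \<open>auto simp: gcls_def\<close>)
  qed
  then have "bilinear_extension (\<lambda>X Y. cls (X \<odot> Y)) B"
    using B(1) by (simp add: bilinear_extension_def)
  then have *: "gprod = B" "bilinear_extension (\<lambda>X Y. cls (X \<odot> Y)) B"
    using bilinear_extension_The[of "\<lambda>X Y. cls (X \<odot> Y)" B] by (simp_all add: gprod_def)
  then show "bilinear_extension (\<lambda>X Y. cls (X \<odot> Y)) (gprod :: 'k graph_space \<Rightarrow> _)" by simp
  show "gprod (gcls g l) (gcls g' l') = (gcls (gunion g g') (ljoin l l') :: 'k graph_space)"
    if "is_graph g" "l \<in> labellings g" "is_graph g'" "l' \<in> labellings g'" "disjoint_graphs g g'"
    unfolding *(1) B(2)[OF that(1-4)] by (rule I(3)[OF that])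
qed

section \<open>Contraction of two half-edges\<close>

definition list_alternating :: "nat set \<Rightarrow> (nat list \<Rightarrow> 'a::ab_group_add) \<Rightarrow> bool" where
  "list_alternating V f \<longleftrightarrow> (\<forall>as x y bs. distinct (as @ x # y # bs) \<longrightarrow> set (as @ x # y # bs) = V \<longrightarrow>
     f (as @ y # x # bs) = - f (as @ x # y # bs))"

definition extract_vertex :: "nat \<Rightarrow> (nat list \<Rightarrow> 'k::field_char_0 graph_space) \<Rightarrow> nat list \<Rightarrow> 'k graph_space" where
  "extract_vertex a f vs = (-1) ^ length (takeWhile (\<lambda>v. v \<noteq> a) vs) *\<^sub>G f (remove1 a vs)"

lemma extract_append:
  assumes "a \<notin> set as"
  shows "extract_vertex a f (as @ a # bs) = (-1) ^ length as *\<^sub>G f (as @ bs)"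
proof -
  have "takeWhile (\<lambda>v. v \<noteq> a) (as @ a # bs) = as"
    using assms by (subst takeWhile_append2) auto
  then show ?thesis using assms by (simp add: extract_vertex_def remove1_append)
qed

lemma extract_alternating:
  assumes f: "list_alternating (V - {a}) f" and a: "a \<in> V"
  shows "list_alternating V (extract_vertex a f)"
  unfolding list_alternating_def
proof (intro allI impI)
  fix as x y bs assume d: "distinct (as @ x # y # bs)" and s: "set (as @ x # y # bs) = V"
  have f': "f (cs @ y # x # ds) = - f (cs @ x # y # ds)"
    if "distinct (cs @ x # y # ds)" "set (cs @ x # y # ds) = V - {a}" for cs ds
    using f that unfolding list_alternating_def by blast
  consider "a = x" | "a = y" | "a \<noteq> x" "a \<noteq> y" "a \<in> set as" | "a \<noteq> x" "a \<noteq> y" "a \<in> set bs"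
    using a s by auto
  then show "extract_vertex a f (as @ y # x # bs) = - extract_vertex a f (as @ x # y # bs)"
  proof cases
    case 1
    then show ?thesis
      using d extract_append[of x as f "y # bs"] extract_append[of x "as @ [y]" f bs] by auto
  next
    case 2
    then show ?thesis
      using d extract_append[of y as f "x # bs"] extract_append[of y "as @ [x]" f bs] by auto
  next
    case 3
    then obtain as1 as2 where as: "as = as1 @ a # as2" by (auto simp: in_set_conv_decomp)
    have "f ((as1 @ as2) @ y # x # bs) = - f ((as1 @ as2) @ x # y # bs)"
      by (rule f') (use d s as in auto)
    then show ?thesis
      using d extract_append[of a as1 f "as2 @ x # y # bs"] extract_append[of a as1 f "as2 @ y # x # bs"]
      by (simp add: as)
  next
    case 4
    then obtain bs1 bs2 where bs: "bs = bs1 @ a # bs2" by (auto simp: in_set_conv_decomp)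
    have "f (as @ y # x # bs1 @ bs2) = - f (as @ x # y # bs1 @ bs2)"
      by (rule f') (use d s bs in auto)
    then show ?thesis
      using d 4 extract_append[of a "as @ x # y # bs1" f bs2] extract_append[of a "as @ y # x # bs1" f bs2]
      by (simp add: bs)
  qed
qed

definition reglue_graph :: "graph \<Rightarrow> nat \<Rightarrow> nat \<Rightarrow> graph" where
  "reglue_graph g h k = g\<lparr>bar := (bar g)(h := k, k := h, bar g h := bar g k, bar g k := bar g h)\<rparr>"

definition collapse_graph :: "graph \<Rightarrow> nat \<Rightarrow> graph" where
  "collapse_graph g h = g\<lparr>verts := verts g - {origin g (bar g h)}, halves := halves g - {h, bar g h},
     origin := (\<lambda>j. if origin g j = origin g (bar g h) then origin g h else origin g j)\<rparr>"

definition contract_graph :: "graph \<Rightarrow> nat \<Rightarrow> nat \<Rightarrow> graph" where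
  "contract_graph g h k = collapse_graph (reglue_graph g h k) h"

definition collapse_lift :: "graph \<Rightarrow> nat \<Rightarrow> (labelling \<Rightarrow> 'k::field_char_0 graph_space) \<Rightarrow>
    labelling \<Rightarrow> 'k graph_space" where
  "collapse_lift g h F = (\<lambda>(vs, I). (if h \<in> I then 1 else - 1) *\<^sub>G
     extract_vertex (origin g h) (extract_vertex (origin g (bar g h))
       (\<lambda>r. F (origin g h # r, I - {h, bar g h}))) vs)"

definition reglue_lift :: "graph \<Rightarrow> nat \<Rightarrow> nat \<Rightarrow> (labelling \<Rightarrow> 'k::field_char_0 graph_space) \<Rightarrow>
    labelling \<Rightarrow> 'k graph_space" where
  "reglue_lift g h k F = (\<lambda>(vs, I). (if h \<in> I then 1 else - 1) *\<^sub>G (if k \<in> I then - 1 else 1) *\<^sub>G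
     F (vs, insert h (insert (bar g k) (I - {bar g h, k}))))"

text \<open>
  \<open>contract_lift g h k F\<close> extends the function \<open>(vs, I) \<mapsto> F (origin g h # drop 2 vs, I - {h, k})\<close>,
  defined on the labellings suited to the contraction of \<open>h\<close> with \<open>k\<close>, to an
  alternating function on all labellings.
\<close>

definition contract_lift :: "graph \<Rightarrow> nat \<Rightarrow> nat \<Rightarrow> (labelling \<Rightarrow> 'k::field_char_0 graph_space) \<Rightarrow>
    labelling \<Rightarrow> 'k graph_space" where
  "contract_lift g h k F = reglue_lift g h k (collapse_lift (reglue_graph g h k) h F)"

definition contractible :: "graph \<Rightarrow> nat \<Rightarrow> nat \<Rightarrow> bool" where
  "contractible g h k \<longleftrightarrow> h \<in> halves g \<and> k \<in> halves g \<and> k \<noteq> bar g h \<and> origin g h \<noteq> origin g k"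

lemma contractibleD:
  assumes "contractible g h k"
  shows "h \<in> halves g" "k \<in> halves g" "origin g h \<noteq> origin g k" "k \<noteq> bar g h"
  using assms by (simp_all add: contractible_def)

lemma reglue_graph_simps [simp]:
  "verts (reglue_graph g h k) = verts g" "halves (reglue_graph g h k) = halves g"
  "origin (reglue_graph g h k) = origin g"
  by (simp_all add: reglue_graph_def)

lemma collapse_graph_simps [simp]:
  "verts (collapse_graph g h) = verts g - {origin g (bar g h)}"
  "halves (collapse_graph g h) = halves g - {h, bar g h}"
  "origin (collapse_graph g h) =
     (\<lambda>j. if origin g j = origin g (bar g h) then origin g h else origin g j)"
  "bar (collapse_graph g h) = bar g"
  by (simp_all add: collapse_graph_def)

lemma contractible_distinct:
  assumes "is_graph g" "contractible g h k"
  shows "distinct [h, k, bar g h, bar g k]"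
proof -
  note b = is_graphD(5,6)[OF assms(1)]
  have c: "h \<in> halves g" "k \<in> halves g" "k \<noteq> bar g h" "h \<noteq> k"
    using assms(2) by (auto simp: contractible_def)
  have "h \<noteq> bar g k" using c b(2)[OF c(2)] by auto
  moreover have "bar g h \<noteq> bar g k" using b(2)[OF c(1)] b(2)[OF c(2)] c(4) by metis
  ultimately show ?thesis using b(1)[OF c(1)] b(1)[OF c(2)] c by simp
qed

lemma bar_reglue_graph:
  assumes "is_graph g" "contractible g h k"
  shows "bar (reglue_graph g h k) h = k" "bar (reglue_graph g h k) k = h"
    "bar (reglue_graph g h k) (bar g h) = bar g k" "bar (reglue_graph g h k) (bar g k) = bar g h"
    "j \<notin> {h, k, bar g h, bar g k} \<Longrightarrow> bar (reglue_graph g h k) j = bar g j"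
  using contractible_distinct[OF assms] by (auto simp: reglue_graph_def)

lemma bar_notin:
  assumes "is_graph g" "contractible g h k" "j \<in> halves g" "j \<notin> {h, k, bar g h, bar g k}"
  shows "bar g j \<notin> {h, k, bar g h, bar g k}"
proof -
  have c: "h \<in> halves g" "k \<in> halves g" using assms by (auto simp: contractible_def)
  show ?thesis
    using is_graphD(6)[OF assms(1)] c assms(3,4) by (metis insertCI insertE singletonD)
qed

lemma is_graph_reglue:
  assumes g: "is_graph g" and c: "contractible g h k"
  shows "is_graph (reglue_graph g h k)"
proof -
  let ?g = "reglue_graph g h k"
  note hk = contractibleD[OF c]
  note hk = hk is_graphD(4)[OF g hk(1)] is_graphD(4)[OF g hk(2)]
  have "bar ?g j \<in> halves g \<and> bar ?g j \<noteq> j \<and> bar ?g (bar ?g j) = j" if j: "j \<in> halves g" for j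
  proof (cases "j \<in> {h, k, bar g h, bar g k}")
    case True
    then consider "j = h" | "j = k" | "j = bar g h" | "j = bar g k" by blast
    then show ?thesis
      using contractible_distinct[OF g c] hk by cases (simp_all add: bar_reglue_graph(1-4)[OF g c])
  next
    case False
    show ?thesis
      using bar_reglue_graph(5)[OF g c False] bar_reglue_graph(5)[OF g c bar_notin[OF g c j False]]
        is_graphD(4-6)[OF g j] by simp
  qed
  then show ?thesis using is_graphD[OF g] unfolding is_graph_def by simp
qed

lemma is_graph_collapse:
  assumes g: "is_graph g" and h: "h \<in> halves g" and n: "origin g h \<noteq> origin g (bar g h)"
  shows "is_graph (collapse_graph g h)"
proof -
  let ?a = "origin g h" and ?b = "origin g (bar g h)" and ?g = "collapse_graph g h"
  note b = is_graphD(4-6)[OF g]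
  have "origin ?g j \<in> verts ?g \<and> bar ?g j \<in> halves ?g \<and> bar ?g j \<noteq> j \<and> bar ?g (bar ?g j) = j"
    if j: "j \<in> halves ?g" for j
  proof -
    have j': "j \<in> halves g" "j \<noteq> h" "j \<noteq> bar g h" using j by auto
    then have "bar g j \<noteq> h" "bar g j \<noteq> bar g h" using b(3)[OF j'(1)] b(3)[OF h] by metis+
    then show ?thesis using j' b(1-3)[OF j'(1)] is_graphD(3)[OF g] h n by auto
  qed
  moreover have "3 \<le> card {j \<in> halves ?g. origin ?g j = v}" if v: "v \<in> verts ?g" for v
  proof (cases "v = ?a")
    case True
    let ?A = "{j \<in> halves g. origin g j = ?a}" and ?B = "{j \<in> halves g. origin g j = ?b}"
    have fin: "finite ?A" "finite ?B" using is_graphD(2)[OF g] by auto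
    have S: "{j \<in> halves ?g. origin ?g j = v} = (?A - {h}) \<union> (?B - {bar g h})"
      using True n by auto
    have "card ((?A - {h}) \<union> (?B - {bar g h})) = card (?A - {h}) + card (?B - {bar g h})"
      by (rule card_Un_disjoint) (use fin n in auto)
    moreover have "card (?A - {h}) = card ?A - 1" "card (?B - {bar g h}) = card ?B - 1"
      using fin h b(1)[OF h] by (auto intro!: card_Diff_singleton)
    moreover have "3 \<le> card ?A" "3 \<le> card ?B"
      using is_graphD(7)[OF g is_graphD(3)[OF g h]] is_graphD(7)[OF g is_graphD(3)[OF g b(1)[OF h]]] .
    ultimately show ?thesis unfolding S by linarith
  next
    case False
    then have "{j \<in> halves ?g. origin ?g j = v} = {j \<in> halves g. origin g j = v}"
      using v by auto
    then show ?thesis using is_graphD(7)[OF g, of v] v by simp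
  qed
  ultimately show ?thesis using is_graphD(1,2)[OF g] unfolding is_graph_def by simp
qed

lemma is_graph_contract:
  assumes "is_graph g" "contractible g h k"
  shows "is_graph (contract_graph g h k)"
  unfolding contract_graph_def using assms
  by (intro is_graph_collapse is_graph_reglue)
    (auto simp: bar_reglue_graph contractible_def)

lemma contract_graph_simps:
  assumes "is_graph g" "contractible g h k"
  shows "verts (contract_graph g h k) = verts g - {origin g k}"
    "halves (contract_graph g h k) = halves g - {h, k}"
    "origin (contract_graph g h k) = (\<lambda>j. if origin g j = origin g k then origin g h else origin g j)"
    "bar (contract_graph g h k) = bar (reglue_graph g h k)"
  using bar_reglue_graph(1)[OF assms] by (simp_all add: contract_graph_def cong: if_cong)

lemma collapse_labellings:
  assumes g: "is_graph g" and h: "h \<in> halves g" and n: "origin g h \<noteq> origin g (bar g h)"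
    and l: "(vs, I) \<in> labellings g"
    and r: "distinct (origin g h # r)" "set (origin g h # r) = verts g - {origin g (bar g h)}"
  shows "(origin g h # r, I - {h, bar g h}) \<in> labellings (collapse_graph g h)"
proof -
  have "j \<in> I - {h, bar g h} \<longleftrightarrow> bar g j \<notin> I - {h, bar g h}"
    if j: "j \<in> halves g" "j \<notin> {h, bar g h}" for j
  proof -
    have "bar g j \<noteq> h" "bar g j \<noteq> bar g h"
      using is_graphD(6)[OF g j(1)] is_graphD(6)[OF g h] j(2) by (metis insertCI)+
    moreover have "j \<in> I \<longleftrightarrow> bar g j \<notin> I" using l j(1) by (simp add: mem_labellings)
    ultimately show ?thesis using j(2) by simp
  qed
  moreover have "I \<subseteq> halves g" using l by (simp add: mem_labellings)
  ultimately show ?thesis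
    using r unfolding mem_labellings collapse_graph_simps by blast
qed

lemma collapse_lift_alternating:
  assumes g: "is_graph g" and h: "h \<in> halves g" and n: "origin g h \<noteq> origin g (bar g h)"
    and F: "alternating (collapse_graph g h) F"
  shows "alternating g (collapse_lift g h F)"
proof (rule alternatingI)
  let ?a = "origin g h" and ?b = "origin g (bar g h)"
  have ab: "?a \<in> verts g" "?b \<in> verts g" using is_graphD(3,4)[OF g] h by auto
  fix as x y bs I assume l: "(as @ x # y # bs, I) \<in> labellings g"
  have "list_alternating (verts g - {?a} - {?b}) (\<lambda>r. F (?a # r, I - {h, bar g h}))"
    unfolding list_alternating_def
  proof (intro allI impI)
    fix cs x y ds assume *: "distinct (cs @ x # y # ds)" "set (cs @ x # y # ds) = verts g - {?a} - {?b}"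
    have "(?a # cs @ x # y # ds, I - {h, bar g h}) \<in> labellings (collapse_graph g h)"
      by (rule collapse_labellings[OF g h n l]) (use * ab n in auto)
    then show "F (?a # cs @ y # x # ds, I - {h, bar g h}) = - F (?a # cs @ x # y # ds, I - {h, bar g h})"
      using alternating_swap[OF F, of "?a # cs" x "[]" y ds] by simp
  qed
  then have "list_alternating (verts g) (extract_vertex ?a (extract_vertex ?b (\<lambda>r. F (?a # r, I - {h, bar g h}))))"
    using ab n by (intro extract_alternating) auto
  then show "collapse_lift g h F (as @ y # x # bs, I) = - collapse_lift g h F (as @ x # y # bs, I)"
    using l unfolding list_alternating_def collapse_lift_def mem_labellings by simp
next
  let ?a = "origin g h" and ?b = "origin g (bar g h)"
  fix vs I j assume l: "(vs, I) \<in> labellings g" and j: "j \<in> I"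
  have jh: "j \<in> halves g" using l j by (auto simp: mem_labellings)
  have hI: "h \<in> I \<longleftrightarrow> bar g h \<notin> I" using l h by (simp add: mem_labellings)
  note b = is_graphD(4-6)[OF g]
  let ?J = "insert (bar g j) (I - {j})"
  show "collapse_lift g h F (vs, ?J) = - collapse_lift g h F (vs, I)"
  proof (cases "j = h \<or> j = bar g h")
    case True
    then have "?J - {h, bar g h} = I - {h, bar g h}" using b(3)[OF h] by auto
    moreover have "h \<in> ?J \<longleftrightarrow> h \<notin> I" using True hI j b(2,3)[OF h] by auto
    ultimately show ?thesis by (simp add: collapse_lift_def)
  next
    case False
    then have nb: "bar g j \<noteq> h" "bar g j \<noteq> bar g h" using b(3)[OF jh] b(3)[OF h] by metis+
    have J: "?J - {h, bar g h} = insert (bar (collapse_graph g h) j) ((I - {h, bar g h}) - {j})"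
      using nb by auto
    have vs: "distinct vs" "set vs = verts g" using l by (auto simp: mem_labellings)
    have "F (?a # remove1 ?b (remove1 ?a vs), ?J - {h, bar g h}) =
        - F (?a # remove1 ?b (remove1 ?a vs), I - {h, bar g h})"
      unfolding J
    proof (rule alternating_flip[OF F])
      show "(?a # remove1 ?b (remove1 ?a vs), I - {h, bar g h}) \<in> labellings (collapse_graph g h)"
        by (rule collapse_labellings[OF g h n l])
          (use vs n is_graphD(3)[OF g h] in \<open>auto simp: distinct_remove1\<close>)
    qed (use j False in auto)
    moreover have "h \<in> ?J \<longleftrightarrow> h \<in> I" using nb False by auto
    ultimately show ?thesis by (simp add: collapse_lift_def extract_vertex_def)
  qed
qed

lemma reglue_labellings:
  assumes g: "is_graph g" and c: "contractible g h k" and l: "(vs, I) \<in> labellings g"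
  shows "(vs, insert h (insert (bar g k) (I - {bar g h, k}))) \<in> labellings (reglue_graph g h k)"
proof -
  let ?I = "insert h (insert (bar g k) (I - {bar g h, k}))"
  note hk = contractibleD[OF c]
  note hk = hk is_graphD(4)[OF g hk(1)] is_graphD(4)[OF g hk(2)]
  have "j \<in> ?I \<longleftrightarrow> bar (reglue_graph g h k) j \<notin> ?I" if j: "j \<in> halves g" for j
  proof (cases "j \<in> {h, k, bar g h, bar g k}")
    case True
    then consider "j = h" | "j = k" | "j = bar g h" | "j = bar g k" by blast
    then show ?thesis
      using contractible_distinct[OF g c] by cases (simp_all add: bar_reglue_graph(1-4)[OF g c])
  next
    case False
    moreover have "j \<in> I \<longleftrightarrow> bar g j \<notin> I" using l j by (simp add: mem_labellings)
    ultimately show ?thesis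
      using bar_reglue_graph(5)[OF g c False] bar_notin[OF g c j False] by simp
  qed
  then show ?thesis using l hk unfolding mem_labellings reglue_graph_simps by blast
qed

lemma reglue_lift_alternating:
  assumes g: "is_graph g" and c: "contractible g h k" and F: "alternating (reglue_graph g h k) F"
  shows "alternating g (reglue_lift g h k F)"
proof (rule alternatingI)
  fix as x y bs I assume l: "(as @ x # y # bs, I) \<in> labellings g"
  from alternating_swap[OF F, of as x "[]" y bs] reglue_labellings[OF g c l]
  show "reglue_lift g h k F (as @ y # x # bs, I) = - reglue_lift g h k F (as @ x # y # bs, I)"
    by (simp add: reglue_lift_def)
next
  fix vs I j assume l: "(vs, I) \<in> labellings g" and j: "j \<in> I"
  have jh: "j \<in> halves g" using l j by (auto simp: mem_labellings)
  note hk = contractibleD[OF c]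
  note d = contractible_distinct[OF g c] and b = is_graphD(4-6)[OF g]
  have hI: "h \<in> I \<longleftrightarrow> bar g h \<notin> I" "k \<in> I \<longleftrightarrow> bar g k \<notin> I" using l hk by (auto simp: mem_labellings)
  let ?J = "insert (bar g j) (I - {j})"
  let ?N = "\<lambda>I. insert h (insert (bar g k) (I - {bar g h, k}))"
  consider "j = h \<or> j = bar g h" | "j = k \<or> j = bar g k" | "j \<notin> {h, k, bar g h, bar g k}" by blast
  then show "reglue_lift g h k F (vs, ?J) = - reglue_lift g h k F (vs, I)"
  proof cases
    case 1
    then have "?N ?J = ?N I" using b(3)[OF hk(1)] by auto
    moreover have "h \<in> ?J \<longleftrightarrow> h \<notin> I" "k \<in> ?J \<longleftrightarrow> k \<in> I"
      using 1 hI(1) j d b(3)[OF hk(1)] by auto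
    ultimately show ?thesis by (simp add: reglue_lift_def)
  next
    case 2
    then have "?N ?J = ?N I" using b(3)[OF hk(2)] by auto
    moreover have "h \<in> ?J \<longleftrightarrow> h \<in> I" "k \<in> ?J \<longleftrightarrow> k \<notin> I"
      using 2 hI(2) j d b(3)[OF hk(2)] by auto
    ultimately show ?thesis by (simp add: reglue_lift_def)
  next
    case 3
    note nb = bar_notin[OF g c jh 3]
    have "?N ?J = insert (bar (reglue_graph g h k) j) (?N I - {j})"
      unfolding bar_reglue_graph(5)[OF g c 3] using 3 nb by auto
    then have "F (vs, ?N ?J) = - F (vs, ?N I)"
      using alternating_flip[OF F reglue_labellings[OF g c l], of j] j 3 by simp
    moreover have "h \<in> ?J \<longleftrightarrow> h \<in> I" "k \<in> ?J \<longleftrightarrow> k \<in> I" using 3 nb by auto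
    ultimately show ?thesis by (simp add: reglue_lift_def)
  qed
qed

lemma contract_lift_alternating:
  assumes g: "is_graph g" and c: "contractible g h k" and F: "alternating (contract_graph g h k) F"
  shows "alternating g (contract_lift g h k F)"
  unfolding contract_lift_def
proof (rule reglue_lift_alternating[OF g c], rule collapse_lift_alternating)
  show "is_graph (reglue_graph g h k)" by (rule is_graph_reglue[OF g c])
  show "origin (reglue_graph g h k) h \<noteq> origin (reglue_graph g h k) (bar (reglue_graph g h k) h)"
    "h \<in> halves (reglue_graph g h k)"
    using c bar_reglue_graph(1)[OF g c] by (auto simp: contractible_def)
  show "alternating (collapse_graph (reglue_graph g h k) h) F"
    using F by (simp add: contract_graph_def)
qed

lemma contract_lift_standard:
  assumes g: "is_graph g" and c: "contractible g h k"
    and l: "([origin g h, origin g k] @ r, I) \<in> labellings g" and hI: "{h, bar g k} \<subseteq> I"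
  shows "contract_lift g h k F ([origin g h, origin g k] @ r, I) = F (origin g h # r, I - {h, k})"
    and "h \<in> I" "k \<notin> I" "bar g h \<notin> I" "bar g k \<in> I"
proof -
  note hk = contractibleD[OF c]
  show I: "h \<in> I" "k \<notin> I" "bar g h \<notin> I" "bar g k \<in> I"
    using hI l hk by (auto simp: mem_labellings)
  have "insert (bar g k) (I - {bar g h, k}) - {h, k} = I - {h, k}" using I by auto
  then show "contract_lift g h k F ([origin g h, origin g k] @ r, I) = F (origin g h # r, I - {h, k})"
    using I(1,2) hk(3) bar_reglue_graph(1)[OF g c]
    by (simp add: contract_lift_def reglue_lift_def collapse_lift_def extract_vertex_def)
qed

lemma contract_labellings:
  assumes g: "is_graph g" and c: "contractible g h k"
    and l: "([origin g h, origin g k] @ r, I) \<in> labellings g" and hI: "{h, bar g k} \<subseteq> I"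
  shows "(origin g h # r, I - {h, k}) \<in> labellings (contract_graph g h k)"
proof -
  note I = contract_lift_standard(2-)[OF g c l hI]
  let ?g = "reglue_graph g h k"
  have "insert h (insert (bar g k) (I - {bar g h, k})) = I" using I by auto
  then have l': "([origin g h, origin g k] @ r, I) \<in> labellings ?g"
    using reglue_labellings[OF g c l] by simp
  note b = bar_reglue_graph(1)[OF g c]
  have "(origin ?g h # r, I - {h, bar ?g h}) \<in> labellings (collapse_graph ?g h)"
  proof (rule collapse_labellings[OF is_graph_reglue[OF g c] _ _ l'])
    show "h \<in> halves ?g" "origin ?g h \<noteq> origin ?g (bar ?g h)"
      using c b by (auto simp: contractible_def)
    show "distinct (origin ?g h # r)" "set (origin ?g h # r) = verts ?g - {origin ?g (bar ?g h)}"
      using l b c unfolding mem_labellings contractible_def by auto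
  qed
  then show ?thesis by (simp add: contract_graph_def b)
qed

lemma contract_standard:
  assumes g: "is_graph g" and c: "contractible g h k"
  shows "distinct [origin g h, origin g k]" "set [origin g h, origin g k] \<subseteq> verts g"
    and "{h, bar g k} \<subseteq> halves g" "j \<in> {h, bar g k} \<Longrightarrow> bar g j \<notin> {h, bar g k}"
  using contractibleD[OF c] contractible_distinct[OF g c] is_graphD(3,4)[OF g] is_graphD(6)[OF g, of k]
  by auto

lemma alternating_eq_contract:
  assumes g: "is_graph g" and c: "contractible g h k"
    and F: "alternating g F" "alternating g F'"
    and eq: "\<And>r I. ([origin g h, origin g k] @ r, I) \<in> labellings g \<Longrightarrow> {h, bar g k} \<subseteq> I \<Longrightarrow>
      F ([origin g h, origin g k] @ r, I) = F' ([origin g h, origin g k] @ r, I)"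
    and l: "l \<in> labellings g"
  shows "F l = F' l"
  by (rule alternating_eq_standard[OF g F contract_standard[OF g c] eq l])

definition contraction :: "graph \<Rightarrow> nat \<Rightarrow> nat \<Rightarrow> labelling \<Rightarrow> 'k::field_char_0 graph_space" where
  "contraction g h k = contract_lift g h k (gcls (contract_graph g h k))"

lemma contraction_alternating:
  assumes "is_graph g" "contractible g h k"
  shows "alternating g (contraction g h k :: _ \<Rightarrow> 'k::field_char_0 graph_space)"
  unfolding contraction_def
  by (intro contract_lift_alternating gcls_alternating is_graph_contract assms)

lemma contractible_iso:
  assumes g: "is_graph g" and i: "graph_iso \<phi> \<psi> g g'" and c: "contractible g h k"
  shows "contractible g' (\<psi> h) (\<psi> k)"
proof -
  note i = graph_isoD[OF i]
  note hk = contractibleD[OF c]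
  have "inj_on \<psi> (halves g)" "inj_on \<phi> (verts g)" "\<psi> ` halves g = halves g'"
    using i(1,2) by (auto simp: bij_betw_def)
  then show ?thesis
    using hk i(3)[OF hk(1)] i(3)[OF hk(2)] i(4)[OF hk(1)] is_graphD(3,4)[OF g hk(1)] is_graphD(3,4)[OF g hk(2)]
    unfolding contractible_def by (auto simp: inj_on_eq_iff)
qed

lemma contract_graph_iso:
  assumes g: "is_graph g" and i: "graph_iso \<phi> \<psi> g g'" and c: "contractible g h k"
  shows "graph_iso \<phi> \<psi> (contract_graph g h k) (contract_graph g' (\<psi> h) (\<psi> k))"
proof -
  note g' = is_graph_iso[OF g i] and c' = contractible_iso[OF g i c]
  note i = graph_isoD[OF i]
  note hk = contractibleD[OF c]
  have inj: "inj_on \<psi> (halves g)" "inj_on \<phi> (verts g)"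
    using i(1,2) by (auto simp: bij_betw_def)
  show ?thesis
    unfolding graph_iso_def contract_graph_simps[OF g c] contract_graph_simps[OF g' c']
  proof (intro conjI ballI)
    show "bij_betw \<phi> (verts g - {origin g k}) (verts g' - {origin g' (\<psi> k)})"
      unfolding i(3)[OF hk(2)]
      by (rule bij_betw_DiffI[OF i(1) bij_betw_singletonI])
        (use is_graphD(3)[OF g hk(2)] bij_betw_apply[OF i(1)] in auto)
    have "bij_betw \<psi> {h, k} {\<psi> h, \<psi> k}"
      using inj_on_subset[OF inj(1), of "{h, k}"] hk by (simp add: bij_betw_def)
    then show "bij_betw \<psi> (halves g - {h, k}) (halves g' - {\<psi> h, \<psi> k})"
      by (rule bij_betw_DiffI[OF i(2)]) (use hk bij_betw_apply[OF i(2)] in auto)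
    fix j assume j: "j \<in> halves g - {h, k}"
    then have jh: "j \<in> halves g" by simp
    show "(if origin g' (\<psi> j) = origin g' (\<psi> k) then origin g' (\<psi> h) else origin g' (\<psi> j)) =
        \<phi> (if origin g j = origin g k then origin g h else origin g j)"
      using i(3)[OF jh] i(3)[OF hk(1)] i(3)[OF hk(2)] inj(2) is_graphD(3)[OF g] jh hk
      by (simp add: inj_on_eq_iff)
    show "bar (reglue_graph g' (\<psi> h) (\<psi> k)) (\<psi> j) = \<psi> (bar (reglue_graph g h k) j)"
    proof (cases "j \<in> {h, k, bar g h, bar g k}")
      case True
      then show ?thesis
        using j bar_reglue_graph[OF g c] bar_reglue_graph[OF g' c'] i(4)[OF hk(1)] i(4)[OF hk(2)]
        by auto
    next
      case False
      have "\<psi> j \<notin> {\<psi> h, \<psi> k, bar g' (\<psi> h), bar g' (\<psi> k)}"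
        using False i(4)[OF hk(1)] i(4)[OF hk(2)] inj(1) jh hk is_graphD(4)[OF g]
        by (simp add: inj_on_eq_iff)
      from bar_reglue_graph(5)[OF g' c' this] bar_reglue_graph(5)[OF g c False] i(4)[OF jh]
      show ?thesis by simp
    qed
  qed
qed

lemma contraction_relabel:
  assumes g: "is_graph g" and i: "graph_iso \<phi> \<psi> g g'" and c: "contractible g h k"
    and l: "l \<in> labellings g"
  shows "contraction g' (\<psi> h) (\<psi> k) (relabel \<phi> \<psi> l) = (contraction g h k l :: 'k::field_char_0 graph_space)"
proof -
  note g' = is_graph_iso[OF g i] and c' = contractible_iso[OF g i c]
  note alt = alternating_relabel[OF g i contraction_alternating[OF g' c', where 'k = 'k]]
  note hk = contractibleD[OF c]
  show ?thesis
  proof (rule alternating_eq_contract[OF g c alt contraction_alternating[OF g c] _ l])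
    fix r I assume l: "([origin g h, origin g k] @ r, I) \<in> labellings g" and I: "{h, bar g k} \<subseteq> I"
    let ?l = "([origin g' (\<psi> h), origin g' (\<psi> k)] @ map \<phi> r, \<psi> ` I)"
    have rel: "relabel \<phi> \<psi> ([origin g h, origin g k] @ r, I) = ?l"
      using graph_isoD(3)[OF i] hk by simp
    then have l': "?l \<in> labellings g'" using relabel_mem[OF g i l] by simp
    have I': "{\<psi> h, bar g' (\<psi> k)} \<subseteq> \<psi> ` I" using I graph_isoD(4)[OF i hk(2)] by auto
    have "I \<subseteq> halves g" "inj_on \<psi> (halves g)"
      using i l by (auto simp: graph_iso_def bij_betw_def mem_labellings)
    then have "\<psi> ` (I - {h, k}) = \<psi> ` I - \<psi> ` {h, k}"
      using hk by (intro inj_on_image_set_diff) auto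
    then have "\<psi> ` I - {\<psi> h, \<psi> k} = \<psi> ` (I - {h, k})" by simp
    then have "(origin g' (\<psi> h) # map \<phi> r, \<psi> ` I - {\<psi> h, \<psi> k}) = relabel \<phi> \<psi> (origin g h # r, I - {h, k})"
      using graph_isoD(3)[OF i] hk by simp
    then have "contraction g' (\<psi> h) (\<psi> k) ?l = (contraction g h k ([origin g h, origin g k] @ r, I) :: 'k graph_space)"
      unfolding contraction_def contract_lift_standard(1)[OF g' c' l' I'] contract_lift_standard(1)[OF g c l I]
      using gcls_relabel[OF is_graph_contract[OF g c] contract_graph_iso[OF g i c] contract_labellings[OF g c l I]]
      by simp
    then show "contraction g' (\<psi> h) (\<psi> k) (relabel \<phi> \<psi> ([origin g h, origin g k] @ r, I)) =
        (contraction g h k ([origin g h, origin g k] @ r, I) :: 'k graph_space)"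
      unfolding rel .
  qed
qed

lemma graph_cong:
  assumes g: "is_graph g" and eq: "verts g' = verts g" "halves g' = halves g"
    "\<And>h. h \<in> halves g \<Longrightarrow> origin g' h = origin g h" "\<And>h. h \<in> halves g \<Longrightarrow> bar g' h = bar g h"
  shows "is_graph g'" "labellings g' = labellings g"
proof -
  have "graph_iso id id g g'" using eq by (auto simp: graph_iso_def)
  then show "is_graph g'" by (rule is_graph_iso[OF g])
  show "labellings g' = labellings g"
    unfolding labellings_def eq(1,2) using eq(4) by auto
qed

lemma contractible_commute:
  assumes g: "is_graph g" and c: "contractible g h k"
  shows "contractible g k h"
  using contractible_distinct[OF assms] c by (auto simp: contractible_def)

lemma contraction_commute:
  assumes g: "is_graph g" and c: "contractible g h k" and l: "l \<in> labellings g"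
  shows "contraction g h k l = (contraction g k h l :: 'k::field_char_0 graph_space)"
proof (rule alternating_eq_contract[OF g c contraction_alternating[OF g c]
      contraction_alternating[OF g contractible_commute[OF g c]] _ l])
  fix r I assume l: "([origin g h, origin g k] @ r, I) \<in> labellings g" and I: "{h, bar g k} \<subseteq> I"
  note c' = contractible_commute[OF g c] and I' = contract_lift_standard(2-)[OF g c l I]
  note hk = contractibleD[OF c]
  note d = contractible_distinct[OF g c]
  let ?G = "contraction g k h :: _ \<Rightarrow> 'k graph_space" and ?a = "origin g h" and ?b = "origin g k"
  let ?vs = "[?b, ?a] @ r" and ?C = "contract_graph g k h"
  let ?I1 = "insert (bar g h) (I - {h})"
  let ?I2 = "insert (bar g (bar g k)) (?I1 - {bar g k})"
  note alt = contraction_alternating[OF g c', where 'k = 'k]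
  have l0: "(?vs, I) \<in> labellings g" by (rule labellings_mset[OF l]) simp
  have l1: "(?vs, ?I1) \<in> labellings g" by (rule labellings_flip[OF g l0 I'(1)])
  have k1: "bar g k \<in> ?I1" using I' d by simp
  have l2: "(?vs, ?I2) \<in> labellings g" by (rule labellings_flip[OF g l1 k1])
  have k: "bar g (bar g k) = k" using is_graphD(6)[OF g hk(2)] .
  have I2: "{k, bar g h} \<subseteq> ?I2" using k d by simp
  have "?G ([?a, ?b] @ r, I) = - ?G (?vs, I)"
    using alternating_swap[OF alt, of "[]" ?b "[]" ?a r I] l0 by simp
  also have "?G (?vs, I) = ?G (?vs, ?I2)"
    using alternating_flip[OF alt l0 I'(1)] alternating_flip[OF alt l1 k1] by simp
  also have "\<dots> = gcls ?C (?b # r, ?I2 - {k, h})"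
    unfolding contraction_def by (rule contract_lift_standard(1)[OF g c' l2 I2])
  also have "\<dots> = - gcls ?C (?b # r, insert (bar ?C (bar g h)) (?I2 - {k, h} - {bar g h}))"
  proof -
    have "bar g h \<in> ?I2 - {k, h}" using d by simp
    from alternating_flip[OF gcls_alternating[OF is_graph_contract[OF g c'], where 'k = 'k]
        contract_labellings[OF g c' l2 I2] this]
    show ?thesis by simp
  qed
  also have "insert (bar ?C (bar g h)) (?I2 - {k, h} - {bar g h}) = I - {h, k}"
    unfolding contract_graph_simps[OF g c'] bar_reglue_graph(4)[OF g c'] using d I' k by auto
  also have "gcls ?C (?b # r, I - {h, k}) = (gcls (contract_graph g h k) (?a # r, I - {h, k}) :: 'k graph_space)"
  proof -
    let ?\<phi> = "\<lambda>v. if v = ?a then ?b else v"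
    have "graph_iso ?\<phi> (\<lambda>j. j) (contract_graph g h k) ?C"
      unfolding graph_iso_def contract_graph_simps[OF g c] contract_graph_simps[OF g c']
    proof (intro conjI ballI)
      show "bij_betw ?\<phi> (verts g - {?b}) (verts g - {?a})"
        using hk is_graphD(3)[OF g] by (intro bij_betw_byWitness[where f' = "\<lambda>v. if v = ?b then ?a else v"]) auto
      show "bij_betw (\<lambda>j. j) (halves g - {h, k}) (halves g - {k, h})"
        by (simp add: bij_betw_def insert_commute)
      fix j
      show "bar (reglue_graph g k h) j = bar (reglue_graph g h k) j"
        using d by (auto simp: reglue_graph_def)
    qed auto
    from gcls_relabel[OF is_graph_contract[OF g c] this contract_labellings[OF g c l I], where 'k = 'k]
    have "(gcls (contract_graph g h k) (?a # r, I - {h, k}) :: 'k graph_space) =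
        gcls ?C (?b # map ?\<phi> r, I - {h, k})" by simp
    moreover have "map ?\<phi> r = r" using l by (intro map_idI) (auto simp: mem_labellings)
    ultimately show ?thesis by simp
  qed
  finally show "contraction g h k ([?a, ?b] @ r, I) = ?G ([?a, ?b] @ r, I)"
    unfolding contraction_def contract_lift_standard(1)[OF g c l I] by simp
qed

lemma spare_half_edge:
  assumes g: "is_graph g" and c: "contractible g h k"
  shows "\<exists>j\<in>halves g. j \<notin> {h, k, bar g h, bar g k}"
proof (rule ccontr)
  assume "\<not> ?thesis"
  then have sub: "halves g \<subseteq> {h, k, bar g h, bar g k}" by blast
  note hk = contractibleD[OF c]
  let ?A = "\<lambda>v. {j \<in> halves g. origin g j = v}"
  have "card (?A (origin g h) \<union> ?A (origin g k)) = card (?A (origin g h)) + card (?A (origin g k))"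
    by (rule card_Un_disjoint) (use is_graphD(2)[OF g] hk in auto)
  moreover have "3 \<le> card (?A (origin g h))" "3 \<le> card (?A (origin g k))"
    using is_graphD(7)[OF g] is_graphD(3)[OF g] hk by auto
  moreover have "card (?A (origin g h) \<union> ?A (origin g k)) \<le> card {h, k, bar g h, bar g k}"
    by (rule card_mono) (use sub in auto)
  moreover have "card {h, k, bar g h, bar g k} \<le> 4" by (simp add: card_insert_if)
  ultimately show False by linarith
qed

lemma reglue_eq:
  assumes c: "contractible (graph_of X) h k"
  obtains l where "l \<in> or_of X" "h \<in> snd l" "k \<notin> snd l"
    "reglue X h k = oriented (reglue_graph (graph_of X) h k) l"
proof -
  let ?g = "graph_of X"
  note g = is_graph_graph_of[of X]
  define l where "l = (SOME l. l \<in> or_of X \<and> h \<in> snd l \<and> k \<notin> snd l)"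
  note hk = contractibleD[OF c]
  obtain l0 where l0: "l0 \<in> labellings ?g" "or_of X = orientation_class ?g l0" using ograph_cases by metis
  obtain j where j: "j \<in> halves ?g" "j \<notin> {h, k, bar ?g h, bar ?g k}" using spare_half_edge[OF g c] by blast
  have "\<exists>r J. ([] @ r, J) \<in> orientation_class ?g l0 \<and> {h, bar ?g k} \<subseteq> J"
  proof (rule class_standard[OF g l0(1)])
    show "{h, bar ?g k} \<subseteq> halves ?g" "\<And>i. i \<in> {h, bar ?g k} \<Longrightarrow> bar ?g i \<notin> {h, bar ?g k}"
      by (rule contract_standard[OF g c])+
    show "j \<in> halves ?g" "j \<notin> {h, bar ?g k}" "bar ?g j \<notin> {h, bar ?g k}"
      using j bar_notin[OF g c j] by auto
  qed auto
  then obtain r J where rJ: "(r, J) \<in> or_of X" "h \<in> J" "bar ?g k \<in> J" using l0(2) by auto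
  moreover have "k \<notin> J" using or_of_subset[OF rJ(1)] rJ(3) hk by (simp add: mem_labellings)
  ultimately have "\<exists>l. l \<in> or_of X \<and> h \<in> snd l \<and> k \<notin> snd l" by (intro exI[of _ "(r, J)"]) simp
  from someI_ex[OF this] have "l \<in> or_of X" "h \<in> snd l" "k \<notin> snd l" unfolding l_def by blast+
  moreover have "reglue X h k = oriented (reglue_graph ?g h k) l"
    by (simp add: reglue_def reglue_graph_def l_def Let_def)
  ultimately show thesis by (rule that)
qed

lemma collapse_lift_standard:
  assumes "origin g h \<noteq> origin g (bar g h)"
  shows "h \<in> I \<Longrightarrow> collapse_lift g h F ([origin g h, origin g (bar g h)] @ r, I) = F (origin g h # r, I - {h, bar g h})"
    and "h \<notin> I \<Longrightarrow> collapse_lift g h F ([origin g (bar g h), origin g h] @ r, I) = F (origin g h # r, I - {h, bar g h})"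
  using assms by (simp_all add: collapse_lift_def extract_vertex_def)

lemma X_hk_eq:
  assumes c: "contractible (graph_of X) h k" and l: "l \<in> or_of X"
  shows "X_hk X h k = (contraction (graph_of X) h k l :: 'k::field_char_0 graph_space)"
proof -
  let ?g = "graph_of X"
  let ?g1 = "reglue_graph ?g h k" and ?a = "origin ?g h" and ?b = "origin ?g k"
  note g = is_graph_graph_of[of X]
  note hk = contractibleD[OF c]
  note d = contractible_distinct[OF g c] and b1 = bar_reglue_graph[OF g c]
  obtain l1 where l1: "l1 \<in> or_of X" "h \<in> snd l1" "k \<notin> snd l1" "reglue X h k = oriented ?g1 l1"
    by (rule reglue_eq[OF c])
  obtain vs1 I1 where vI1: "l1 = (vs1, I1)" by fastforce
  have lab1: "l1 \<in> labellings ?g" using l1 or_of_subset by blast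
  have "bar ?g h \<notin> I1" "bar ?g k \<in> I1" using lab1 l1(2,3) hk by (auto simp: vI1 mem_labellings)
  then have N: "insert h (insert (bar ?g k) (I1 - {bar ?g h, k})) = I1" using l1(2,3) vI1 by auto
  have g1: "is_graph ?g1" by (rule is_graph_reglue[OF g c])
  have lab: "l1 \<in> labellings ?g1"
    using reglue_labellings[OF g c] lab1 N unfolding vI1 by metis
  note G = graph_of_oriented[OF g1 lab]
  define P where "P l \<longleftrightarrow> l \<in> orientation_class ?g1 l1 \<and>
    (\<exists>i\<in>{h, bar ?g1 h}. i \<in> snd l \<and> take 2 (fst l) = [origin ?g1 i, origin ?g1 (bar ?g1 i)])" for l
  define l2 where "l2 = (SOME l. P l)"
  have "\<exists>r J. ([?a, ?b] @ r, J) \<in> orientation_class ?g1 l1 \<and> {h} \<subseteq> J"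
  proof (rule class_standard[OF g1 lab])
    show "bar ?g h \<in> halves ?g1" "bar ?g h \<notin> {h}" "bar ?g1 (bar ?g h) \<notin> {h}"
      using hk d b1 is_graphD(4)[OF g hk(1)] by auto
    show "bar ?g1 i \<notin> {h}" if "i \<in> {h}" for i using that b1 d by auto
  qed (use hk is_graphD(3)[OF g] in auto)
  then obtain r0 J0 where "([?a, ?b] @ r0, J0) \<in> orientation_class ?g1 l1" "h \<in> J0" by blast
  then have "P ([?a, ?b] @ r0, J0)"
    unfolding P_def using b1(1) by (intro conjI bexI[of _ h]) auto
  then have P: "P l2" unfolding l2_def by (rule someI)
  obtain vs I where vI: "l2 = (vs, I)" by fastforce
  have l2: "l2 \<in> orientation_class ?g1 l1" using P by (simp add: P_def)
  obtain n where "(l1, l2) \<in> moves ?g1 ^^ n" using l2 unfolding orientation_class_def by blast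
  then have lab2: "l2 \<in> labellings ?g1" using labellings_relpow[OF g1 lab] by blast
  have "X_hk X h k = cls (collapse (oriented ?g1 l1) h)"
    using hk by (simp add: X_hk_def l1)
  also have "collapse (oriented ?g1 l1) h =
      oriented (contract_graph ?g h k) (?a # drop 2 vs, I - {h, bar ?g1 h})"
    unfolding collapse_def G Let_def P_def[symmetric] l2_def[symmetric] vI
    by (simp add: contract_graph_def collapse_graph_def)
  also have "cls \<dots> = (gcls (contract_graph ?g h k) (?a # drop 2 vs, I - {h, bar ?g1 h}) :: 'k graph_space)"
    by (simp add: gcls_def)
  also have "\<dots> = collapse_lift ?g1 h (gcls (contract_graph ?g h k)) l2"
  proof -
    from P consider "h \<in> I" "take 2 vs = [?a, ?b]" | "k \<in> I" "take 2 vs = [?b, ?a]"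
      unfolding P_def vI by (auto simp: b1)
    then show ?thesis
    proof cases
      case 1
      then obtain r where "vs = [?a, ?b] @ r" by (metis append_take_drop_id)
      then show ?thesis
        using collapse_lift_standard(1)[of ?g1 h I "gcls (contract_graph ?g h k) :: _ \<Rightarrow> 'k graph_space" r] hk(3) 1(1) by (simp add: b1 vI)
    next
      case 2
      then obtain r where vs: "vs = [?b, ?a] @ r" by (metis append_take_drop_id)
      have "bar ?g1 k = h" "k \<in> halves ?g1" using b1 hk by auto
      then have "h \<notin> I" using 2(1) lab2 unfolding vI mem_labellings by metis
      then show ?thesis
        using collapse_lift_standard(2)[of ?g1 h I "gcls (contract_graph ?g h k) :: _ \<Rightarrow> 'k graph_space" r] hk(3) vs by (simp add: b1 vI)
    qed
  qed
  also have "\<dots> = collapse_lift ?g1 h (gcls (contract_graph ?g h k)) l1"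
  proof (rule alternating_class[OF g1 _ lab l2], rule collapse_lift_alternating[OF g1])
    show "alternating (collapse_graph ?g1 h) (gcls (contract_graph ?g h k))"
      using gcls_alternating[OF is_graph_contract[OF g c]] by (simp add: contract_graph_def)
  qed (use hk b1 in auto)
  also have "\<dots> = contraction ?g h k l1"
    using l1(2,3) N by (simp add: contraction_def contract_lift_def reglue_lift_def vI1)
  also have "\<dots> = contraction ?g h k l"
    by (rule alternating_or_of[OF contraction_alternating[OF g c] l1(1) l])
  finally show ?thesis .
qed

lemma contractible_gunion:
  assumes "disjoint_graphs g g'"
  shows "contractible g h k \<Longrightarrow> contractible (gunion g g') h k"
    and "contractible g' h k \<Longrightarrow> contractible (gunion g g') h k"
    and "is_graph g \<Longrightarrow> is_graph g' \<Longrightarrow> h \<in> halves g \<Longrightarrow> k \<in> halves g' \<Longrightarrow> contractible (gunion g g') h k"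
proof -
  show "contractible g h k \<Longrightarrow> contractible (gunion g g') h k"
    "contractible g' h k \<Longrightarrow> contractible (gunion g g') h k"
    using assms by (auto simp: contractible_def disjoint_graphs_def)
  assume g: "is_graph g" "is_graph g'" and h: "h \<in> halves g" and k: "k \<in> halves g'"
  have "bar g h \<in> halves g" "origin g h \<in> verts g" "origin g' k \<in> verts g'"
    using is_graphD(3,4)[OF g(1) h] is_graphD(3)[OF g(2) k] by auto
  then show "contractible (gunion g g') h k"
    using h k assms unfolding contractible_def disjoint_graphs_def by auto
qed

definition transplant :: "graph \<Rightarrow> graph \<Rightarrow> graph" where
  "transplant g c = g\<lparr>origin := origin c, bar := bar c\<rparr>"

text \<open>A contraction in \<open>g'\<close> changes \<open>origin\<close> and \<open>bar\<close> only on half-edges outside of \<open>g\<close>.\<close>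

lemma contract_gunion:
  assumes g: "is_graph g" and g': "is_graph g'" and d: "disjoint_graphs g g'" and c: "contractible g' p q"
  defines "k \<equiv> transplant g (contract_graph g' p q)"
  shows "is_graph k" "labellings k = labellings g" "verts k = verts g" "halves k = halves g"
    and "l \<in> labellings g \<Longrightarrow> gcls k l = (gcls g l :: 'k::field_char_0 graph_space)"
    and "disjoint_graphs k (contract_graph g' p q)"
    and "gunion k (contract_graph g' p q) = contract_graph (gunion g g') p q"
    and "gunion (contract_graph g' p q) k = contract_graph (gunion g' g) p q"
proof -
  let ?C = "contract_graph g' p q"
  note C = contract_graph_simps[OF g' c]
  note d' = d[unfolded disjoint_graphs_def]
  note pq = contractibleD(1,2)[OF c]
  have h: "origin k h = origin g h" "bar k h = bar g h" if h: "h \<in> halves g" for h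
  proof -
    have "origin g h \<in> verts g" "origin g' q \<in> verts g'"
      using is_graphD(3)[OF g h] is_graphD(3)[OF g' pq(2)] .
    then show "origin k h = origin g h" using d' by (auto simp: k_def transplant_def C)
    have "h \<notin> {p, q, bar g' p, bar g' q}"
      using h d' pq is_graphD(4)[OF g' pq(1)] is_graphD(4)[OF g' pq(2)] by auto
    then show "bar k h = bar g h" using bar_reglue_graph(5)[OF g' c] d' by (simp add: k_def transplant_def C)
  qed
  have v: "verts k = verts g" "halves k = halves g" by (simp_all add: k_def transplant_def)
  note cong = graph_cong[OF g v h]
  have qv: "origin g' q \<in> verts g'" using is_graphD(3)[OF g' pq(2)] .
  have c': "contractible (gunion g g') p q" "contractible (gunion g' g) p q"
    using contractible_gunion(2)[OF d c] contractible_gunion(1)[OF disjoint_graphs_sym[OF d] c] .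
  have G: "is_graph (gunion g g')" "is_graph (gunion g' g)"
    using is_graph_gunion[OF g g' d] is_graph_gunion[OF g' g disjoint_graphs_sym[OF d]] .
  have un: "gunion k ?C = contract_graph (gunion g g') p q"
    using d' qv pq
    by (intro graph.equality)
      (auto simp: contract_graph_simps[OF G(1) c'(1)] C k_def transplant_def reglue_graph_def)
  have dk: "disjoint_graphs k ?C"
    unfolding disjoint_graphs_def C(1,2) v using d' by (auto simp: k_def transplant_def)
  show "is_graph k" using cong(1) by simp
  show "labellings k = labellings g" using cong(2) by simp
  show "verts k = verts g" "halves k = halves g" by (rule v)+
  show "gcls k l = (gcls g l :: 'k graph_space)" if "l \<in> labellings g" by (rule gcls_cong[OF g v h that])
  show "disjoint_graphs k ?C" by (rule dk)
  show "gunion k ?C = contract_graph (gunion g g') p q" by (rule un)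
  show "gunion ?C k = contract_graph (gunion g' g) p q"
    using gunion_commute[OF dk] gunion_commute[OF d] un by simp
qed

lemma contract_lift_ljoin:
  assumes g: "is_graph g" and g': "is_graph g'" and d: "disjoint_graphs g g'" and c: "contractible g' p q"
    and F: "alternating (contract_graph (gunion g g') p q) (F :: labelling \<Rightarrow> 'k::field_char_0 graph_space)"
    and l: "(vs, J) \<in> labellings g" and l': "([origin g' p, origin g' q] @ r, I) \<in> labellings g'"
    and I: "{p, bar g' q} \<subseteq> I"
  shows "contract_lift (gunion g g') p q F (ljoin (vs, J) ([origin g' p, origin g' q] @ r, I)) =
      (-1) ^ length vs *\<^sub>G F (ljoin (vs, J) (origin g' p # r, I - {p, q}))"
    and "contract_lift (gunion g g') p q F (ljoin ([origin g' p, origin g' q] @ r, I) (vs, J)) =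
      F (ljoin (origin g' p # r, I - {p, q}) (vs, J))"
proof -
  let ?W = "gunion g g'" and ?a = "origin g' p" and ?b = "origin g' q"
  note W = is_graph_gunion[OF g g' d] and c' = contractible_gunion(2)[OF d c]
  note alt = contract_lift_alternating[OF W c' F]
  have e: "origin ?W = origin g'" "bar ?W = bar g'" using d by (simp_all add: disjoint_graphs_def)
  have lj: "(vs @ [?a, ?b] @ r, J \<union> I) \<in> labellings ?W"
    using ljoin_labellings[OF g g' d l l'] by simp
  have pq: "p \<notin> J" "q \<notin> J" using l c d by (auto simp: mem_labellings contractible_def disjoint_graphs_def)
  have I': "{p, bar ?W q} \<subseteq> J \<union> I" using I e by auto
  have Jpq: "(J \<union> I) - {p, q} = J \<union> (I - {p, q})" using pq by auto
  have l2: "([origin ?W p, origin ?W q] @ (vs @ r), J \<union> I) \<in> labellings ?W"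
    unfolding e by (rule labellings_mset[OF lj]) simp
  have "contract_lift ?W p q F (vs @ [?a, ?b] @ r, J \<union> I) =
      contract_lift ?W p q F ([?a, ?b] @ vs @ r, J \<union> I)"
    using alternating_block_swap[OF alt lj] by (simp add: power_mult)
  also have "\<dots> = F (?a # vs @ r, J \<union> (I - {p, q}))"
    using contract_lift_standard(1)[OF W c' l2 I', of F] unfolding e Jpq .
  also have "\<dots> = (-1) ^ length vs *\<^sub>G F (vs @ ?a # r, J \<union> (I - {p, q}))"
  proof -
    have "(?a # vs @ r, J \<union> (I - {p, q})) \<in> labellings (contract_graph ?W p q)"
      using contract_labellings[OF W c' l2 I'] unfolding e Jpq .
    then show ?thesis using alternating_block_swap[OF F, of "[?a]" vs r] by simp
  qed
  finally show "contract_lift ?W p q F (ljoin (vs, J) ([?a, ?b] @ r, I)) =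
      (-1) ^ length vs *\<^sub>G F (ljoin (vs, J) (?a # r, I - {p, q}))"
    by simp
  have l3: "([origin ?W p, origin ?W q] @ (r @ vs), J \<union> I) \<in> labellings ?W"
    unfolding e by (rule labellings_mset[OF lj]) simp
  show "contract_lift ?W p q F (ljoin ([?a, ?b] @ r, I) (vs, J)) =
      F (ljoin (?a # r, I - {p, q}) (vs, J))"
    using contract_lift_standard(1)[OF W c' l3 I', of F] unfolding e Jpq by (simp add: Un_commute)
qed

lemma bilinear_gprod: "bilinear_map gscale (gprod :: 'k::field_char_0 graph_space \<Rightarrow> _)"
  by (rule bilinear_extension_gprod[unfolded bilinear_extension_def, THEN conjunct1])

lemmas gprod_linear = bilinear_mapD[OF bilinear_gprod]

lemma alternating_linear:
  assumes "glinear T" "alternating g F"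
  shows "alternating g (\<lambda>l. T (F l))"
  using assms glinearD(4)[OF assms(1)] unfolding alternating_def by simp

lemma alternating_sum:
  "(\<And>i. i \<in> A \<Longrightarrow> alternating g (F i)) \<Longrightarrow> alternating g (\<lambda>l. \<Sum>i\<in>A. F i l)"
  unfolding alternating_def by (simp add: sum_negf)

lemma gprod_contraction:
  assumes g: "is_graph g" and g': "is_graph g'" and d: "disjoint_graphs g g'" and c: "contractible g' p q"
    and l: "l \<in> labellings g" and l': "l' \<in> labellings g'"
  shows "gprod (gcls g l) (contraction g' p q l') =
      (-1) ^ card (verts g) *\<^sub>G (contraction (gunion g g') p q (ljoin l l') :: 'k::field_char_0 graph_space)"
    and "gprod (contraction g' p q l') (gcls g l) =
      (contraction (gunion g' g) p q (ljoin l' l) :: 'k::field_char_0 graph_space)"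
proof -
  let ?W = "gunion g g'" and ?C = "contract_graph g' p q"
  note W = is_graph_gunion[OF g g' d] and cW = contractible_gunion(2)[OF d c]
  note d' = disjoint_graphs_sym[OF d]
  note alt = contraction_alternating[OF W cW, where 'k = 'k]
  have comm: "gunion g' g = ?W" by (rule gunion_commute[OF d])
  obtain vs J where vJ: "l = (vs, J)" by fastforce
  define k where "k = transplant g (contract_graph g' p q)"
  note k = contract_gunion[OF g g' d c, folded k_def]
  have len: "length vs = card (verts g)"
    using l distinct_card[of vs] by (simp add: vJ mem_labellings)
  note S = contract_lift_ljoin[OF g g' d c gcls_alternating[OF is_graph_contract[OF W cW]] l[unfolded vJ],
      where 'k = 'k]
  show "gprod (gcls g l) (contraction g' p q l') =
      (-1) ^ card (verts g) *\<^sub>G (contraction ?W p q (ljoin l l') :: 'k graph_space)"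
  proof (rule alternating_eq_contract[OF g' c _ _ _ l'])
    show "alternating g' (\<lambda>l'. gprod (gcls g l) (contraction g' p q l' :: 'k graph_space))"
      by (rule alternating_linear[OF gprod_linear(1) contraction_alternating[OF g' c]])
    show "alternating g' (\<lambda>l'. (-1) ^ card (verts g) *\<^sub>G (contraction ?W p q (ljoin l l') :: 'k graph_space))"
      using alternating_ljoin_right[OF g g' d l alt]
      by (intro alternating_linear[where T = "gscale _"]) (auto simp: glinear_iff G.scale_right_distrib ac_simps)
    fix r I assume l': "([origin g' p, origin g' q] @ r, I) \<in> labellings g'" and I: "{p, bar g' q} \<subseteq> I"
    note lC = contract_labellings[OF g' c l' I]
    show "gprod (gcls g l) (contraction g' p q ([origin g' p, origin g' q] @ r, I)) =
      (-1) ^ card (verts g) *\<^sub>G (contraction ?W p q (ljoin l ([origin g' p, origin g' q] @ r, I)) :: 'k graph_space)"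
      unfolding contraction_def contract_lift_standard(1)[OF g' c l' I] vJ S(1)[OF l' I] k(5)[OF l, symmetric, unfolded vJ]
      using gprod_gcls[OF k(1) _ is_graph_contract[OF g' c] lC k(6), of l, where 'k = 'k] l
      by (simp add: k(2,7) vJ len powneg1_mult del: G.scale_scale ljoin_Pair)
  qed
  show "gprod (contraction g' p q l') (gcls g l) = (contraction (gunion g' g) p q (ljoin l' l) :: 'k graph_space)"
    unfolding comm
  proof (rule alternating_eq_contract[OF g' c _ _ _ l'])
    show "alternating g' (\<lambda>l'. gprod (contraction g' p q l' :: 'k graph_space) (gcls g l))"
      by (rule alternating_linear[OF gprod_linear(2) contraction_alternating[OF g' c]])
    show "alternating g' (\<lambda>l'. contraction ?W p q (ljoin l' l) :: 'k graph_space)"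
      using alternating_ljoin_left[OF g' g d' l] alt comm by simp
    fix r I assume l': "([origin g' p, origin g' q] @ r, I) \<in> labellings g'" and I: "{p, bar g' q} \<subseteq> I"
    note lC = contract_labellings[OF g' c l' I]
    show "gprod (contraction g' p q ([origin g' p, origin g' q] @ r, I)) (gcls g l) =
      (contraction ?W p q (ljoin ([origin g' p, origin g' q] @ r, I) l) :: 'k graph_space)"
      unfolding contraction_def contract_lift_standard(1)[OF g' c l' I] vJ S(2)[OF l' I] k(5)[OF l, symmetric, unfolded vJ]
      using gprod_gcls[OF is_graph_contract[OF g' c] lC k(1) _ disjoint_graphs_sym[OF k(6)], of l, where 'k = 'k] l
      by (simp add: k(2,8) comm vJ del: ljoin_Pair)
  qed
qed

section \<open>The bracket\<close>

definition contraction_sum :: "graph \<Rightarrow> nat set \<Rightarrow> nat set \<Rightarrow> labelling \<Rightarrow> 'k::field_char_0 graph_space" where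
  "contraction_sum g H H' l = (\<Sum>h\<in>H. \<Sum>k\<in>H'. contraction g h k l)"

lemma union_invariant_contraction_sum:
  "union_invariant (contraction_sum :: _ \<Rightarrow> _ \<Rightarrow> _ \<Rightarrow> _ \<Rightarrow> 'k::field_char_0 graph_space)"
  unfolding union_invariant_def
proof (intro conjI allI impI)
  fix k k' assume k: "is_graph k" "is_graph k'" "disjoint_graphs k k'"
  show "alternating (gunion k k') (contraction_sum (gunion k k') (halves k) (halves k') :: _ \<Rightarrow> 'k graph_space)"
    unfolding contraction_sum_def[abs_def]
    by (intro alternating_sum contraction_alternating is_graph_gunion contractible_gunion(3) k)
next
  fix \<phi> \<psi> g g' k k' l
  assume g: "is_graph g" "is_graph g'" "disjoint_graphs g g'" and i: "graph_iso \<phi> \<psi> (gunion g g') (gunion k k')"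
    and h: "halves k = \<psi> ` halves g" "halves k' = \<psi> ` halves g'" and l: "l \<in> labellings (gunion g g')"
  have "inj_on \<psi> (halves g \<union> halves g')" using i by (simp add: graph_iso_def bij_betw_def)
  then have "inj_on \<psi> (halves g)" "inj_on \<psi> (halves g')" by (auto intro: inj_on_subset)
  then show "contraction_sum (gunion k k') (halves k) (halves k') (relabel \<phi> \<psi> l) =
      (contraction_sum (gunion g g') (halves g) (halves g') l :: 'k graph_space)"
    unfolding contraction_sum_def h
    using contraction_relabel[OF is_graph_gunion[OF g] i contractible_gunion(3)[OF g(3,1,2)] l]
    by (auto simp: sum.reindex intro!: sum.cong)
qed

definition half_edge_pairs :: "graph \<Rightarrow> (nat \<times> nat) set" where
  "half_edge_pairs g = {(h, k). h \<in> halves g \<and> k \<in> halves g \<and> h < k \<and> k \<noteq> bar g h}"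

lemma boundary_H_prod:
  assumes l: "l \<in> or_of (X \<odot> Y)"
    and W: "graph_of (X \<odot> Y) = disjoint_union (graph_of X) (graph_of Y)"
  shows "(boundary_H (X \<odot> Y) :: 'k::field_char_0 graph_space) =
    (\<Sum>(h, k) \<in> half_edge_pairs (graph_of X).
       X_hk (X \<odot> Y) (2 * h) (2 * k)) +
    (\<Sum>(h, k) \<in> half_edge_pairs (graph_of Y).
       X_hk (X \<odot> Y) (2 * h + 1) (2 * k + 1)) +
    contraction_sum (disjoint_union (graph_of X) (graph_of Y))
      ((\<lambda>h. 2 * h) ` halves (graph_of X)) ((\<lambda>h. 2 * h + 1) ` halves (graph_of Y)) l"
proof -
  let ?g = "graph_of X" and ?g' = "graph_of Y" and ?Z = "X \<odot> Y"
  let ?W = "disjoint_union ?g ?g'"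
  let ?f = "\<lambda>(h, k). X_hk ?Z h k :: 'k graph_space"
  define M where "M = {(h, k) \<in> half_edge_pairs ?W. even h \<noteq> even k}"
  have fin: "finite (half_edge_pairs g)" if "is_graph g" for g
    by (rule finite_subset[of _ "halves g \<times> halves g"]) (use is_graphD(2)[OF that] in \<open>auto simp: half_edge_pairs_def\<close>)
  have Wg: "is_graph ?W" by (simp add: is_graph_disjoint_union)
  have finM: "finite M" by (rule finite_subset[OF _ fin[OF Wg]]) (auto simp: M_def)
  have S: "half_edge_pairs ?W = map_prod (\<lambda>h. 2 * h) (\<lambda>h. 2 * h) ` half_edge_pairs ?g \<union>
      map_prod (\<lambda>h. 2 * h + 1) (\<lambda>h. 2 * h + 1) ` half_edge_pairs ?g' \<union> M" (is "_ = ?A \<union> ?B \<union> _")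
  proof (intro equalityI subsetI)
    fix x assume x: "x \<in> half_edge_pairs ?W"
    obtain h k where hk: "x = (h, k)" by fastforce
    show "x \<in> ?A \<union> ?B \<union> M"
    proof (cases "even h = even k")
      case False
      then show ?thesis using x by (simp add: M_def hk)
    next
      case True
      show ?thesis
      proof (cases "even h")
        case True
        then obtain h' k' where e: "h = 2 * h'" "k = 2 * k'" using \<open>even h = even k\<close> by (auto elim!: evenE)
        have "h' \<in> halves ?g" "k' \<in> halves ?g" using x by (auto simp: hk e half_edge_pairs_def disjoint_union_def) presburger+
        then have "(h', k') \<in> half_edge_pairs ?g" using x by (auto simp: hk e half_edge_pairs_def disjoint_union_def)
        then show ?thesis by (auto simp: hk e intro!: image_eqI[of _ _ "(h', k')"])
      next
        case False
        then obtain h' k' where e: "h = 2 * h' + 1" "k = 2 * k' + 1" using \<open>even h = even k\<close> by (auto elim!: oddE)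
        have "h' \<in> halves ?g'" "k' \<in> halves ?g'" using x by (auto simp: hk e half_edge_pairs_def disjoint_union_def) presburger+
        then have "(h', k') \<in> half_edge_pairs ?g'" using x by (auto simp: hk e half_edge_pairs_def disjoint_union_def)
        then show ?thesis by (auto simp: hk e intro!: image_eqI[of _ _ "(h', k')"])
      qed
    qed
  qed (auto simp: half_edge_pairs_def M_def disjoint_union_def)
  have "boundary_H ?Z = sum ?f (half_edge_pairs ?W)"
    by (simp add: boundary_H_def W half_edge_pairs_def)
  also have "\<dots> = sum ?f (?A \<union> ?B) + sum ?f M"
    unfolding S by (rule sum.union_disjoint) (use fin finM in \<open>auto simp: M_def\<close>)
  also have "sum ?f (?A \<union> ?B) = sum ?f ?A + sum ?f ?B"
    by (rule sum.union_disjoint) (use fin in \<open>auto, presburger\<close>)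
  also have "sum ?f ?A = (\<Sum>(h, k) \<in> half_edge_pairs ?g. X_hk ?Z (2 * h) (2 * k))"
    by (subst sum.reindex) (auto simp: inj_on_def intro!: sum.cong)
  also have "sum ?f ?B = (\<Sum>(h, k) \<in> half_edge_pairs ?g'. X_hk ?Z (2 * h + 1) (2 * k + 1))"
    by (subst sum.reindex) (auto simp: inj_on_def intro!: sum.cong)
  also have "sum ?f M = (\<Sum>(h, k) \<in> ((\<lambda>h. 2 * h) ` halves ?g) \<times> ((\<lambda>h. 2 * h + 1) ` halves ?g'). contraction ?W h k l)"
  proof (rule sum.reindex_bij_witness[where i = "\<lambda>(h, k). if h < k then (h, k) else (k, h)"
        and j = "\<lambda>(h, k). if even h then (h, k) else (k, h)"])
    fix x assume x: "x \<in> M"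
    obtain h k where hk: "x = (h, k)" by fastforce
    have hkW: "h \<in> halves ?W" "k \<in> halves ?W" "h < k" "k \<noteq> bar ?W h" "even h \<noteq> even k"
      using x by (auto simp: M_def half_edge_pairs_def hk)
    show "(case case x of (h, k) \<Rightarrow> if even h then (h, k) else (k, h) of (h, k) \<Rightarrow> if h < k then (h, k) else (k, h)) = x"
      using hkW by (simp add: hk)
    show "(case x of (h, k) \<Rightarrow> if even h then (h, k) else (k, h)) \<in> ((\<lambda>h. 2 * h) ` halves ?g) \<times> ((\<lambda>h. 2 * h + 1) ` halves ?g')"
      using hkW by (auto simp: hk disjoint_union_def)
    have "even (origin ?W j) = even j" for j by (simp add: disjoint_union_def)
    then have "origin ?W h \<noteq> origin ?W k" using hkW(5) by metis
    then have c: "contractible ?W h k" using hkW by (simp add: contractible_def)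
    have "X_hk ?Z h k = (contraction ?W h k l :: 'k graph_space)"
      using X_hk_eq[of ?Z h k l] c l by (simp add: W)
    moreover have "contraction ?W k h l = (contraction ?W h k l :: 'k graph_space)"
      by (rule contraction_commute[OF Wg c, symmetric]) (use or_of_subset[OF l] W in simp)
    ultimately show "(case case x of (h, k) \<Rightarrow> if even h then (h, k) else (k, h) of (h, k) \<Rightarrow> contraction ?W h k l) = ?f x"
      by (simp add: hk)
  next
    fix x assume x: "x \<in> ((\<lambda>h. 2 * h) ` halves ?g) \<times> ((\<lambda>h. 2 * h + 1) ` halves ?g')"
    then obtain h k where hk: "x = (2 * h, 2 * k + 1)" "h \<in> halves ?g" "k \<in> halves ?g'" by blast
    show "(case case x of (h, k) \<Rightarrow> if h < k then (h, k) else (k, h) of (h, k) \<Rightarrow> if even h then (h, k) else (k, h)) = x"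
      by (simp add: hk)
    have "2 * h \<noteq> Suc (2 * k)" "2 * h \<noteq> Suc (2 * bar ?g' k)" "Suc (2 * k) \<noteq> 2 * bar ?g h" by presburger+
    then show "(case x of (h, k) \<Rightarrow> if h < k then (h, k) else (k, h)) \<in> M"
      using hk by (auto simp: M_def half_edge_pairs_def disjoint_union_def)
  qed
  also have "\<dots> = contraction_sum ?W ((\<lambda>h. 2 * h) ` halves ?g) ((\<lambda>h. 2 * h + 1) ` halves ?g') l"
    by (simp add: contraction_sum_def sum.cartesian_product)
  finally show ?thesis .
qed

lemma ograph_bracket_eq:
  assumes l: "l \<in> or_of X" and l': "l' \<in> or_of Y"
  shows "(ograph_bracket X Y :: 'k::field_char_0 graph_space) =
    contraction_sum (disjoint_union (graph_of X) (graph_of Y))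
      ((\<lambda>h. 2 * h) ` halves (graph_of X)) ((\<lambda>h. 2 * h + 1) ` halves (graph_of Y)) (lunion l l')"
proof -
  let ?g = "graph_of X" and ?g' = "graph_of Y" and ?Z = "X \<odot> Y"
  let ?W = "disjoint_union ?g ?g'" and ?H = "\<lambda>h::nat. 2 * h" and ?K = "\<lambda>h::nat. 2 * h + 1"
  obtain l1 l1' where m: "l1 \<in> or_of X" "l1' \<in> or_of Y" "?Z = oriented ?W (lunion l1 l1')"
    by (rule ograph_prod_eq)
  have lab: "l \<in> labellings ?g" "l' \<in> labellings ?g'" "l1 \<in> labellings ?g" "l1' \<in> labellings ?g'"
    using l l' m or_of_subset by auto
  note g = is_graph_graph_of[of X] and g' = is_graph_graph_of[of Y]
  note Wg = is_graph_disjoint_union[OF g g']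
  have W: "graph_of ?Z = ?W" and lZ: "lunion l1 l1' \<in> or_of ?Z"
    unfolding m(3) using graph_of_oriented[OF Wg lunion_labellings[OF g g' lab(3,4)]] in_orientation_class by auto
  define k k' where "k = left_part ?g ?g'" and "k' = right_part ?g ?g'"
  note k = disjoint_union_parts[OF g g', folded k_def k'_def]
  have d': "disjoint_graphs k' k" by (rule disjoint_graphs_sym[OF k(2)])
  have comm: "gunion k' k = gunion k k'" by (rule gunion_commute[OF k(2)])
  let ?l = "relabel ?H ?H l1" and ?l' = "relabel ?K ?K l1'"
  have rl: "?l \<in> labellings k" "?l' \<in> labellings k'"
    using relabel_mem[OF g k(5) lab(3)] relabel_mem[OF g' k(6) lab(4)] .
  have clsX: "cls X = (gcls k ?l :: 'k graph_space)" and clsY: "cls Y = (gcls k' ?l' :: 'k graph_space)"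
    unfolding cls_eq_gcls[OF m(1)] cls_eq_gcls[OF m(2)]
    by (rule gcls_relabel[OF g k(5) lab(3), symmetric], rule gcls_relabel[OF g' k(6) lab(4), symmetric])
  have nX: "nverts X = card (verts k)"
    unfolding nverts_def using k(5) bij_betw_same_card graph_isoD(1) by metis
  have X1: "X_hk ?Z (2 * h) (2 * j) = (gprod (X_hk X h j) (cls Y) :: 'k graph_space)"
    if hj: "(h, j) \<in> half_edge_pairs ?g" for h j
  proof (cases "origin ?g h = origin ?g j")
    case True
    then show ?thesis
      by (simp add: X_hk_def W disjoint_union_def glinearD(3)[OF gprod_linear(2)])
  next
    case False
    then have c: "contractible ?g h j" using hj by (auto simp: half_edge_pairs_def contractible_def)
    note c1 = contractible_iso[OF g k(5) c]
    have "contractible ?W (2 * h) (2 * j)" unfolding k(1) by (rule contractible_gunion(1)[OF k(2) c1])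
    then have "X_hk ?Z (2 * h) (2 * j) = (contraction ?W (2 * h) (2 * j) (lunion l1 l1') :: 'k graph_space)"
      using X_hk_eq[OF _ lZ] W by simp
    also have "\<dots> = gprod (contraction k (2 * h) (2 * j) ?l) (gcls k' ?l')"
      unfolding gprod_contraction(2)[OF k(4,3) d' c1 rl(2,1)] k(1) lunion_def ..
    also have "contraction k (2 * h) (2 * j) ?l = (X_hk X h j :: 'k graph_space)"
      using contraction_relabel[OF g k(5) c lab(3), where 'k = 'k] X_hk_eq[OF c m(1), where 'k = 'k] by simp
    finally show ?thesis by (simp add: clsY)
  qed
  have X2: "X_hk ?Z (2 * h + 1) (2 * j + 1) = ((-1) ^ nverts X *\<^sub>G gprod (cls X) (X_hk Y h j) :: 'k graph_space)"
    if hj: "(h, j) \<in> half_edge_pairs ?g'" for h j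
  proof (cases "origin ?g' h = origin ?g' j")
    case True
    then show ?thesis
      by (simp add: X_hk_def W disjoint_union_def glinearD(3)[OF gprod_linear(1)])
  next
    case False
    then have c: "contractible ?g' h j" using hj by (auto simp: half_edge_pairs_def contractible_def)
    note c1 = contractible_iso[OF g' k(6) c]
    have "contractible ?W (2 * h + 1) (2 * j + 1)" unfolding k(1) by (rule contractible_gunion(2)[OF k(2) c1])
    then have "X_hk ?Z (2 * h + 1) (2 * j + 1) = (contraction ?W (2 * h + 1) (2 * j + 1) (lunion l1 l1') :: 'k graph_space)"
      using X_hk_eq[OF _ lZ] W by simp
    also have "\<dots> = (-1) ^ nverts X *\<^sub>G gprod (gcls k ?l) (contraction k' (2 * h + 1) (2 * j + 1) ?l')"
      unfolding gprod_contraction(1)[OF k(3,4,2) c1 rl] k(1) lunion_def nX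
      by (simp flip: mult_2 power_add add: power_mult)
    also have "contraction k' (2 * h + 1) (2 * j + 1) ?l' = (X_hk Y h j :: 'k graph_space)"
      using contraction_relabel[OF g' k(6) c lab(4), where 'k = 'k] X_hk_eq[OF c m(2), where 'k = 'k] by simp
    finally show ?thesis by (simp add: clsX)
  qed
  have bX: "gprod (boundary_H X) (cls Y) = (\<Sum>(h, j) \<in> half_edge_pairs ?g. X_hk ?Z (2 * h) (2 * j) :: 'k graph_space)"
    unfolding boundary_H_def half_edge_pairs_def[symmetric] glinearD(6)[OF gprod_linear(2)]
    by (intro sum.cong refl) (auto simp: X1)
  have bY: "(-1) ^ nverts X *\<^sub>G gprod (cls X) (boundary_H Y) =
      (\<Sum>(h, j) \<in> half_edge_pairs ?g'. X_hk ?Z (2 * h + 1) (2 * j + 1) :: 'k graph_space)"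
    unfolding boundary_H_def half_edge_pairs_def[symmetric] glinearD(6)[OF gprod_linear(1)] G.scale_sum_right
    by (intro sum.cong refl) (use X2 in auto)
  have "ograph_bracket X Y = (contraction_sum ?W (?H ` halves ?g) (?K ` halves ?g') (lunion l1 l1') :: 'k graph_space)"
    unfolding ograph_bracket_def bX bY boundary_H_prod[OF lZ W] by simp
  also have "\<dots> = contraction_sum ?W (?H ` halves ?g) (?K ` halves ?g') (lunion l l')"
  proof -
    note inv = graph_invariant_disjoint_union[OF union_invariant_contraction_sum[where 'k = 'k]]
    have "alternating ?g (\<lambda>l. contraction_sum ?W (?H ` halves ?g) (?K ` halves ?g') (lunion l l1') :: 'k graph_space)"
      using inv(2)[OF g' lab(4)] g unfolding graph_invariant_def by blast
    moreover have "alternating ?g' (\<lambda>l'. contraction_sum ?W (?H ` halves ?g) (?K ` halves ?g') (lunion l l') :: 'k graph_space)"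
      using inv(1)[OF g lab(1)] g' unfolding graph_invariant_def by blast
    ultimately show ?thesis
      using alternating_or_of[of X _ l1 l] alternating_or_of[of Y _ l1' l'] m l l' by metis
  qed
  finally show ?thesis .
qed

lemma gbracket_facts:
  shows bilinear_extension_gbracket:
    "bilinear_extension ograph_bracket (gbracket :: 'k::field_char_0 graph_space \<Rightarrow> _)"
    and gbracket_gcls: "is_graph g \<Longrightarrow> l \<in> labellings g \<Longrightarrow> is_graph g' \<Longrightarrow> l' \<in> labellings g' \<Longrightarrow>
      disjoint_graphs g g' \<Longrightarrow> gbracket (gcls g l) (gcls g' l') =
        (contraction_sum (gunion g g') (halves g) (halves g') (ljoin l l') :: 'k graph_space)"
proof -
  note I = graph_invariant_disjoint_union[OF union_invariant_contraction_sum[where 'k = 'k]]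
  obtain B :: "'k graph_space \<Rightarrow> 'k graph_space \<Rightarrow> 'k graph_space" where B: "bilinear_map gscale B"
    "\<And>g l g' l'. is_graph g \<Longrightarrow> l \<in> labellings g \<Longrightarrow> is_graph g' \<Longrightarrow> l' \<in> labellings g' \<Longrightarrow>
       B (gcls g l) (gcls g' l') = contraction_sum (disjoint_union g g')
         ((\<lambda>h. 2 * h) ` halves g) ((\<lambda>h. 2 * h + 1) ` halves g') (lunion l l')"
    using bilinear_map_extension[OF I(1,2)] by blast
  have "B (cls X) (cls Y) = ograph_bracket X Y" for X Y
  proof -
    obtain l l' where l: "l \<in> or_of X" "l' \<in> or_of Y" using or_of_nonempty by metis
    show ?thesis
      unfolding cls_eq_gcls[OF l(1)] cls_eq_gcls[OF l(2)] ograph_bracket_eq[OF l]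
      by (rule B(2)) (use l or_of_subset in auto)
  qed
  then have "bilinear_extension ograph_bracket B"
    using B(1) by (simp add: bilinear_extension_def)
  then have *: "gbracket = B" "bilinear_extension ograph_bracket B"
    using bilinear_extension_The[of ograph_bracket B] by (simp_all add: gbracket_def)
  then show "bilinear_extension ograph_bracket (gbracket :: 'k graph_space \<Rightarrow> _)" by simp
  show "gbracket (gcls g l) (gcls g' l') =
        (contraction_sum (gunion g g') (halves g) (halves g') (ljoin l l') :: 'k graph_space)"
    if "is_graph g" "l \<in> labellings g" "is_graph g'" "l' \<in> labellings g'" "disjoint_graphs g g'"
    unfolding *(1) B(2)[OF that(1-4)] by (rule I(3)[OF that])
qed

lemma bilinear_gbracket: "bilinear_map gscale (gbracket :: 'k::field_char_0 graph_space \<Rightarrow> _)"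
  by (rule bilinear_extension_gbracket[unfolded bilinear_extension_def, THEN conjunct1])

lemmas gbracket_linear = bilinear_mapD[OF bilinear_gbracket]

lemma glinear_scale: "glinear (gscale c)"
  by (auto simp: glinear_iff G.scale_right_distrib ac_simps)

section \<open>Double contractions and the Jacobi identity\<close>

definition contraction2 :: "graph \<Rightarrow> nat \<Rightarrow> nat \<Rightarrow> nat \<Rightarrow> nat \<Rightarrow> labelling \<Rightarrow> 'k::field_char_0 graph_space" where
  "contraction2 g p q h m = contract_lift g p q (contraction (contract_graph g p q) h m)"

lemma contraction2_alternating:
  assumes "is_graph g" "contractible g p q" "contractible (contract_graph g p q) h m"
  shows "alternating g (contraction2 g p q h m :: _ \<Rightarrow> 'k::field_char_0 graph_space)"
  unfolding contraction2_def
  by (intro contract_lift_alternating contraction_alternating is_graph_contract assms)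

lemma contractible_contract_gunion:
  assumes g: "is_graph g" and g': "is_graph g'" and d: "disjoint_graphs g g'" and c: "contractible g' p q"
    and h: "h \<in> halves g" and m: "m \<in> halves g' - {p, q}"
  shows "contractible (contract_graph (gunion g g') p q) h m"
proof -
  define k where "k = transplant g (contract_graph g' p q)"
  note k = contract_gunion[OF g g' d c, folded k_def]
  show ?thesis
    unfolding k(7)[symmetric]
    by (rule contractible_gunion(3)[OF k(6,1) is_graph_contract[OF g' c]])
      (use h m k(4) contract_graph_simps[OF g' c] in auto)
qed

lemma gbracket_contraction:
  assumes g: "is_graph g" and g': "is_graph g'" and d: "disjoint_graphs g g'" and c: "contractible g' p q"
    and l: "l \<in> labellings g" and l': "l' \<in> labellings g'"
  shows "gbracket (gcls g l) (contraction g' p q l') =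
      (-1) ^ card (verts g) *\<^sub>G (\<Sum>h\<in>halves g. \<Sum>m\<in>halves g' - {p, q}.
         contraction2 (gunion g g') p q h m (ljoin l l') :: 'k::field_char_0 graph_space)"
proof -
  let ?W = "gunion g g'" and ?C = "contract_graph g' p q"
  let ?R = "\<lambda>l. \<Sum>h\<in>halves g. \<Sum>m\<in>halves g' - {p, q}. contraction2 ?W p q h m l :: 'k graph_space"
  note W = is_graph_gunion[OF g g' d] and cW = contractible_gunion(2)[OF d c]
  obtain vs J where vJ: "l = (vs, J)" by fastforce
  define k where "k = transplant g (contract_graph g' p q)"
  note k = contract_gunion[OF g g' d c, folded k_def]
  have len: "length vs = card (verts g)"
    using l distinct_card[of vs] by (simp add: vJ mem_labellings)
  note c2 = contractible_contract_gunion[OF g g' d c]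
  have alt: "alternating ?W ?R"
    by (intro alternating_sum contraction2_alternating[OF W cW] c2)
  show ?thesis
  proof (rule alternating_eq_contract[OF g' c _ _ _ l'])
    show "alternating g' (\<lambda>l'. gbracket (gcls g l) (contraction g' p q l' :: 'k graph_space))"
      by (rule alternating_linear[OF gbracket_linear(1) contraction_alternating[OF g' c]])
    show "alternating g' (\<lambda>l'. (-1) ^ card (verts g) *\<^sub>G ?R (ljoin l l'))"
      by (rule alternating_linear[OF glinear_scale alternating_ljoin_right[OF g g' d l alt]])
    fix r I assume l': "([origin g' p, origin g' q] @ r, I) \<in> labellings g'" and I: "{p, bar g' q} \<subseteq> I"
    note lC = contract_labellings[OF g' c l' I]
    let ?l' = "(origin g' p # r, I - {p, q})"
    have "contraction2 ?W p q h m (ljoin l ([origin g' p, origin g' q] @ r, I)) =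
        (-1) ^ length vs *\<^sub>G (contraction (contract_graph ?W p q) h m (ljoin l ?l') :: 'k graph_space)"
      if "h \<in> halves g" "m \<in> halves g' - {p, q}" for h m
      unfolding contraction2_def vJ
      by (rule contract_lift_ljoin(1)[OF g g' d c contraction_alternating[OF is_graph_contract[OF W cW] c2[OF that]]
            l[unfolded vJ] l' I])
    then have "?R (ljoin l ([origin g' p, origin g' q] @ r, I)) =
        (\<Sum>h\<in>halves g. \<Sum>m\<in>halves g' - {p, q}.
          (-1) ^ length vs *\<^sub>G (contraction (contract_graph ?W p q) h m (ljoin l ?l') :: 'k graph_space))"
      by (intro sum.cong refl) blast
    also have "\<dots> = (-1) ^ length vs *\<^sub>G contraction_sum (gunion k ?C) (halves k) (halves ?C) (ljoin l ?l')"
      by (simp add: contraction_sum_def G.scale_sum_right k(4,7) contract_graph_simps(2)[OF g' c])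
    also have "contraction_sum (gunion k ?C) (halves k) (halves ?C) (ljoin l ?l') =
        (gbracket (gcls k l) (gcls ?C ?l') :: 'k graph_space)"
      using gbracket_gcls[OF k(1) _ is_graph_contract[OF g' c] lC k(6), of l, where 'k = 'k] l
      by (simp add: k(2))
    also have "\<dots> = gbracket (gcls g l) (contraction g' p q ([origin g' p, origin g' q] @ r, I))"
      unfolding contraction_def contract_lift_standard(1)[OF g' c l' I] k(5)[OF l] ..
    finally show "gbracket (gcls g l) (contraction g' p q ([origin g' p, origin g' q] @ r, I)) =
      (-1) ^ card (verts g) *\<^sub>G ?R (ljoin l ([origin g' p, origin g' q] @ r, I))"
      by (simp add: len powneg1_mult del: G.scale_scale)
  qed
qed

text \<open>
  Contracting \<open>p\<close> with \<open>q\<close> and then \<open>h\<close> with \<open>m\<close> gives the same graph as contracting in the other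
  order, but the two collapsed vertices (or, if \<open>p\<close> and \<open>m\<close> begin at the same vertex, the
  vertices which are merged into it) get their numbers in the opposite order.
\<close>

lemma contraction2_commute:
  assumes g: "is_graph g"
    and hs: "p \<in> halves g" "q \<in> halves g" "h \<in> halves g" "m \<in> halves g" "distinct [p, q, h, m]"
    and os: "origin g q \<notin> {origin g p, origin g m, origin g h}" "origin g h \<notin> {origin g p, origin g m}"
    and bs: "bar g q \<notin> {p, h, m}" "bar g h \<notin> {p, q, m}"
    and l: "l \<in> labellings g"
  shows "contraction2 g p q h m l = - (contraction2 g h m q p l :: 'k::field_char_0 graph_space)"
proof -
  have bb: "bar g (bar g p) = p" "bar g (bar g q) = q" "bar g (bar g h) = h" "bar g (bar g m) = m"
    "bar g p \<noteq> p" "bar g q \<noteq> q" "bar g h \<noteq> h" "bar g m \<noteq> m"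
    using is_graphD(5,6)[OF g] hs by auto
  have bs': "bar g p \<noteq> q" "bar g p \<noteq> h" "bar g m \<noteq> q" "bar g m \<noteq> h"
    using bs bb by auto
  have bi: "bar g q \<noteq> bar g p" "bar g q \<noteq> bar g h" "bar g q \<noteq> bar g m" "bar g h \<noteq> bar g p"
    "bar g h \<noteq> bar g m" "bar g m \<noteq> bar g p"
    using bb(1-4) hs(5) by (metis distinct_length_2_or_more)+
  note ne = hs(5) os bs bs' bi bb(5-8)
  have c1: "contractible g p q" "contractible g h m" using hs ne by (auto simp: contractible_def)
  note b1 = bar_reglue_graph[OF g c1(1)] and b2 = bar_reglue_graph[OF g c1(2)]
  let ?g1 = "contract_graph g p q" and ?g2 = "contract_graph g h m"
  note G = is_graph_contract[OF g c1(1)] is_graph_contract[OF g c1(2)]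
  note s1 = contract_graph_simps[OF g c1(1)] and s2 = contract_graph_simps[OF g c1(2)]
  have o1: "origin ?g1 h = origin g h" "origin ?g1 m = origin g m"
    and o2: "origin ?g2 q = origin g q"
      "origin ?g2 p = (if origin g p = origin g m then origin g h else origin g p)"
    using ne by (auto simp: s1 s2)
  have bg1: "bar ?g1 h = bar g h" "bar ?g1 m = (if m = bar g p then bar g q else bar g m)"
    using ne b1 bb by (auto simp: s1 reglue_graph_def)
  have bg2: "bar ?g2 q = bar g q" "bar ?g2 p = (if m = bar g p then bar g h else bar g p)"
    using ne b2 bb by (auto simp: s2 reglue_graph_def)
  have c2: "contractible ?g1 h m" "contractible ?g2 p q"
    using hs ne o1 o2 bg1 bg2 unfolding contractible_def by (auto simp: s1(2) s2(2) split: if_splits)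
  let ?g12 = "contract_graph ?g1 h m" and ?g21 = "contract_graph ?g2 p q"
  note s12 = contract_graph_simps[OF G(1) c2(1)] and s21 = contract_graph_simps[OF G(2) c2(2)]
  have eqv: "verts ?g21 = verts ?g12" and eqh: "halves ?g21 = halves ?g12"
    unfolding s12 s21 o1 o2 s1 s2 using os by auto
  have eqo: "origin ?g21 j = origin ?g12 j" for j
    unfolding s12 s21 o1 o2 unfolding s1 s2 using ne by auto
  have eqb: "bar ?g21 j = bar ?g12 j" if j: "j \<in> halves ?g12" for j
  proof -
    have jn: "j \<noteq> p" "j \<noteq> q" "j \<noteq> h" "j \<noteq> m" using j by (auto simp: s12 s1)
    show ?thesis
      unfolding s12(4) s21(4) reglue_graph_def[of ?g1] reglue_graph_def[of ?g2]
      unfolding graph.simps bg1 bg2 unfolding s1(4) s2(4) reglue_graph_def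
      using jn ne bb by (auto simp: fun_upd_def)
  qed
  have cong: "gcls ?g21 l = (gcls ?g12 l :: 'k graph_space)" if "l \<in> labellings ?g12" for l
    by (rule gcls_cong[OF is_graph_contract[OF G(1) c2(1)] eqv eqh eqo eqb that])
  have labs: "labellings ?g21 = labellings ?g12"
    by (rule graph_cong(2)[OF is_graph_contract[OF G(1) c2(1)] eqv eqh eqo eqb])
  note c2' = contractible_commute[OF G(2) c2(2)]
  note alt = contraction2_alternating[OF g c1(1) c2(1), where 'k = 'k]
    contraction2_alternating[OF g c1(2) c2', where 'k = 'k]
  have altn: "alternating g (\<lambda>l. - (contraction2 g h m q p l :: 'k graph_space))"
    using alt(2) unfolding alternating_def by simp
  let ?A = "{p, bar g q, h, bar g m}"
  have A1: "?A \<subseteq> halves g"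
    using hs is_graphD(4)[OF g hs(2)] is_graphD(4)[OF g hs(4)] by simp
  have A2: "bar g j \<notin> ?A" if j: "j \<in> ?A" for j
  proof -
    consider "j = p" | "j = bar g q" | "j = h" | "j = bar g m" using j by blast
    then show ?thesis by cases (use ne in \<open>auto simp: bb(1-4)\<close>)
  qed
  note A = A1 A2
  have ov: "origin g p \<in> verts g" "origin g q \<in> verts g" "origin g h \<in> verts g" "origin g m \<in> verts g"
    using is_graphD(3)[OF g] hs by auto
  have I1: "{p, bar g q} \<subseteq> I" and I2: "{h, bar ?g1 m} \<subseteq> I - {p, q}"
    and I3: "{h, bar g m} \<subseteq> I" and I4: "{p, bar ?g2 q} \<subseteq> I - {h, m}" if "?A \<subseteq> I" for I
    using that ne bb(4) unfolding bg1 bg2 by auto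
  have II: "I - {h, m} - {p, q} = I - {p, q} - {h, m}" for I by auto
  show ?thesis
  proof (cases "origin g p = origin g m")
    case False
    let ?xs = "[origin g p, origin g q, origin g h, origin g m]"
    show ?thesis
    proof (rule alternating_eq_standard[OF g alt(1) altn _ _ A _ l])
      show "distinct ?xs" "set ?xs \<subseteq> verts g" using False os ov by auto
      fix r I assume l: "(?xs @ r, I) \<in> labellings g" and I: "?A \<subseteq> I"
      have la: "([origin g p, origin g q] @ ([origin g h, origin g m] @ r), I) \<in> labellings g"
        using l by simp
      have lb: "([origin g h, origin g m] @ ([origin g p, origin g q] @ r), I) \<in> labellings g"
        by (rule labellings_mset[OF l]) simp
      have la1: "([origin g p] @ [origin g h, origin g m] @ r, I - {p, q}) \<in> labellings ?g1"
        using contract_labellings[OF g c1(1) la I1[OF I]] by simp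
      have la2: "([origin ?g1 h, origin ?g1 m] @ ([origin g p] @ r), I - {p, q}) \<in> labellings ?g1"
        unfolding o1 by (rule labellings_mset[OF la1]) simp
      have lb1: "([origin g h] @ [origin g p, origin g q] @ r, I - {h, m}) \<in> labellings ?g2"
        using contract_labellings[OF g c1(2) lb I3[OF I]] by simp
      have o2p: "origin ?g2 p = origin g p" using o2 False by simp
      have lb2: "([origin ?g2 p, origin ?g2 q] @ ([origin g h] @ r), I - {h, m}) \<in> labellings ?g2"
        unfolding o2p o2(1) by (rule labellings_mset[OF lb1]) simp
      have "contraction2 g p q h m (?xs @ r, I) =
          (contraction ?g1 h m ([origin g p] @ [origin g h, origin g m] @ r, I - {p, q}) :: 'k graph_space)"
        using contract_lift_standard(1)[OF g c1(1) la I1[OF I]] by (simp add: contraction2_def)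
      also have "\<dots> = contraction ?g1 h m ([origin ?g1 h, origin ?g1 m] @ ([origin g p] @ r), I - {p, q})"
        using alternating_block_swap[OF contraction_alternating[OF G(1) c2(1)] la1, where 'k = 'k] by (simp add: o1)
      also have "\<dots> = gcls ?g12 (origin g h # origin g p # r, I - {p, q} - {h, m})"
        using contract_lift_standard(1)[OF G(1) c2(1) la2 I2[OF I], of "gcls ?g12 :: _ \<Rightarrow> 'k graph_space"]
        by (simp add: contraction_def o1)
      finally have 1: "contraction2 g p q h m (?xs @ r, I) =
          (gcls ?g12 (origin g h # origin g p # r, I - {p, q} - {h, m}) :: 'k graph_space)" .
      have "contraction2 g h m q p (?xs @ r, I) =
          (contraction2 g h m q p ([origin g h, origin g m] @ ([origin g p, origin g q] @ r), I) :: 'k graph_space)"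
        using alternating_block_swap[OF alt(2), of "[origin g p, origin g q]" "[origin g h, origin g m]" r I] l
        by simp
      also have "\<dots> = contraction ?g2 q p ([origin g h] @ [origin g p, origin g q] @ r, I - {h, m})"
        using contract_lift_standard(1)[OF g c1(2) lb I3[OF I]] by (simp add: contraction2_def)
      also have "\<dots> = contraction ?g2 p q ([origin g h] @ [origin g p, origin g q] @ r, I - {h, m})"
        by (rule contraction_commute[OF G(2) c2' lb1])
      also have "\<dots> = contraction ?g2 p q ([origin ?g2 p, origin ?g2 q] @ ([origin g h] @ r), I - {h, m})"
        using alternating_block_swap[OF contraction_alternating[OF G(2) c2(2)] lb1, where 'k = 'k]
        by (simp add: o2p o2(1))
      also have "\<dots> = gcls ?g21 (origin g p # origin g h # r, I - {p, q} - {h, m})"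
        using contract_lift_standard(1)[OF G(2) c2(2) lb2 I4[OF I], of "gcls ?g21 :: _ \<Rightarrow> 'k graph_space"]
        by (simp add: contraction_def o2p II)
      also have "\<dots> = - gcls ?g21 (origin g h # origin g p # r, I - {p, q} - {h, m})"
      proof -
        have "([] @ origin g p # [] @ origin g h # r, I - {p, q} - {h, m}) \<in> labellings ?g21"
          using contract_labellings[OF G(2) c2(2) lb2 I4[OF I]] by (simp add: o2p II)
        from alternating_swap[OF gcls_alternating[OF is_graph_contract[OF G(2) c2(2)], where 'k = 'k] this]
        show ?thesis by simp
      qed
      also have "gcls ?g21 (origin g h # origin g p # r, I - {p, q} - {h, m}) =
          (gcls ?g12 (origin g h # origin g p # r, I - {p, q} - {h, m}) :: 'k graph_space)"
        using cong contract_labellings[OF G(1) c2(1) la2 I2[OF I]] by (simp add: o1)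
      finally show "contraction2 g p q h m (?xs @ r, I) = - (contraction2 g h m q p (?xs @ r, I) :: 'k graph_space)"
        unfolding 1 by simp
    qed
  next
    case True
    let ?xs = "[origin g p, origin g q, origin g h]"
    show ?thesis
    proof (rule alternating_eq_standard[OF g alt(1) altn _ _ A _ l])
      show "distinct ?xs" "set ?xs \<subseteq> verts g" using os ov by auto
      fix r I assume l: "(?xs @ r, I) \<in> labellings g" and I: "?A \<subseteq> I"
      have la: "([origin g p, origin g q] @ ([origin g h] @ r), I) \<in> labellings g"
        using l by simp
      have lb: "([origin g h, origin g m] @ ([origin g q] @ r), I) \<in> labellings g"
        by (rule labellings_mset[OF l]) (simp add: True)
      have la1: "([] @ origin g p # [] @ origin g h # r, I - {p, q}) \<in> labellings ?g1"
        using contract_labellings[OF g c1(1) la I1[OF I]] by simp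
      have la2: "([origin ?g1 h, origin ?g1 m] @ r, I - {p, q}) \<in> labellings ?g1"
        unfolding o1 by (rule labellings_mset[OF la1]) (simp add: True)
      have o2p: "origin ?g2 p = origin g h" using o2 True by simp
      have lb2: "([origin ?g2 p, origin ?g2 q] @ r, I - {h, m}) \<in> labellings ?g2"
        using contract_labellings[OF g c1(2) lb I3[OF I]] unfolding o2p o2(1) by simp
      have "contraction2 g p q h m (?xs @ r, I) =
          (contraction ?g1 h m (origin g p # origin g h # r, I - {p, q}) :: 'k graph_space)"
        using contract_lift_standard(1)[OF g c1(1) la I1[OF I]] by (simp add: contraction2_def)
      also have "\<dots> = - contraction ?g1 h m ([origin ?g1 h, origin ?g1 m] @ r, I - {p, q})"
        using alternating_swap[OF contraction_alternating[OF G(1) c2(1), where 'k = 'k] la1]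
        by (simp add: o1 True)
      also have "contraction ?g1 h m ([origin ?g1 h, origin ?g1 m] @ r, I - {p, q}) =
          (gcls ?g12 (origin g h # r, I - {p, q} - {h, m}) :: 'k graph_space)"
        using contract_lift_standard(1)[OF G(1) c2(1) la2 I2[OF I], of "gcls ?g12 :: _ \<Rightarrow> 'k graph_space"]
        by (simp add: contraction_def o1)
      finally have 1: "contraction2 g p q h m (?xs @ r, I) =
          - (gcls ?g12 (origin g h # r, I - {p, q} - {h, m}) :: 'k graph_space)" .
      have "contraction2 g h m q p (?xs @ r, I) =
          (contraction2 g h m q p ([origin g h, origin g m] @ ([origin g q] @ r), I) :: 'k graph_space)"
        using alternating_block_swap[OF alt(2), of "[origin g p, origin g q]" "[origin g h]" r I] l True
        by simp
      also have "\<dots> = contraction ?g2 q p ([origin ?g2 p, origin ?g2 q] @ r, I - {h, m})"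
        using contract_lift_standard(1)[OF g c1(2) lb I3[OF I]] by (simp add: contraction2_def o2p o2(1))
      also have "\<dots> = contraction ?g2 p q ([origin ?g2 p, origin ?g2 q] @ r, I - {h, m})"
        by (rule contraction_commute[OF G(2) c2' lb2])
      also have "\<dots> = gcls ?g21 (origin g h # r, I - {p, q} - {h, m})"
        using contract_lift_standard(1)[OF G(2) c2(2) lb2 I4[OF I], of "gcls ?g21 :: _ \<Rightarrow> 'k graph_space"]
        by (simp add: contraction_def o2p II)
      also have "\<dots> = gcls ?g12 (origin g h # r, I - {p, q} - {h, m})"
        using cong contract_labellings[OF G(1) c2(1) la2 I2[OF I]] by (simp add: o1)
      finally show "contraction2 g p q h m (?xs @ r, I) = - (contraction2 g h m q p (?xs @ r, I) :: 'k graph_space)"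
        unfolding 1 by simp
    qed
  qed
qed

definition contraction2_sum ::
  "graph \<Rightarrow> nat set \<Rightarrow> nat set \<Rightarrow> nat set \<Rightarrow> labelling \<Rightarrow> 'k::field_char_0 graph_space" where
  "contraction2_sum g A B C l =
     (\<Sum>k\<in>B. \<Sum>q\<in>C. \<Sum>h\<in>A. \<Sum>m\<in>(B \<union> C) - {k, q}. contraction2 g k q h m l)"

definition disjoint_triple ::
  "graph \<Rightarrow> labelling \<Rightarrow> graph \<Rightarrow> labelling \<Rightarrow> graph \<Rightarrow> labelling \<Rightarrow> bool" where
  "disjoint_triple ga la gb lb gc lc \<longleftrightarrow> is_graph ga \<and> is_graph gb \<and> is_graph gc \<and>
     disjoint_graphs ga gb \<and> disjoint_graphs ga gc \<and> disjoint_graphs gb gc \<and>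
     la \<in> labellings ga \<and> lb \<in> labellings gb \<and> lc \<in> labellings gc"

lemma disjoint_tripleD:
  assumes "disjoint_triple ga la gb lb gc lc"
  shows "is_graph ga" "is_graph gb" "is_graph gc"
    "disjoint_graphs ga gb" "disjoint_graphs ga gc" "disjoint_graphs gb gc"
    "la \<in> labellings ga" "lb \<in> labellings gb" "lc \<in> labellings gc"
  using assms by (simp_all add: disjoint_triple_def)

lemma disjoint_triple_rotate:
  "disjoint_triple ga la gb lb gc lc \<Longrightarrow> disjoint_triple gc lc ga la gb lb"
  by (simp add: disjoint_triple_def disjoint_graphs_sym)

lemma gbracket_gbracket:
  assumes t: "disjoint_triple ga la gb lb gc lc"
  shows "gbracket (gcls ga la) (gbracket (gcls gb lb) (gcls gc lc)) =
      (-1) ^ card (verts ga) *\<^sub>G (contraction2_sum (gunion ga (gunion gb gc)) (halves ga) (halves gb) (halves gc)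
        (ljoin la (ljoin lb lc)) :: 'k::field_char_0 graph_space)"
    and "alternating (gunion ga (gunion gb gc))
      (contraction2_sum (gunion ga (gunion gb gc)) (halves ga) (halves gb) (halves gc) :: _ \<Rightarrow> 'k graph_space)"
proof -
  note g = disjoint_tripleD(1-3)[OF t] and d = disjoint_tripleD(4-6)[OF t] and l = disjoint_tripleD(7-9)[OF t]
  note bc = is_graph_gunion[OF g(2,3) d(3)] ljoin_labellings[OF g(2,3) d(3) l(2,3)]
  note dd = disjoint_graphs_gunion(2)[OF d(1,2)]
  note W = is_graph_gunion[OF g(1) bc(1) dd]
  have c: "contractible (gunion gb gc) k q" if "k \<in> halves gb" "q \<in> halves gc" for k q
    by (rule contractible_gunion(3)[OF d(3) g(2,3) that])
  have "gbracket (gcls ga la) (gbracket (gcls gb lb) (gcls gc lc)) =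
    (\<Sum>k\<in>halves gb. \<Sum>q\<in>halves gc. gbracket (gcls ga la) (contraction (gunion gb gc) k q (ljoin lb lc)) :: 'k graph_space)"
    unfolding gbracket_gcls[OF g(2) l(2) g(3) l(3) d(3)] contraction_sum_def glinearD(6)[OF gbracket_linear(1)] ..
  also have "\<dots> = (\<Sum>k\<in>halves gb. \<Sum>q\<in>halves gc. (-1) ^ card (verts ga) *\<^sub>G
      (\<Sum>h\<in>halves ga. \<Sum>m\<in>halves (gunion gb gc) - {k, q}.
         contraction2 (gunion ga (gunion gb gc)) k q h m (ljoin la (ljoin lb lc))))"
    by (intro sum.cong refl gbracket_contraction[OF g(1) bc(1) dd _ l(1) bc(2)] c)
  finally show "gbracket (gcls ga la) (gbracket (gcls gb lb) (gcls gc lc)) =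
      (-1) ^ card (verts ga) *\<^sub>G (contraction2_sum (gunion ga (gunion gb gc)) (halves ga) (halves gb) (halves gc)
        (ljoin la (ljoin lb lc)) :: 'k graph_space)"
    by (simp add: contraction2_sum_def G.scale_sum_right)
  show "alternating (gunion ga (gunion gb gc))
      (contraction2_sum (gunion ga (gunion gb gc)) (halves ga) (halves gb) (halves gc) :: _ \<Rightarrow> 'k graph_space)"
    unfolding contraction2_sum_def[abs_def]
    by (intro alternating_sum contraction2_alternating[OF W] contractible_gunion(2)[OF dd]
        contractible_contract_gunion[OF g(1) bc(1) dd] c) simp_all
qed

lemma sum_swap4:
  fixes f :: "'a \<Rightarrow> 'b \<Rightarrow> 'c \<Rightarrow> 'd \<Rightarrow> 'e::comm_monoid_add"
  shows "(\<Sum>a\<in>A. \<Sum>b\<in>B. \<Sum>c\<in>C. \<Sum>d\<in>D. f a b c d) = (\<Sum>d\<in>D. \<Sum>c\<in>C. \<Sum>a\<in>A. \<Sum>b\<in>B. f a b c d)"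
  unfolding sum.cartesian_product
  by (rule sum.reindex_bij_witness[of _ "\<lambda>(d, c, a, b). (a, b, c, d)" "\<lambda>(a, b, c, d). (d, c, a, b)"]) auto

lemma sum_remove_if:
  fixes f :: "'a \<Rightarrow> 'b::comm_monoid_add"
  assumes "finite A"
  shows "(\<Sum>m\<in>A - {k}. f m) = (\<Sum>m\<in>A. if m = k then 0 else f m)"
  using assms by (intro sum.mono_neutral_cong_left) auto

text \<open>
  As \<open>h\<close> lies in \<open>A\<close>, \<open>k\<close> in \<open>B\<close> and \<open>q\<close> in \<open>C\<close>, the half-edge \<open>m\<close> lies in the same graph as
  \<open>k\<close> in the first of the following sums, and in the same graph as \<open>q\<close> in the second one.
\<close>

definition contraction2_first ::
  "graph \<Rightarrow> nat set \<Rightarrow> nat set \<Rightarrow> nat set \<Rightarrow> labelling \<Rightarrow> 'k::field_char_0 graph_space" where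
  "contraction2_first g A B C l =
     (\<Sum>k\<in>B. \<Sum>q\<in>C. \<Sum>h\<in>A. \<Sum>m\<in>B. if m = k then 0 else contraction2 g k q h m l)"

definition contraction2_second ::
  "graph \<Rightarrow> nat set \<Rightarrow> nat set \<Rightarrow> nat set \<Rightarrow> labelling \<Rightarrow> 'k::field_char_0 graph_space" where
  "contraction2_second g A B C l =
     (\<Sum>k\<in>B. \<Sum>q\<in>C. \<Sum>h\<in>A. \<Sum>m\<in>C. if m = q then 0 else contraction2 g k q h m l)"

lemma contraction2_sum_split:
  assumes "finite B" "finite C" "B \<inter> C = {}"
  shows "contraction2_sum g A B C l =
    contraction2_first g A B C l + (contraction2_second g A B C l :: 'k::field_char_0 graph_space)"
proof -
  have "(\<Sum>m\<in>(B \<union> C) - {k, q}. f m) =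
      (\<Sum>m\<in>B. if m = k then 0 else f m) + (\<Sum>m\<in>C. if m = q then 0 else f m)"
    if "k \<in> B" "q \<in> C" for k q and f :: "nat \<Rightarrow> 'k graph_space"
  proof -
    have "(B \<union> C) - {k, q} = (B - {k}) \<union> (C - {q})" using assms(3) that by auto
    moreover have "(\<Sum>m\<in>(B - {k}) \<union> (C - {q}). f m) = (\<Sum>m\<in>B - {k}. f m) + (\<Sum>m\<in>C - {q}. f m)"
      by (rule sum.union_disjoint) (use assms in auto)
    ultimately show ?thesis by (simp add: sum_remove_if assms)
  qed
  then show ?thesis
    by (simp add: contraction2_sum_def contraction2_first_def contraction2_second_def sum.distrib)
qed

lemma contraction2_cancel:
  assumes t: "disjoint_triple ga la gb lb gc lc"
    and l: "l \<in> labellings (gunion ga (gunion gb gc))"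
  shows "contraction2_second (gunion ga (gunion gb gc)) (halves gc) (halves ga) (halves gb) l =
      - (contraction2_first (gunion ga (gunion gb gc)) (halves ga) (halves gb) (halves gc) l :: 'k::field_char_0 graph_space)"
proof -
  note g = disjoint_tripleD(1-3)[OF t] and d = disjoint_tripleD(4-6)[OF t]
  let ?W = "gunion ga (gunion gb gc)"
  note bc = is_graph_gunion[OF g(2,3) d(3)]
  note dd = disjoint_graphs_gunion(2)[OF d(1,2)]
  note W = is_graph_gunion[OF g(1) bc(1) dd]
  have c: "(if k = m then 0 else contraction2 ?W h m q k l) =
      - (if m = k then 0 else contraction2 ?W k q h m l :: 'k graph_space)"
    if "h \<in> halves ga" "m \<in> halves gb" "q \<in> halves gc" "k \<in> halves gb" for h m q k
  proof (cases "k = m")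
    case False
    have hs: "h \<in> halves ga" "m \<in> halves gb" "q \<in> halves gc" "k \<in> halves gb"
      "bar ga h \<in> halves ga" "bar ga q \<in> halves gc" "origin ga h \<in> verts ga" "origin ga m \<in> verts gb"
      "origin ga q \<in> verts gc" "origin ga k \<in> verts gb"
      using that is_graphD(3,4)[OF g(1) that(1)] is_graphD(3)[OF g(2) that(2)] is_graphD(3)[OF g(2) that(4)]
        is_graphD(3,4)[OF g(3) that(3)] d by (simp_all add: disjoint_graphs_def)
    have disj: "verts ga \<inter> verts gb = {}" "verts ga \<inter> verts gc = {}" "verts gb \<inter> verts gc = {}"
      "halves ga \<inter> halves gb = {}" "halves ga \<inter> halves gc = {}" "halves gb \<inter> halves gc = {}"
      using d by (simp_all add: disjoint_graphs_def)
    have "contraction2 ?W k q h m l = - (contraction2 ?W h m q k l :: 'k graph_space)"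
    proof (rule contraction2_commute[OF W _ _ _ _ _ _ _ _ _ l])
      show "k \<in> halves ?W" "q \<in> halves ?W" "h \<in> halves ?W" "m \<in> halves ?W" using hs by auto
      show "distinct [k, q, h, m]" using hs(1-4) disj(4-6) False by auto
      show "origin ?W q \<notin> {origin ?W k, origin ?W m, origin ?W h}"
        "origin ?W h \<notin> {origin ?W k, origin ?W m}" using hs(7-10) disj(1-3) by auto
      show "bar ?W q \<notin> {k, h, m}" "bar ?W h \<notin> {k, q, m}" using hs(1-6) disj(4-6) by auto
    qed
    then show ?thesis using False by simp
  qed simp
  have "contraction2_second ?W (halves gc) (halves ga) (halves gb) l =
    (\<Sum>h\<in>halves ga. \<Sum>m\<in>halves gb. \<Sum>q\<in>halves gc. \<Sum>k\<in>halves gb.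
       - (if m = k then 0 else contraction2 ?W k q h m l :: 'k graph_space))"
    unfolding contraction2_second_def by (intro sum.cong refl c)
  also have "\<dots> = (\<Sum>k\<in>halves gb. \<Sum>q\<in>halves gc. \<Sum>h\<in>halves ga. \<Sum>m\<in>halves gb.
       - (if m = k then 0 else contraction2 ?W k q h m l :: 'k graph_space))"
    by (rule sum_swap4)
  finally show ?thesis by (simp add: contraction2_first_def sum_negf)
qed

lemma gprod_gcls_commute:
  assumes g: "is_graph g" "is_graph g'" "disjoint_graphs g g'" "l \<in> labellings g" "l' \<in> labellings g'"
  shows "gprod (gcls g l) (gcls g' l') =
    (-1) ^ (card (verts g) * card (verts g')) *\<^sub>G (gprod (gcls g' l') (gcls g l) :: 'k::field_char_0 graph_space)"
  unfolding gprod_gcls[OF g(1,4,2,5,3)] gprod_gcls[OF g(2,5,1,4) disjoint_graphs_sym[OF g(3)]] gunion_commute[OF g(3)]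
  by (rule alternating_ljoin_commute[OF g gcls_alternating[OF is_graph_gunion[OF g(1-3)]]])

lemma gbracket_gcls_commute:
  assumes g: "is_graph g" "is_graph g'" "disjoint_graphs g g'" "l \<in> labellings g" "l' \<in> labellings g'"
  shows "gbracket (gcls g l) (gcls g' l') =
    (-1) ^ (card (verts g) * card (verts g')) *\<^sub>G (gbracket (gcls g' l') (gcls g l) :: 'k::field_char_0 graph_space)"
proof -
  note W = is_graph_gunion[OF g(1-3)]
  let ?S = "\<lambda>l. contraction_sum (gunion g g') (halves g) (halves g') l :: 'k graph_space"
  have alt: "alternating (gunion g g') ?S"
    unfolding contraction_sum_def
    by (intro alternating_sum contraction_alternating[OF W] contractible_gunion(3) g)
  have lj: "ljoin l' l \<in> labellings (gunion g g')"
    using ljoin_labellings[OF g(2,1) disjoint_graphs_sym[OF g(3)] g(5,4)] gunion_commute[OF g(3)] by simp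
  have "gbracket (gcls g' l') (gcls g l) =
      (\<Sum>k\<in>halves g'. \<Sum>h\<in>halves g. contraction (gunion g g') k h (ljoin l' l) :: 'k graph_space)"
    unfolding gbracket_gcls[OF g(2,5,1,4) disjoint_graphs_sym[OF g(3)]] gunion_commute[OF g(3)] contraction_sum_def ..
  also have "\<dots> = (\<Sum>k\<in>halves g'. \<Sum>h\<in>halves g. contraction (gunion g g') h k (ljoin l' l))"
    by (intro sum.cong refl contraction_commute[OF W _ lj, symmetric] contractible_gunion(3) g)
  also have "\<dots> = ?S (ljoin l' l)"
    unfolding contraction_sum_def by (rule sum.swap)
  finally show ?thesis
    unfolding gbracket_gcls[OF g(1,4,2,5,3)] alternating_ljoin_commute[OF g alt] by simp
qed

lemma gbracket_gprod_gcls: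
  assumes t: "disjoint_triple ga la gb lb gc lc"
  shows "gbracket (gcls ga la) (gprod (gcls gb lb) (gcls gc lc)) =
      gprod (gbracket (gcls ga la) (gcls gb lb)) (gcls gc lc) +
      (-1) ^ (card (verts gb) * (card (verts ga) + 1)) *\<^sub>G
        (gprod (gcls gb lb) (gbracket (gcls ga la) (gcls gc lc)) :: 'k::field_char_0 graph_space)"
proof -
  note g = disjoint_tripleD(1-3)[OF t] and d = disjoint_tripleD(4-6)[OF t] and l = disjoint_tripleD(7-9)[OF t]
  let ?W = "gunion ga (gunion gb gc)" and ?l = "ljoin la (ljoin lb lc)"
  note bc = is_graph_gunion[OF g(2,3) d(3)] ljoin_labellings[OF g(2,3) d(3) l(2,3)]
  note ab = is_graph_gunion[OF g(1,2) d(1)] ljoin_labellings[OF g(1,2) d(1) l(1,2)]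
  note ac = is_graph_gunion[OF g(1,3) d(2)] ljoin_labellings[OF g(1,3) d(2) l(1,3)]
  note dd = disjoint_graphs_gunion(2)[OF d(1,2)]
  note W = is_graph_gunion[OF g(1) bc(1) dd]
  have d1: "disjoint_graphs gc (gunion ga gb)"
    by (rule disjoint_graphs_gunion(2)[OF disjoint_graphs_sym[OF d(2)] disjoint_graphs_sym[OF d(3)]])
  have d2: "disjoint_graphs gb (gunion ga gc)"
    by (rule disjoint_graphs_gunion(2)[OF disjoint_graphs_sym[OF d(1)] d(3)])
  have W2: "gunion gb (gunion ga gc) = ?W"
    by (simp add: gunion_assoc[symmetric] gunion_commute[OF d(1)])
  have cW: "contractible ?W h k" if "h \<in> halves ga" "k \<in> halves gb \<union> halves gc" for h k
    by (rule contractible_gunion(3)[OF dd g(1) bc(1)]) (use that in auto)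
  have 1: "gprod (contraction (gunion ga gb) h k (ljoin la lb)) (gcls gc lc) = (contraction ?W h k ?l :: 'k graph_space)"
    if "h \<in> halves ga" "k \<in> halves gb" for h k
    using gprod_contraction(2)[OF g(3) ab(1) d1 contractible_gunion(3)[OF d(1) g(1,2) that] l(3) ab(2), where 'k = 'k]
    by (simp add: gunion_assoc ljoin_assoc)
  have 2: "gprod (gcls gb lb) (contraction (gunion ga gc) h k (ljoin la lc)) =
      ((-1) ^ (card (verts gb) * (card (verts ga) + 1)) *\<^sub>G contraction ?W h k ?l :: 'k graph_space)"
    if h: "h \<in> halves ga" "k \<in> halves gc" for h k
  proof -
    have "alternating ?W (contraction ?W h k :: _ \<Rightarrow> 'k graph_space)"
      by (rule contraction_alternating[OF W cW]) (use h in auto)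
    then have "alternating (gunion (gunion ga gb) gc) (contraction ?W h k :: _ \<Rightarrow> 'k graph_space)"
      by (simp add: gunion_assoc)
    from alternating_ljoin_left[OF ab(1) g(3) disjoint_graphs_sym[OF d1] l(3) this]
    have "(contraction ?W h k (ljoin (ljoin lb la) lc) :: 'k graph_space) =
        (-1) ^ (card (verts ga) * card (verts gb)) *\<^sub>G contraction ?W h k (ljoin (ljoin la lb) lc)"
      by (subst alternating_ljoin_commute[OF g(1,2) d(1) l(1,2)]) (simp_all flip: power_mult_distrib)
    then show ?thesis
      using gprod_contraction(1)[OF g(2) ac(1) d2 contractible_gunion(3)[OF d(2) g(1,3) h] l(2) ac(2), where 'k = 'k]
      by (simp add: W2 ljoin_assoc algebra_simps power_add)
  qed
  have "gbracket (gcls ga la) (gprod (gcls gb lb) (gcls gc lc)) =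
      (\<Sum>h\<in>halves ga. \<Sum>k\<in>halves gb \<union> halves gc. contraction ?W h k ?l :: 'k graph_space)"
    unfolding gprod_gcls[OF g(2) l(2) g(3) l(3) d(3)] gbracket_gcls[OF g(1) l(1) bc dd] contraction_sum_def by simp
  also have "\<dots> = (\<Sum>h\<in>halves ga. \<Sum>k\<in>halves gb. contraction ?W h k ?l) +
      (\<Sum>h\<in>halves ga. \<Sum>k\<in>halves gc. contraction ?W h k ?l)"
    using is_graphD(2)[OF g(2)] is_graphD(2)[OF g(3)] d(3)
    by (simp add: sum.union_disjoint sum.distrib disjoint_graphs_def)
  also have "(\<Sum>h\<in>halves ga. \<Sum>k\<in>halves gb. contraction ?W h k ?l) =
      (gprod (gbracket (gcls ga la) (gcls gb lb)) (gcls gc lc) :: 'k graph_space)"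
    unfolding gbracket_gcls[OF g(1) l(1) g(2) l(2) d(1)] contraction_sum_def glinearD(6)[OF gprod_linear(2)]
    by (intro sum.cong refl 1[symmetric])
  also have "(\<Sum>h\<in>halves ga. \<Sum>k\<in>halves gc. contraction ?W h k ?l) =
      ((-1) ^ (card (verts gb) * (card (verts ga) + 1)) *\<^sub>G
        gprod (gcls gb lb) (gbracket (gcls ga la) (gcls gc lc)) :: 'k graph_space)"
    unfolding gbracket_gcls[OF g(1) l(1) g(3) l(3) d(2)] contraction_sum_def glinearD(6)[OF gprod_linear(1)] G.scale_sum_right
    by (intro sum.cong refl) (simp add: 2 powneg1_mult del: G.scale_scale)
  finally show ?thesis .
qed

lemma gbracket_jacobi_gcls:
  assumes t: "disjoint_triple ga la gb lb gc lc"
  defines "a \<equiv> card (verts ga)" and "b \<equiv> card (verts gb)" and "c \<equiv> card (verts gc)"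
  shows "(-1) ^ a *\<^sub>G gbracket (gcls ga la) (gbracket (gcls gb lb) (gcls gc lc)) +
    (-1) ^ (c + c * (a + b)) *\<^sub>G gbracket (gcls gc lc) (gbracket (gcls ga la) (gcls gb lb)) +
    (-1) ^ (b + a * (b + c)) *\<^sub>G gbracket (gcls gb lb) (gbracket (gcls gc lc) (gcls ga la)) =
    (0 :: 'k::field_char_0 graph_space)"
proof -
  note g = disjoint_tripleD(1-3)[OF t] and d = disjoint_tripleD(4-6)[OF t] and l = disjoint_tripleD(7-9)[OF t]
  let ?W = "gunion ga (gunion gb gc)" and ?l = "ljoin la (ljoin lb lc)"
  note ds = disjoint_graphs_sym[OF d(1)] disjoint_graphs_sym[OF d(2)] disjoint_graphs_sym[OF d(3)]
  note bc = is_graph_gunion[OF g(2,3) d(3)] ljoin_labellings[OF g(2,3) d(3) l(2,3)]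
  note ab = is_graph_gunion[OF g(1,2) d(1)] ljoin_labellings[OF g(1,2) d(1) l(1,2)]
  note dd = disjoint_graphs_gunion(2)[OF d(1,2)] disjoint_graphs_gunion(2)[OF ds(2,3)]
  note lW = ljoin_labellings[OF g(1) bc(1) dd(1) l(1) bc(2)]
  let ?A = "halves ga" and ?B = "halves gb" and ?C = "halves gc"
  have W: "gunion gc (gunion ga gb) = ?W" "gunion gb (gunion gc ga) = ?W"
    using d by (auto simp: gunion_def disjoint_graphs_def)
  have card: "card (verts ga \<union> verts gb) = a + b" "card (verts gb \<union> verts gc) = b + c"
    unfolding a_def b_def c_def
    using is_graphD(1)[OF g(1)] is_graphD(1)[OF g(2)] is_graphD(1)[OF g(3)] d
    by (simp_all add: card_Un_disjoint disjoint_graphs_def)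
  note t2 = disjoint_triple_rotate[OF t]
  note t3 = disjoint_triple_rotate[OF t2]
  note T1 = gbracket_gbracket[OF t, where 'k = 'k]
  note T2 = gbracket_gbracket[OF t2, where 'k = 'k, unfolded W]
  note T3 = gbracket_gbracket[OF t3, where 'k = 'k, unfolded W]
  have 2: "contraction2_sum ?W ?C ?A ?B (ljoin lc (ljoin la lb)) =
      ((-1) ^ (c * (a + b)) *\<^sub>G contraction2_sum ?W ?C ?A ?B ?l :: 'k graph_space)"
    using alternating_ljoin_commute[OF g(3) ab(1) dd(2) l(3) ab(2), of "contraction2_sum ?W ?C ?A ?B :: _ \<Rightarrow> 'k graph_space"] T2(2)
    by (simp add: W ljoin_assoc card c_def)
  have 3: "contraction2_sum ?W ?B ?C ?A (ljoin lb (ljoin lc la)) =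
      ((-1) ^ (a * (b + c)) *\<^sub>G contraction2_sum ?W ?B ?C ?A ?l :: 'k graph_space)"
    using alternating_ljoin_commute[OF bc(1) g(1) disjoint_graphs_sym[OF dd(1)] bc(2) l(1),
        of "contraction2_sum ?W ?B ?C ?A :: _ \<Rightarrow> 'k graph_space"] T3(2)
    by (simp add: gunion_commute[OF dd(1)] ljoin_assoc card a_def mult.commute)
  have fin: "finite ?A" "finite ?B" "finite ?C" using is_graphD(2) g by auto
  have disj: "?A \<inter> ?B = {}" "?B \<inter> ?C = {}" "?C \<inter> ?A = {}"
    using d by (auto simp: disjoint_graphs_def)
  have lW': "?l \<in> labellings (gunion gc (gunion ga gb))" "?l \<in> labellings (gunion gb (gunion gc ga))"
    using lW by (simp_all add: W)
  have "contraction2_sum ?W ?A ?B ?C ?l + contraction2_sum ?W ?C ?A ?B ?l + contraction2_sum ?W ?B ?C ?A ?l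
      = (0 :: 'k graph_space)"
    using contraction2_cancel[OF t lW, where 'k = 'k]
      contraction2_cancel[OF t2 lW'(1), where 'k = 'k]
      contraction2_cancel[OF t3 lW'(2), where 'k = 'k]
    by (simp add: contraction2_sum_split fin disj W)
  moreover have "(-1) ^ (n + m) *\<^sub>G (-1) ^ n *\<^sub>G (-1) ^ m *\<^sub>G v = v" for n m and v :: "'k graph_space"
    by (simp add: power_add flip: power_mult_distrib) (simp add: algebra_simps flip: power_mult_distrib)
  moreover have "(-1) ^ n *\<^sub>G (-1) ^ n *\<^sub>G v = v" for n and v :: "'k graph_space"
    by (simp flip: power_mult_distrib)
  ultimately show ?thesis
    unfolding T1(1) T2(1) T3(1) 2 3 a_def[symmetric] b_def[symmetric] c_def[symmetric] by simp
qed

section \<open>The Gerstenhaber algebra\<close>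

lemma gcls_degree:
  assumes "is_graph g" "l \<in> labellings g"
  shows "gcls g l \<in> graph_degree (int (card (verts g)))"
  unfolding graph_degree_def gcls_def
  by (rule G.span_base) (use graph_of_oriented[OF assms] in \<open>auto simp: nverts_def\<close>)

lemma contraction_degree:
  assumes g: "is_graph g" and c: "contractible g h k" and l: "l \<in> labellings g"
  shows "(contraction g h k l :: 'k::field_char_0 graph_space) \<in> graph_degree (int (card (verts g)) - 1)"
proof -
  note hk = contractibleD[OF c]
  obtain r J where rJ: "(l, ([origin g h, origin g k] @ r, J)) \<in> (moves g)\<^sup>*" "{h, bar g k} \<subseteq> J"
    "([origin g h, origin g k] @ r, J) \<in> labellings g"
    by (rule moves_to_standard[OF g l contract_standard[OF g c]])
  obtain n where n: "(l, ([origin g h, origin g k] @ r, J)) \<in> moves g ^^ n"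
    using rJ(1) rtrancl_imp_relpow by metis
  let ?v = "gcls (contract_graph g h k) (origin g h # r, J - {h, k}) :: 'k graph_space"
  have "?v = (if even n then contraction g h k l else - contraction g h k l)"
    using alternating_relpow[OF g contraction_alternating[OF g c] l n, where 'k1 = 'k]
      contract_lift_standard(1)[OF g c rJ(3,2), of "gcls (contract_graph g h k) :: _ \<Rightarrow> 'k graph_space"]
    by (simp add: contraction_def)
  moreover have "?v \<in> graph_degree (int (card (verts g)) - 1)"
  proof -
    have "origin g k \<in> verts g" using is_graphD(3)[OF g] hk by simp
    then have "int (card (verts g - {origin g k})) = int (card (verts g)) - 1"
      using is_graphD(1)[OF g] card_gt_0_iff[of "verts g"] by (auto simp: card_Diff_singleton of_nat_diff)
    then show ?thesis
      using gcls_degree[OF is_graph_contract[OF g c] contract_labellings[OF g c rJ(3,2)], where 'a = 'k]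
      by (simp add: contract_graph_simps[OF g c])
  qed
  ultimately show ?thesis
    using G.subspace_neg[OF graph_degree_subspace, of ?v] by (auto split: if_splits)
qed

lemma disjoint_representatives:
  obtains ga la gb lb gc lc where "disjoint_triple ga la gb lb gc lc"
    "(cls X :: 'k::field_char_0 graph_space) = gcls ga la" "(cls Y :: 'k graph_space) = gcls gb lb"
    "(cls Z :: 'k graph_space) = gcls gc lc"
    "nverts X = card (verts ga)" "nverts Y = card (verts gb)" "nverts Z = card (verts gc)"
proof -
  define G where "G i = graph_of (if i = 0 then X else if i = 1 then Y else Z)" for i :: nat
  define f :: "nat \<Rightarrow> nat \<Rightarrow> nat" where "f i v = 3 * v + i" for i v
  have iso: "graph_iso (f i) (f i) (G i) (copy 3 G i)" if "i < 3" for i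
    using copy_iso[OF that, of G] by (simp add: f_def[abs_def])
  have rep: "\<exists>l. l \<in> labellings (copy 3 G i) \<and> (cls (if i = 0 then X else if i = 1 then Y else Z) :: 'k graph_space) =
      gcls (copy 3 G i) l" if i: "i < 3" for i
  proof -
    let ?X = "if i = 0 then X else if i = 1 then Y else Z"
    obtain l where l: "l \<in> or_of ?X" using or_of_nonempty by blast
    have lab: "l \<in> labellings (G i)" using or_of_subset[OF l] by (simp add: G_def)
    have "(cls ?X :: 'k graph_space) = gcls (G i) l" using cls_eq_gcls[OF l] by (simp only: G_def)
    also have "\<dots> = gcls (copy 3 G i) (relabel (f i) (f i) l)"
      by (rule gcls_relabel[OF _ iso[OF i] lab, symmetric]) (simp add: G_def)
    finally have "(cls ?X :: 'k graph_space) = gcls (copy 3 G i) (relabel (f i) (f i) l)" .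
    moreover have "is_graph (G i)" by (simp add: G_def)
    from relabel_mem[OF this iso[OF i] lab]
    have "relabel (f i) (f i) l \<in> labellings (copy 3 G i)" .
    ultimately show ?thesis by blast
  qed
  have gr: "is_graph (copy 3 G i)" if "i < 3" for i
    by (rule is_graph_iso[OF _ iso[OF that]]) (simp add: G_def)
  have card: "card (verts (copy 3 G i)) = card (verts (G i))" if "i < 3" for i
    using bij_betw_same_card[OF graph_isoD(1)[OF iso[OF that]]] by simp
  obtain la lb lc where l: "la \<in> labellings (copy 3 G 0)" "lb \<in> labellings (copy 3 G 1)"
    "lc \<in> labellings (copy 3 G 2)" "(cls X :: 'k graph_space) = gcls (copy 3 G 0) la"
    "(cls Y :: 'k graph_space) = gcls (copy 3 G 1) lb" "(cls Z :: 'k graph_space) = gcls (copy 3 G 2) lc"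
    using rep[of 0] rep[of 1] rep[of 2] by auto
  show thesis
  proof (rule that[OF _ l(4-6)])
    show "disjoint_triple (copy 3 G 0) la (copy 3 G 1) lb (copy 3 G 2) lc"
      using l(1-3) gr by (simp add: disjoint_triple_def copy_disjoint)
  qed (simp_all add: card nverts_def, simp_all add: G_def)
qed

lemma gprod_cls_assoc:
  "gprod (gprod (cls X) (cls Y)) (cls Z) = (gprod (cls X) (gprod (cls Y) (cls Z)) :: 'k::field_char_0 graph_space)"
proof -
  obtain ga la gb lb gc lc where t: "disjoint_triple ga la gb lb gc lc"
    and e: "(cls X :: 'k graph_space) = gcls ga la" "(cls Y :: 'k graph_space) = gcls gb lb"
    "(cls Z :: 'k graph_space) = gcls gc lc"
    "nverts X = card (verts ga)" "nverts Y = card (verts gb)" "nverts Z = card (verts gc)"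
    by (rule disjoint_representatives[where 'k = 'k and X = X and Y = Y and Z = Z])
  note g = disjoint_tripleD(1-3)[OF t] and d = disjoint_tripleD(4-6)[OF t] and l = disjoint_tripleD(7-9)[OF t]
  show ?thesis
    unfolding e gprod_gcls[OF g(1) l(1) g(2) l(2) d(1)] gprod_gcls[OF g(2) l(2) g(3) l(3) d(3)]
      gprod_gcls[OF g(1) l(1) is_graph_gunion[OF g(2,3) d(3)] ljoin_labellings[OF g(2,3) d(3) l(2,3)]
        disjoint_graphs_gunion(2)[OF d(1,2)]]
      gprod_gcls[OF is_graph_gunion[OF g(1,2) d(1)] ljoin_labellings[OF g(1,2) d(1) l(1,2)] g(3) l(3)
        disjoint_graphs_gunion(1)[OF d(2,3)]]
    by (simp add: gunion_assoc ljoin_assoc)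
qed

lemma cls_commute:
  shows "gprod (cls X) (cls Y) = ((-1) ^ (nverts X * nverts Y) *\<^sub>G gprod (cls Y) (cls X) :: 'k::field_char_0 graph_space)"
    and "gbracket (cls X) (cls Y) = ((-1) ^ (nverts X * nverts Y) *\<^sub>G gbracket (cls Y) (cls X) :: 'k graph_space)"
proof -
  obtain ga la gb lb gc lc where t: "disjoint_triple ga la gb lb gc lc"
    and e: "(cls X :: 'k graph_space) = gcls ga la" "(cls Y :: 'k graph_space) = gcls gb lb"
    "nverts X = card (verts ga)" "nverts Y = card (verts gb)"
    by (rule disjoint_representatives[where 'k = 'k and X = X and Y = Y and Z = Y])
  note g = disjoint_tripleD(1,2,4,7,8)[OF t]
  show "gprod (cls X) (cls Y) = ((-1) ^ (nverts X * nverts Y) *\<^sub>G gprod (cls Y) (cls X) :: 'k graph_space)"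
    unfolding e by (rule gprod_gcls_commute[OF g])
  show "gbracket (cls X) (cls Y) = ((-1) ^ (nverts X * nverts Y) *\<^sub>G gbracket (cls Y) (cls X) :: 'k graph_space)"
    unfolding e by (rule gbracket_gcls_commute[OF g])
qed

lemma gbracket_cls_leibniz:
  "gbracket (cls X) (gprod (cls Y) (cls Z)) = gprod (gbracket (cls X) (cls Y)) (cls Z) +
    ((-1) ^ (nverts Y * (nverts X + 1)) *\<^sub>G gprod (cls Y) (gbracket (cls X) (cls Z)) :: 'k::field_char_0 graph_space)"
proof -
  obtain ga la gb lb gc lc where t: "disjoint_triple ga la gb lb gc lc"
    and e: "(cls X :: 'k graph_space) = gcls ga la" "(cls Y :: 'k graph_space) = gcls gb lb"
    "(cls Z :: 'k graph_space) = gcls gc lc"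
    "nverts X = card (verts ga)" "nverts Y = card (verts gb)" "nverts Z = card (verts gc)"
    by (rule disjoint_representatives[where 'k = 'k and X = X and Y = Y and Z = Z])
  show ?thesis unfolding e by (rule gbracket_gprod_gcls[OF t])
qed

lemma gbracket_cls_jacobi:
  "(-1) ^ nverts X *\<^sub>G gbracket (cls X) (gbracket (cls Y) (cls Z)) +
    (-1) ^ (nverts Z + nverts Z * (nverts X + nverts Y)) *\<^sub>G gbracket (cls Z) (gbracket (cls X) (cls Y)) +
    (-1) ^ (nverts Y + nverts X * (nverts Y + nverts Z)) *\<^sub>G gbracket (cls Y) (gbracket (cls Z) (cls X)) =
    (0 :: 'k::field_char_0 graph_space)"
proof -
  obtain ga la gb lb gc lc where t: "disjoint_triple ga la gb lb gc lc"
    and e: "(cls X :: 'k graph_space) = gcls ga la" "(cls Y :: 'k graph_space) = gcls gb lb"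
    "(cls Z :: 'k graph_space) = gcls gc lc"
    "nverts X = card (verts ga)" "nverts Y = card (verts gb)" "nverts Z = card (verts gc)"
    by (rule disjoint_representatives[where 'k = 'k and X = X and Y = Y and Z = Z])
  show ?thesis unfolding e by (rule gbracket_jacobi_gcls[OF t])
qed

lemma glinear_span_mem:
  assumes "glinear T" "\<And>v. v \<in> A \<Longrightarrow> T v \<in> S" "G.subspace S" "v \<in> G.span A"
  shows "T v \<in> S"
  using assms(4)
proof (induction rule: G.span_induct)
  case base
  show ?case
    using glinearD(1-3)[OF assms(1)] assms(3) by (auto simp: G.subspace_def)
qed (use assms(2) in simp)

lemma bilinear_degree:
  fixes B :: "'k::field_char_0 graph_space \<Rightarrow> 'k graph_space \<Rightarrow> 'k graph_space"
  assumes B: "bilinear_map gscale B"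
    and XY: "\<And>X Y. int (nverts X) = i \<Longrightarrow> int (nverts Y) = j \<Longrightarrow> B (cls X) (cls Y) \<in> graph_degree n"
    and "u \<in> graph_degree i" "v \<in> graph_degree j"
  shows "B u v \<in> graph_degree n"
proof -
  have "B (cls X) v \<in> graph_degree n" if "int (nverts X) = i" for X
    by (rule glinear_span_mem[OF bilinear_mapD(1)[OF B] _ graph_degree_subspace assms(4)[unfolded graph_degree_def]])
      (use XY that in auto)
  then show ?thesis
    by (intro glinear_span_mem[OF bilinear_mapD(2)[OF B] _ graph_degree_subspace assms(3)[unfolded graph_degree_def]])
      auto
qed

lemma bilinear_eq_degree:
  fixes B C :: "'k::field_char_0 graph_space \<Rightarrow> 'k graph_space \<Rightarrow> 'k graph_space"
  assumes lin: "\<And>u. glinear (B u)" "\<And>v. glinear (\<lambda>u. B u v)" "\<And>u. glinear (C u)" "\<And>v. glinear (\<lambda>u. C u v)"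
    and eq: "\<And>X Y. int (nverts X) = i \<Longrightarrow> int (nverts Y) = j \<Longrightarrow> B (cls X) (cls Y) = C (cls X) (cls Y)"
    and u: "u \<in> graph_degree i" and v: "v \<in> graph_degree j"
  shows "B u v = C u v"
proof -
  have "B (cls X) v = C (cls X) v" if "int (nverts X) = i" for X
    by (rule glinear_eq_on_span[OF lin(1,3) _ v[unfolded graph_degree_def]]) (use eq that in auto)
  then show ?thesis
    by (intro glinear_eq_on_span[OF lin(2,4) _ u[unfolded graph_degree_def]]) auto
qed

lemma trilinear_eq_degree:
  fixes B C :: "'k::field_char_0 graph_space \<Rightarrow> 'k graph_space \<Rightarrow> 'k graph_space \<Rightarrow> 'k graph_space"
  assumes lin: "\<And>u v. glinear (B u v)" "\<And>u w. glinear (\<lambda>v. B u v w)" "\<And>v w. glinear (\<lambda>u. B u v w)"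
    "\<And>u v. glinear (C u v)" "\<And>u w. glinear (\<lambda>v. C u v w)" "\<And>v w. glinear (\<lambda>u. C u v w)"
    and eq: "\<And>X Y Z. int (nverts X) = i \<Longrightarrow> int (nverts Y) = j \<Longrightarrow> int (nverts Z) = k \<Longrightarrow>
      B (cls X) (cls Y) (cls Z) = C (cls X) (cls Y) (cls Z)"
    and u: "u \<in> graph_degree i" and v: "v \<in> graph_degree j" and w: "w \<in> graph_degree k"
  shows "B u v w = C u v w"
proof -
  have "B (cls X) v w = C (cls X) v w" if "int (nverts X) = i" for X
    by (rule bilinear_eq_degree[OF lin(1,2,4,5) _ v w]) (use eq that in auto)
  then show ?thesis
    by (intro glinear_eq_on_span[OF lin(3,6) _ u[unfolded graph_degree_def]]) auto
qed

lemma glinear_comp: "glinear S \<Longrightarrow> glinear T \<Longrightarrow> glinear (\<lambda>v. S (T v))"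
  by (simp add: glinear_iff)

lemma gprod_degree:
  assumes "u \<in> graph_degree i" "v \<in> graph_degree j"
  shows "gprod u v \<in> (graph_degree (i + j) :: 'k::field_char_0 graph_space set)"
proof (rule bilinear_degree[OF bilinear_gprod _ assms])
  fix X Y assume n: "int (nverts X) = i" "int (nverts Y) = j"
  show "gprod (cls X) (cls Y) \<in> (graph_degree (i + j) :: 'k graph_space set)"
  proof -
    obtain ga la gb lb gc lc where t: "disjoint_triple ga la gb lb gc lc"
      and e: "(cls X :: 'k graph_space) = gcls ga la" "(cls Y :: 'k graph_space) = gcls gb lb"
      "nverts X = card (verts ga)" "nverts Y = card (verts gb)"
      by (rule disjoint_representatives[where 'k = 'k and X = X and Y = Y and Z = Y])
    note g = disjoint_tripleD(1,2)[OF t] and d = disjoint_tripleD(4)[OF t] and l = disjoint_tripleD(7,8)[OF t]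
    have "int (card (verts ga \<union> verts gb)) = i + j"
      using d n e(3,4) is_graphD(1)[OF g(1)] is_graphD(1)[OF g(2)]
      by (simp add: card_Un_disjoint disjoint_graphs_def)
    then show ?thesis
      unfolding e gprod_gcls[OF g(1) l(1) g(2) l(2) d]
      using gcls_degree[OF is_graph_gunion[OF g d] ljoin_labellings[OF g d l], where 'a = 'k] by simp
  qed
qed

lemma gbracket_degree:
  assumes "u \<in> graph_degree i" "v \<in> graph_degree j"
  shows "gbracket u v \<in> (graph_degree (i + j - 1) :: 'k::field_char_0 graph_space set)"
proof (rule bilinear_degree[OF bilinear_gbracket _ assms])
  fix X Y assume n: "int (nverts X) = i" "int (nverts Y) = j"
  show "gbracket (cls X) (cls Y) \<in> (graph_degree (i + j - 1) :: 'k graph_space set)"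
  proof -
    obtain ga la gb lb gc lc where t: "disjoint_triple ga la gb lb gc lc"
      and e: "(cls X :: 'k graph_space) = gcls ga la" "(cls Y :: 'k graph_space) = gcls gb lb"
      "nverts X = card (verts ga)" "nverts Y = card (verts gb)"
      by (rule disjoint_representatives[where 'k = 'k and X = X and Y = Y and Z = Y])
    note g = disjoint_tripleD(1,2)[OF t] and d = disjoint_tripleD(4)[OF t] and l = disjoint_tripleD(7,8)[OF t]
    have "int (card (verts (gunion ga gb))) = i + j"
      using d n e(3,4) is_graphD(1)[OF g(1)] is_graphD(1)[OF g(2)]
      by (simp add: card_Un_disjoint disjoint_graphs_def)
    then have "(contraction (gunion ga gb) h k (ljoin la lb) :: 'k graph_space) \<in> graph_degree (i + j - 1)"
      if "h \<in> halves ga" "k \<in> halves gb" for h k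
      using contraction_degree[OF is_graph_gunion[OF g d] contractible_gunion(3)[OF d g that]
          ljoin_labellings[OF g d l], where 'k = 'k] by simp
    then show ?thesis
      unfolding e gbracket_gcls[OF g(1) l(1) g(2) l(2) d] contraction_sum_def
      by (intro G.subspace_sum[OF graph_degree_subspace])
  qed
qed

lemma gbracket_phi_facts:
  shows bilinear_extension_gbracket_phi: "bilinear_extension (\<lambda>X Y. (-1) ^ nverts X *\<^sub>G gbracket (cls X) (cls Y))
      (gbracket_phi :: 'k::field_char_0 graph_space \<Rightarrow> _)"
    and bilinear_gbracket_phi: "bilinear_map gscale (gbracket_phi :: 'k graph_space \<Rightarrow> _)"
    and gbracket_phi_cls: "gbracket_phi (cls X) v = ((-1) ^ nverts X *\<^sub>G gbracket (cls X) v :: 'k graph_space)"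
proof -
  obtain C :: "'k graph_space \<Rightarrow> 'k graph_space \<Rightarrow> 'k graph_space"
    where C: "bilinear_extension (\<lambda>X Y. (-1) ^ nverts X *\<^sub>G gbracket (cls X) (cls Y)) C"
    using bilinear_extension_scale[OF bilinear_gbracket] by blast
  have "gbracket_phi = C" unfolding gbracket_phi_def by (rule bilinear_extension_The[OF C])
  then show ext: "bilinear_extension (\<lambda>X Y. (-1) ^ nverts X *\<^sub>G gbracket (cls X) (cls Y))
      (gbracket_phi :: 'k graph_space \<Rightarrow> _)"
    using C by simp
  then show bil: "bilinear_map gscale (gbracket_phi :: 'k graph_space \<Rightarrow> _)"
    by (simp add: bilinear_extension_def)
  show "gbracket_phi (cls X) v = ((-1) ^ nverts X *\<^sub>G gbracket (cls X) v :: 'k graph_space)"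
    by (rule glinear_eqI[OF bilinear_mapD(1)[OF bil] glinear_comp[OF glinear_scale gbracket_linear(1)]])
      (use ext in \<open>simp add: bilinear_extension_def\<close>)
qed

lemmas gbracket_phi_linear = bilinear_mapD[OF bilinear_gbracket_phi]

lemma gbracket_phi_degree:
  assumes "u \<in> graph_degree i" "v \<in> graph_degree j"
  shows "gbracket_phi u v \<in> (graph_degree (i + j - 1) :: 'k::field_char_0 graph_space set)"
proof (rule bilinear_degree[OF bilinear_gbracket_phi _ assms])
  fix X Y assume n: "int (nverts X) = i" "int (nverts Y) = j"
  have "cls X \<in> (graph_degree i :: 'k graph_space set)" "cls Y \<in> (graph_degree j :: 'k graph_space set)"
    unfolding graph_degree_def using n by (auto intro!: G.span_base)
  from gbracket_degree[OF this]
  show "gbracket_phi (cls X) (cls Y) \<in> (graph_degree (i + j - 1) :: 'k graph_space set)"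
    unfolding gbracket_phi_cls by (rule G.subspace_scale[OF graph_degree_subspace])
qed

lemma neg_one_powi: "(-1 :: 'k::field) powi n = (if even n then 1 else - 1)"
  by (simp add: power_int_minus_left)

lemma gbracket_phi_cls_commute:
  "gbracket_phi (cls X) (cls Y) =
    - ((-1) powi (shifted_degree X * shifted_degree Y) *\<^sub>G gbracket_phi (cls Y) (cls X) :: 'k::field_char_0 graph_space)"
  unfolding gbracket_phi_cls cls_commute(2)[of X Y]
  by (simp add: shifted_degree_def neg_one_powi minus_one_power_iff)

lemma gbracket_phi_cls_leibniz:
  "gbracket_phi (cls X) (gprod (cls Y) (cls Z)) = gprod (gbracket_phi (cls X) (cls Y)) (cls Z) +
    ((-1) powi (shifted_degree X * (shifted_degree Y + 1)) *\<^sub>G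
       gprod (cls Y) (gbracket_phi (cls X) (cls Z)) :: 'k::field_char_0 graph_space)"
  unfolding gbracket_phi_cls gbracket_cls_leibniz glinearD(2)[OF gprod_linear(1)] glinearD(2)[OF gprod_linear(2)]
  by (auto simp: shifted_degree_def neg_one_powi minus_one_power_iff G.scale_right_distrib)

lemma gbracket_phi_cls_jacobi:
  "gbracket_phi (cls X) (gbracket_phi (cls Y) (cls Z)) +
    (-1) powi (shifted_degree Z * (shifted_degree X + shifted_degree Y)) *\<^sub>G
      gbracket_phi (cls Z) (gbracket_phi (cls X) (cls Y)) +
    (-1) powi (shifted_degree X * (shifted_degree Y + shifted_degree Z)) *\<^sub>G
      gbracket_phi (cls Y) (gbracket_phi (cls Z) (cls X)) = (0 :: 'k::field_char_0 graph_space)"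
proof -
  have "(-1) ^ nverts Y *\<^sub>G ((-1) ^ nverts X *\<^sub>G gbracket (cls X) (gbracket (cls Y) (cls Z)) +
    (-1) ^ (nverts Z + nverts Z * (nverts X + nverts Y)) *\<^sub>G gbracket (cls Z) (gbracket (cls X) (cls Y)) +
    (-1) ^ (nverts Y + nverts X * (nverts Y + nverts Z)) *\<^sub>G gbracket (cls Y) (gbracket (cls Z) (cls X))) =
    (0 :: 'k graph_space)"
    unfolding gbracket_cls_jacobi by simp
  then show ?thesis
    unfolding gbracket_phi_cls glinearD(2)[OF gbracket_linear(1)] G.scale_right_distrib
    by (cases "even (nverts X)"; cases "even (nverts Y)"; cases "even (nverts Z)")
      (simp_all add: shifted_degree_def neg_one_powi minus_one_power_iff)
qed

lemmas product_simps =
  glinearD(1,2)[OF gprod_linear(1)] glinearD(1,2)[OF gprod_linear(2)]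
  glinearD(1,2)[OF gbracket_phi_linear(1)] glinearD(1,2)[OF gbracket_phi_linear(2)]
  G.scale_right_distrib

lemma graded_commutative_product_gprod:
  "graded_commutative_product gscale graph_degree (gprod :: 'k::field_char_0 graph_space \<Rightarrow> _)"
  unfolding graded_commutative_product_def
proof (intro conjI allI ballI)
  show "bilinear_map gscale (gprod :: 'k graph_space \<Rightarrow> _)" by (rule bilinear_gprod)
next
  fix i j and u v :: "'k graph_space"
  assume u: "u \<in> graph_degree i" and v: "v \<in> graph_degree j"
  show "gprod u v \<in> graph_degree (i + j)" by (rule gprod_degree[OF u v])
  show "gprod u v = (-1) powi (i * j) *\<^sub>G gprod v u"
  proof (rule bilinear_eq_degree[where B = gprod and C = "\<lambda>u v. (-1) powi (i * j) *\<^sub>G gprod v u", OF _ _ _ _ _ u v])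
    fix X Y assume n: "int (nverts X) = i" "int (nverts Y) = j"
    show "gprod (cls X) (cls Y) = ((-1) powi (i * j) *\<^sub>G gprod (cls Y) (cls X) :: 'k graph_space)"
      unfolding cls_commute(1)[of X Y] n[symmetric] by (simp add: neg_one_powi minus_one_power_iff)
  qed (simp_all add: glinear_iff product_simps ac_simps)
next
  fix u v w :: "'k graph_space"
  have 1: "gprod (gprod (cls X) (cls Y)) w = gprod (cls X) (gprod (cls Y) w)" for X Y
    by (rule glinear_eqI[where S = "\<lambda>w. gprod (gprod (cls X) (cls Y)) w" and T = "\<lambda>w. gprod (cls X) (gprod (cls Y) w)"])
      (simp_all add: glinear_iff product_simps gprod_cls_assoc)
  have 2: "gprod (gprod (cls X) v) w = gprod (cls X) (gprod v w)" for X
    by (rule glinear_eqI[where S = "\<lambda>v. gprod (gprod (cls X) v) w" and T = "\<lambda>v. gprod (cls X) (gprod v w)"])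
      (simp_all add: glinear_iff product_simps 1)
  show "gprod (gprod u v) w = gprod u (gprod v w)"
    by (rule glinear_eqI[where S = "\<lambda>u. gprod (gprod u v) w" and T = "\<lambda>u. gprod u (gprod v w)"])
      (simp_all add: glinear_iff product_simps 2)
qed

lemma graded_lie_bracket_gbracket_phi:
  "graded_lie_bracket gscale (shift_down graph_degree) (gbracket_phi :: 'k::field_char_0 graph_space \<Rightarrow> _)"
  unfolding graded_lie_bracket_def shift_down_def
proof (intro conjI allI ballI)
  show "bilinear_map gscale (gbracket_phi :: 'k graph_space \<Rightarrow> _)" by (rule bilinear_gbracket_phi)
next
  fix i j and u v :: "'k graph_space"
  assume u: "u \<in> graph_degree (i + 1)" and v: "v \<in> graph_degree (j + 1)"
  show "gbracket_phi u v \<in> graph_degree (i + j + 1)"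
    using gbracket_phi_degree[OF u v] by (simp add: algebra_simps)
  show "gbracket_phi u v = - ((-1) powi (i * j) *\<^sub>G gbracket_phi v u)"
  proof (rule bilinear_eq_degree[where B = gbracket_phi and
        C = "\<lambda>u v. - ((-1) powi (i * j) *\<^sub>G gbracket_phi v u)", OF _ _ _ _ _ u v])
    fix X Y assume n: "int (nverts X) = i + 1" "int (nverts Y) = j + 1"
    have "shifted_degree X = i" "shifted_degree Y = j" using n by (simp_all add: shifted_degree_def)
    then show "gbracket_phi (cls X) (cls Y) = - ((-1) powi (i * j) *\<^sub>G gbracket_phi (cls Y) (cls X) :: 'k graph_space)"
      using gbracket_phi_cls_commute[of X Y, where 'k = 'k] by simp
  qed (simp_all add: glinear_iff product_simps ac_simps)
next
  fix i j k and u v w :: "'k graph_space"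
  assume u: "u \<in> graph_degree (i + 1)" and v: "v \<in> graph_degree (j + 1)" and w: "w \<in> graph_degree (k + 1)"
  let ?J = "\<lambda>u v w :: 'k graph_space. gbracket_phi u (gbracket_phi v w) +
      (-1) powi (k * (i + j)) *\<^sub>G gbracket_phi w (gbracket_phi u v) +
      (-1) powi (i * (j + k)) *\<^sub>G gbracket_phi v (gbracket_phi w u)"
  show "?J u v w = 0"
  proof (rule trilinear_eq_degree[where B = ?J and C = "\<lambda>_ _ _. 0", OF _ _ _ _ _ _ _ u v w])
    fix X Y Z assume n: "int (nverts X) = i + 1" "int (nverts Y) = j + 1" "int (nverts Z) = k + 1"
    have "shifted_degree X = i" "shifted_degree Y = j" "shifted_degree Z = k"
      using n by (simp_all add: shifted_degree_def)
    then show "?J (cls X) (cls Y) (cls Z) = 0"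
      using gbracket_phi_cls_jacobi[of X Y Z, where 'k = 'k] by simp
  qed (simp_all add: glinear_iff product_simps ac_simps)
qed

theorem proposition4p6:
  shows "bilinear_extension (\<lambda>X Y. cls (X \<odot> Y)) (gprod :: 'k::field_char_0 graph_space \<Rightarrow> _) \<and>
    bilinear_extension ograph_bracket (gbracket :: 'k graph_space \<Rightarrow> _) \<and>
    bilinear_extension (\<lambda>X Y. (-1) ^ nverts X *\<^sub>G gbracket (cls X) (cls Y))
      (gbracket_phi :: 'k graph_space \<Rightarrow> _) \<and>
    gerstenhaber_algebra gscale (shift_down graph_degree)
      (gprod :: 'k graph_space \<Rightarrow> _) gbracket_phi \<and>
    (\<forall>X Y Z. gbracket_phi (cls X) (gprod (cls Y) (cls Z)) =
       gprod (gbracket_phi (cls X) (cls Y)) (cls Z) +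
       (-1) powi (shifted_degree X * (shifted_degree Y + 1)) *\<^sub>G
         gprod (cls Y) (gbracket_phi (cls X) (cls Z) :: 'k graph_space))"
proof (intro conjI allI)
  show "gerstenhaber_algebra gscale (shift_down graph_degree) (gprod :: 'k graph_space \<Rightarrow> _) gbracket_phi"
    unfolding gerstenhaber_algebra_def
  proof (intro conjI allI ballI)
    show "graded_space gscale (shift_down graph_degree :: int \<Rightarrow> 'k graph_space set)"
      by (rule graded_space_graph_degree)
    show "graded_commutative_product gscale (\<lambda>n. shift_down graph_degree (n - 1)) (gprod :: 'k graph_space \<Rightarrow> _)"
      using graded_commutative_product_gprod by (simp add: shift_down_def)
    show "graded_lie_bracket gscale (shift_down graph_degree) (gbracket_phi :: 'k graph_space \<Rightarrow> _)"
      by (rule graded_lie_bracket_gbracket_phi)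
    fix i j k and u v w :: "'k graph_space"
    assume uvw: "u \<in> shift_down graph_degree i" "v \<in> shift_down graph_degree j" "w \<in> shift_down graph_degree k"
    let ?R = "\<lambda>u v w :: 'k graph_space. gprod (gbracket_phi u v) w + (-1) powi (i * (j + 1)) *\<^sub>G gprod v (gbracket_phi u w)"
    show "gbracket_phi u (gprod v w) = ?R u v w"
    proof (rule trilinear_eq_degree[where B = "\<lambda>u v w. gbracket_phi u (gprod v w)" and C = ?R,
          OF _ _ _ _ _ _ _ uvw[unfolded shift_down_def]])
      fix X Y Z assume n: "int (nverts X) = i + 1" "int (nverts Y) = j + 1"
      have "shifted_degree X = i" "shifted_degree Y = j" using n by (simp_all add: shifted_degree_def)
      then show "gbracket_phi (cls X) (gprod (cls Y) (cls Z)) = ?R (cls X) (cls Y) (cls Z)"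
        using gbracket_phi_cls_leibniz[of X Y Z, where 'k = 'k] by simp
    qed (simp_all add: glinear_iff product_simps ac_simps)
  qed
qed (rule bilinear_extension_gprod bilinear_extension_gbracket bilinear_extension_gbracket_phi gbracket_phi_cls_leibniz)+

end
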